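(* Let $\mathbb{K}$ be a field and let $\mathcal{T}$ be a Lawvere theory. The category $[\mathcal{T},\mathsf{Coalg}_{coc}]$ of coalgebraic models of $\mathcal{T}$ is a category of $\Omega$-Hopf algebras if and only if it is pointed and there exists an algebraic functor $[\mathcal{T},\mathsf{Coalg}_{coc}]\to\mathsf{Hopf}_{coc}$.
   Context: $\mathsf{Coalg}_{coc}$ is the category of coassociative, counital, cocommutative coalgebras over $\mathbb{K}$ and coalgebra homomorphisms; its finite products are given by $\otimes_{\mathbb{K}}$ and its terminal object is $\mathbb{K}$. A Lawvere theory $\mathcal{T}$ is a small category with finite products whose objects are the powers $T^0,T^1=T,T^2,\dots$ of one object $T$. A morphism of Lawvere theories is a product-preserving functor sending the $n$-th power of the generating object to the $n$-th power of the generating object. $[\mathcal{T},\mathsf{Coalg}_{coc}]$ is the category of finite-product-preserving functors $\mathcal{T}\to\mathsf{Coalg}_{coc}$ and natural transformations (coalgebraic models of $\mathcal{T}$). An algebraic functor $[\mathcal{T},\mathsf{Coalg}_{coc}]\to[\mathcal{S},\mathsf{Coalg}_{coc}]$ is a functor given by precomposition with a morphism of Lawvere theories $\mathcal{S}\to\mathcal{T}$. $\mathsf{Hopf}_{coc}$ is the category of cocommutative Hopf algebras over $\mathbb{K}$, identified with $[\mathcal{T}_{\mathsf{Grp}},\mathsf{Coalg}_{coc}]$, where $\mathcal{T}_{\mathsf{Grp}}$ is the Lawvere theory of groups. An $\Omega$-group is a group with a set of additional operations of positive arity such that every operation $f$ satisfies $f(u,\dots,u)=u$, where $u$ is the neutral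 element of the group. $\mathcal{T}$ is the Lawvere theory of a variety of $\Omega$-groups if it has morphisms $\cdot\colon T^2\to T$, $1\colon T^0\to T$, $S\colon T\to T$ satisfying the group axioms, $1$ is the only morphism $T^0\to T$, and every morphism $f\colon T^n\to T$ satisfies $f\circ(1,\dots,1)=1$. A category of $\Omega$-Hopf algebras is a category of coalgebraic models of a Lawvere theory of a variety of $\Omega$-groups. A category is pointed if it has a zero object. *)

theory Defs
  imports "HOL-Algebra.Module" "HOL-Algebra.AbelCoset" "HOL-Library.Equipollence" "HOL-Library.FuncSet"
begin

section \<open>Categories, functors, natural transformations\<close>

record ('o, 'a) cat =
  Obj :: "'o set"
  Arr :: "'a set"
  Dom :: "'a \<Rightarrow> 'o"
  Cod :: "'a \<Rightarrow> 'o"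
  Ident :: "'o \<Rightarrow> 'a"
  Comp :: "'a \<Rightarrow> 'a \<Rightarrow> 'a"  (infixr \<open>\<cdot>\<index>\<close> 75)

definition Hom :: "('o, 'a) cat \<Rightarrow> 'o \<Rightarrow> 'o \<Rightarrow> 'a set" where
  "Hom C A B = {f \<in> Arr C. Dom C f = A \<and> Cod C f = B}"

locale category =
  fixes C :: "('o, 'a) cat" (structure)
  assumes dom_obj: "f \<in> Arr C \<Longrightarrow> Dom C f \<in> Obj C"
    and cod_obj: "f \<in> Arr C \<Longrightarrow> Cod C f \<in> Obj C"
    and ident_hom: "A \<in> Obj C \<Longrightarrow> Ident C A \<in> Hom C A A"
    and comp_hom: "\<lbrakk>f \<in> Hom C A B; g \<in> Hom C B D\<rbrakk> \<Longrightarrow> g \<cdot> f \<in> Hom C A D"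
    and ident_left: "f \<in> Hom C A B \<Longrightarrow> Ident C B \<cdot> f = f"
    and ident_right: "f \<in> Hom C A B \<Longrightarrow> f \<cdot> Ident C A = f"
    and comp_assoc: "\<lbrakk>f \<in> Hom C A B; g \<in> Hom C B D; h \<in> Hom C D E\<rbrakk> \<Longrightarrow> (h \<cdot> g) \<cdot> f = h \<cdot> (g \<cdot> f)"

definition zero_object :: "('o, 'a) cat \<Rightarrow> 'o \<Rightarrow> bool" where
  "zero_object C Z \<longleftrightarrow> Z \<in> Obj C \<and>
     (\<forall>A \<in> Obj C. (\<exists>!f. f \<in> Hom C Z A) \<and> (\<exists>!f. f \<in> Hom C A Z))"

definition pointed :: "('o, 'a) cat \<Rightarrow> bool" where
  "pointed C \<longleftrightarrow> (\<exists>Z. zero_object C Z)"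

text \<open>\<open>P\<close> with projections \<open>p 0, \<dots>, p (n - 1)\<close> is a product of \<open>A 0, \<dots>, A (n - 1)\<close>;
  for \<open>n = 0\<close> this says that \<open>P\<close> is terminal.\<close>

definition is_product ::
  "('o, 'a) cat \<Rightarrow> nat \<Rightarrow> (nat \<Rightarrow> 'o) \<Rightarrow> 'o \<Rightarrow> (nat \<Rightarrow> 'a) \<Rightarrow> bool" where
  "is_product C n A P p \<longleftrightarrow> P \<in> Obj C \<and> (\<forall>i<n. p i \<in> Hom C P (A i)) \<and>
     (\<forall>X \<in> Obj C. \<forall>f. (\<forall>i<n. f i \<in> Hom C X (A i)) \<longrightarrow>
        (\<exists>!h. h \<in> Hom C X P \<and> (\<forall>i<n. p i \<cdot>\<^bsub>C\<^esub> h = f i)))"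

text \<open>The maps of functors and natural transformations are extensional, so that
  equality of these records is equality of functors and natural transformations.\<close>

record ('o, 'a, 'p, 'b) fctr =
  Src :: "('o, 'a) cat"
  Trg :: "('p, 'b) cat"
  OMap :: "'o \<Rightarrow> 'p"
  AMap :: "'a \<Rightarrow> 'b"

definition is_functor ::
  "('o, 'a) cat \<Rightarrow> ('p, 'b) cat \<Rightarrow> ('o, 'a, 'p, 'b) fctr \<Rightarrow> bool" where
  "is_functor C D F \<longleftrightarrow> Src F = C \<and> Trg F = D \<and>
     OMap F \<in> Obj C \<rightarrow>\<^sub>E Obj D \<and> AMap F \<in> Arr C \<rightarrow>\<^sub>E Arr D \<and>
     (\<forall>f \<in> Arr C. Dom D (AMap F f) = OMap F (Dom C f) \<and> Cod D (AMap F f) = OMap F (Cod C f)) \<and>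
     (\<forall>A \<in> Obj C. AMap F (Ident C A) = Ident D (OMap F A)) \<and>
     (\<forall>f \<in> Arr C. \<forall>g \<in> Arr C. Dom C g = Cod C f \<longrightarrow>
        AMap F (g \<cdot>\<^bsub>C\<^esub> f) = AMap F g \<cdot>\<^bsub>D\<^esub> AMap F f)"

definition functor_comp ::
  "('p, 'b, 'q, 'c) fctr \<Rightarrow> ('o, 'a, 'p, 'b) fctr \<Rightarrow> ('o, 'a, 'q, 'c) fctr" where
  "functor_comp G F = \<lparr>Src = Src F, Trg = Trg G,
     OMap = compose (Obj (Src F)) (OMap G) (OMap F),
     AMap = compose (Arr (Src F)) (AMap G) (AMap F)\<rparr>"

definition preserves_finite_products :: "('o, 'a, 'p, 'b) fctr \<Rightarrow> bool" where
  "preserves_finite_products F \<longleftrightarrow> (\<forall>n A P p. is_product (Src F) n A P p \<longrightarrow>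
     is_product (Trg F) n (\<lambda>i. OMap F (A i)) (OMap F P) (\<lambda>i. AMap F (p i)))"

record ('o, 'a, 'p, 'b) ntrans =
  NSrc :: "('o, 'a, 'p, 'b) fctr"
  NTrg :: "('o, 'a, 'p, 'b) fctr"
  Component :: "'o \<Rightarrow> 'b"

definition is_ntrans ::
  "('o, 'a) cat \<Rightarrow> ('p, 'b) cat \<Rightarrow> ('o, 'a, 'p, 'b) ntrans \<Rightarrow> bool" where
  "is_ntrans C D \<eta> \<longleftrightarrow> is_functor C D (NSrc \<eta>) \<and> is_functor C D (NTrg \<eta>) \<and>
     Component \<eta> \<in> extensional (Obj C) \<and>
     (\<forall>A \<in> Obj C. Component \<eta> A \<in> Hom D (OMap (NSrc \<eta>) A) (OMap (NTrg \<eta>) A)) \<and>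
     (\<forall>f \<in> Arr C. AMap (NTrg \<eta>) f \<cdot>\<^bsub>D\<^esub> Component \<eta> (Dom C f)
                  = Component \<eta> (Cod C f) \<cdot>\<^bsub>D\<^esub> AMap (NSrc \<eta>) f)"

definition product_functor_category ::
  "('o, 'a) cat \<Rightarrow> ('p, 'b) cat \<Rightarrow> (('o, 'a, 'p, 'b) fctr, ('o, 'a, 'p, 'b) ntrans) cat" where
  "product_functor_category C D =
     (let objs = {F. is_functor C D F \<and> preserves_finite_products F} in
     \<lparr>Obj = objs,
      Arr = {\<eta>. is_ntrans C D \<eta> \<and> NSrc \<eta> \<in> objs \<and> NTrg \<eta> \<in> objs},
      Dom = NSrc,
      Cod = NTrg,
      Ident = (\<lambda>F. \<lparr>NSrc = F, NTrg = F, Component = (\<lambda>A\<in>Obj C. Ident D (OMap F A))\<rparr>),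
      Comp = (\<lambda>\<theta> \<eta>. \<lparr>NSrc = NSrc \<eta>, NTrg = NTrg \<theta>,
                Component = (\<lambda>A\<in>Obj C. Component \<theta> A \<cdot>\<^bsub>D\<^esub> Component \<eta> A)\<rparr>)\<rparr>)"


section \<open>Lawvere theories\<close>

text \<open>\<open>pow T n\<close> is the power $T^n$ of the generating object \<open>pow T 1\<close>, and
  \<open>prj T n i\<close>, for \<open>i < n\<close>, are its projections. All finite products exist in the base
  category, since $T^{m+n}$ is a product of $T^m$ and $T^n$. Smallness is expressed relative
  to a universe, where it is needed.\<close>

record ('o, 'a) lawvere =
  base :: "('o, 'a) cat"
  pow :: "nat \<Rightarrow> 'o"
  prj :: "nat \<Rightarrow> nat \<Rightarrow> 'a"

definition lawvere_theory :: "('o, 'a) lawvere \<Rightarrow> bool" where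
  "lawvere_theory T \<longleftrightarrow> category (base T) \<and> Obj (base T) = range (pow T) \<and>
     (\<forall>n. is_product (base T) n (\<lambda>_. pow T 1) (pow T n) (prj T n))"

definition theory_morphism ::
  "('o, 'a) lawvere \<Rightarrow> ('p, 'b) lawvere \<Rightarrow> ('o, 'a, 'p, 'b) fctr \<Rightarrow> bool" where
  "theory_morphism S T F \<longleftrightarrow> is_functor (base S) (base T) F \<and>
     preserves_finite_products F \<and> (\<forall>n. OMap F (pow S n) = pow T n)"

definition tuple :: "('o, 'a) lawvere \<Rightarrow> nat \<Rightarrow> 'o \<Rightarrow> (nat \<Rightarrow> 'a) \<Rightarrow> 'a" where
  "tuple T n X f = (THE h. h \<in> Hom (base T) X (pow T n) \<and>
     (\<forall>i<n. prj T n i \<cdot>\<^bsub>base T\<^esub> h = f i))"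

definition pair :: "('o, 'a) lawvere \<Rightarrow> 'o \<Rightarrow> 'a \<Rightarrow> 'a \<Rightarrow> 'a" where
  "pair T X f g = tuple T 2 X (\<lambda>i. if i = 0 then f else g)"

definition bang :: "('o, 'a) lawvere \<Rightarrow> 'o \<Rightarrow> 'a" where
  "bang T X = tuple T 0 X (\<lambda>_. undefined)"

definition group_structure :: "('o, 'a) lawvere \<Rightarrow> 'a \<Rightarrow> 'a \<Rightarrow> 'a \<Rightarrow> bool" where
  "group_structure T m e s \<longleftrightarrow>
    (let B = base T; G = pow T 1; G3 = pow T 3; \<pi> = prj T 3;
         one = Ident B G; e' = e \<cdot>\<^bsub>B\<^esub> bang T G in
     m \<in> Hom B (pow T 2) G \<and> e \<in> Hom B (pow T 0) G \<and> s \<in> Hom B G G \<and>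
     m \<cdot>\<^bsub>B\<^esub> pair T G3 (m \<cdot>\<^bsub>B\<^esub> pair T G3 (\<pi> 0) (\<pi> 1)) (\<pi> 2)
       = m \<cdot>\<^bsub>B\<^esub> pair T G3 (\<pi> 0) (m \<cdot>\<^bsub>B\<^esub> pair T G3 (\<pi> 1) (\<pi> 2)) \<and>
     m \<cdot>\<^bsub>B\<^esub> pair T G e' one = one \<and> m \<cdot>\<^bsub>B\<^esub> pair T G one e' = one \<and>
     m \<cdot>\<^bsub>B\<^esub> pair T G s one = e' \<and> m \<cdot>\<^bsub>B\<^esub> pair T G one s = e')"

definition Omega_group_theory :: "('o, 'a) lawvere \<Rightarrow> bool" where
  "Omega_group_theory T \<longleftrightarrow> lawvere_theory T \<and>
     (\<exists>m e s. group_structure T m e s \<and> Hom (base T) (pow T 0) (pow T 1) = {e} \<and>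
        (\<forall>n. \<forall>f \<in> Hom (base T) (pow T n) (pow T 1).
           f \<cdot>\<^bsub>base T\<^esub> tuple T n (pow T 0) (\<lambda>_. e) = e))"


section \<open>The Lawvere theory of groups\<close>

datatype 'x gterm = GVar 'x | GOne | GInv "'x gterm" | GMul "'x gterm" "'x gterm"

primrec gsubst :: "('x \<Rightarrow> 'y gterm) \<Rightarrow> 'x gterm \<Rightarrow> 'y gterm" where
  "gsubst \<sigma> (GVar x) = \<sigma> x"
| "gsubst \<sigma> GOne = GOne"
| "gsubst \<sigma> (GInv t) = GInv (gsubst \<sigma> t)"
| "gsubst \<sigma> (GMul t u) = GMul (gsubst \<sigma> t) (gsubst \<sigma> u)"

definition gterms :: "nat \<Rightarrow> nat gterm set" where
  "gterms m = {t. set_gterm t \<subseteq> {..<m}}"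

text \<open>Derivability of \<open>t = u\<close> from the group axioms, for terms in the variables
  \<open>0, \<dots>, m - 1\<close>. The quotient of \<open>gterms m\<close> is the free group on \<open>m\<close> generators.\<close>

inductive geq :: "nat \<Rightarrow> nat gterm \<Rightarrow> nat gterm \<Rightarrow> bool" for m where
  geq_refl: "t \<in> gterms m \<Longrightarrow> geq m t t"
| geq_sym: "geq m t u \<Longrightarrow> geq m u t"
| geq_trans: "\<lbrakk>geq m t u; geq m u v\<rbrakk> \<Longrightarrow> geq m t v"
| geq_inv: "geq m t u \<Longrightarrow> geq m (GInv t) (GInv u)"
| geq_mul: "\<lbrakk>geq m t u; geq m t' u'\<rbrakk> \<Longrightarrow> geq m (GMul t t') (GMul u u')"
| geq_assoc: "\<lbrakk>t \<in> gterms m; u \<in> gterms m; v \<in> gterms m\<rbrakk> \<Longrightarrow>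
    geq m (GMul (GMul t u) v) (GMul t (GMul u v))"
| geq_l_one: "t \<in> gterms m \<Longrightarrow> geq m (GMul GOne t) t"
| geq_r_one: "t \<in> gterms m \<Longrightarrow> geq m (GMul t GOne) t"
| geq_l_inv: "t \<in> gterms m \<Longrightarrow> geq m (GMul (GInv t) t) GOne"
| geq_r_inv: "t \<in> gterms m \<Longrightarrow> geq m (GMul t (GInv t)) GOne"

definition geq_rel :: "nat \<Rightarrow> (nat gterm \<times> nat gterm) set" where
  "geq_rel m = {(t, u). geq m t u}"

text \<open>An arrow $m \to n$ is a pair \<open>(m, cs)\<close>, where \<open>cs\<close> is a list of \<open>n\<close> classes of terms in
  \<open>m\<close> variables. Composition is substitution of terms.\<close>

definition gclass_subst :: "nat \<Rightarrow> nat gterm set list \<Rightarrow> nat gterm set \<Rightarrow> nat gterm set" where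
  "gclass_subst m cs d = {u. \<exists>t \<in> d. \<exists>\<sigma>. (\<forall>i < length cs. \<sigma> i \<in> cs ! i) \<and>
     geq m (gsubst \<sigma> t) u}"

definition theory_of_groups :: "(nat, nat \<times> nat gterm set list) lawvere" where
  "theory_of_groups =
     \<lparr>base =
       \<lparr>Obj = UNIV,
        Arr = {(m, cs). set cs \<subseteq> gterms m // geq_rel m},
        Dom = fst,
        Cod = (\<lambda>f. length (snd f)),
        Ident = (\<lambda>n. (n, map (\<lambda>i. geq_rel n `` {GVar i}) [0..<n])),
        Comp = (\<lambda>g f. (fst f, map (gclass_subst (fst f) (snd f)) (snd g)))\<rparr>,
      pow = (\<lambda>n. n),
      prj = (\<lambda>n i. (n, [geq_rel n `` {GVar i}]))\<rparr>"


section \<open>Tensor products of vector spaces\<close>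

definition linear_maps ::
  "('k, 'r) ring_scheme \<Rightarrow> ('k, 'v, 'x) module_scheme \<Rightarrow> ('k, 'w, 'y) module_scheme \<Rightarrow> ('v \<Rightarrow> 'w) set"
  where
  "linear_maps K V W = {f \<in> carrier V \<rightarrow>\<^sub>E carrier W.
     (\<forall>v \<in> carrier V. \<forall>v' \<in> carrier V. f (v \<oplus>\<^bsub>V\<^esub> v') = f v \<oplus>\<^bsub>W\<^esub> f v') \<and>
     (\<forall>r \<in> carrier K. \<forall>v \<in> carrier V. f (r \<odot>\<^bsub>V\<^esub> v) = r \<odot>\<^bsub>W\<^esub> f v)}"

text \<open>The record type \<open>module\<close> extends that of rings; the multiplicative fields
  \<open>mult\<close> and \<open>one\<close> play no role for modules.\<close>

definition ground_module :: "('k, 'r) ring_scheme \<Rightarrow> ('k, 'k) module" where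
  "ground_module K = \<lparr>carrier = carrier K, mult = mult K, one = one K,
     zero = zero K, add = add K, smult = mult K\<rparr>"

definition free_module :: "('k, 'r) ring_scheme \<Rightarrow> 'x set \<Rightarrow> ('k, 'x \<Rightarrow> 'k) module" where
  "free_module K X =
     \<lparr>carrier = {f. (\<forall>x. f x \<in> carrier K) \<and> finite {x. f x \<noteq> \<zero>\<^bsub>K\<^esub>} \<and> {x. f x \<noteq> \<zero>\<^bsub>K\<^esub>} \<subseteq> X},
      mult = undefined, one = undefined,
      zero = (\<lambda>x. \<zero>\<^bsub>K\<^esub>),
      add = (\<lambda>f g x. f x \<oplus>\<^bsub>K\<^esub> g x),
      smult = (\<lambda>r f x. r \<otimes>\<^bsub>K\<^esub> f x)\<rparr>"

definition basis_vec :: "('k, 'r) ring_scheme \<Rightarrow> 'x \<Rightarrow> 'x \<Rightarrow> 'k" where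
  "basis_vec K x = (\<lambda>y. if y = x then \<one>\<^bsub>K\<^esub> else \<zero>\<^bsub>K\<^esub>)"

definition submodule_span ::
  "('k, 'r) ring_scheme \<Rightarrow> ('k, 'v, 'x) module_scheme \<Rightarrow> 'v set \<Rightarrow> 'v set" where
  "submodule_span K M S = \<Inter>{H. submodule H K M \<and> S \<subseteq> H}"

definition quotient_module ::
  "('k, 'v, 'x) module_scheme \<Rightarrow> 'v set \<Rightarrow> ('k, 'v set) module" where
  "quotient_module M N =
     \<lparr>carrier = a_rcosets\<^bsub>M\<^esub> N,
      mult = undefined, one = undefined,
      zero = N,
      add = set_add M,
      smult = (\<lambda>r X. \<Union>x\<in>X. N +>\<^bsub>M\<^esub> (r \<odot>\<^bsub>M\<^esub> x))\<rparr>"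

definition tensor_relations ::
  "('k, 'r) ring_scheme \<Rightarrow> ('k, 'v, 'x) module_scheme \<Rightarrow> ('k, 'w, 'y) module_scheme \<Rightarrow>
   ('v \<times> 'w \<Rightarrow> 'k) set" where
  "tensor_relations K V W =
    (let F = free_module K (carrier V \<times> carrier W); b = basis_vec K in
      {b (v \<oplus>\<^bsub>V\<^esub> v', w) \<ominus>\<^bsub>F\<^esub> (b (v, w) \<oplus>\<^bsub>F\<^esub> b (v', w)) | v v' w.
         v \<in> carrier V \<and> v' \<in> carrier V \<and> w \<in> carrier W} \<union>
      {b (v, w \<oplus>\<^bsub>W\<^esub> w') \<ominus>\<^bsub>F\<^esub> (b (v, w) \<oplus>\<^bsub>F\<^esub> b (v, w')) | v w w'.
         v \<in> carrier V \<and> w \<in> carrier W \<and> w' \<in> carrier W} \<union>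
      {b (r \<odot>\<^bsub>V\<^esub> v, w) \<ominus>\<^bsub>F\<^esub> (r \<odot>\<^bsub>F\<^esub> b (v, w)) | r v w.
         r \<in> carrier K \<and> v \<in> carrier V \<and> w \<in> carrier W} \<union>
      {b (v, r \<odot>\<^bsub>W\<^esub> w) \<ominus>\<^bsub>F\<^esub> (r \<odot>\<^bsub>F\<^esub> b (v, w)) | r v w.
         r \<in> carrier K \<and> v \<in> carrier V \<and> w \<in> carrier W})"

definition tensor_kernel ::
  "('k, 'r) ring_scheme \<Rightarrow> ('k, 'v, 'x) module_scheme \<Rightarrow> ('k, 'w, 'y) module_scheme \<Rightarrow>
   ('v \<times> 'w \<Rightarrow> 'k) set" where
  "tensor_kernel K V W =
     submodule_span K (free_module K (carrier V \<times> carrier W)) (tensor_relations K V W)"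

definition tensor ::
  "('k, 'r) ring_scheme \<Rightarrow> ('k, 'v, 'x) module_scheme \<Rightarrow> ('k, 'w, 'y) module_scheme \<Rightarrow>
   ('k, ('v \<times> 'w \<Rightarrow> 'k) set) module" where
  "tensor K V W =
     quotient_module (free_module K (carrier V \<times> carrier W)) (tensor_kernel K V W)"

definition tens ::
  "('k, 'r) ring_scheme \<Rightarrow> ('k, 'v, 'x) module_scheme \<Rightarrow> ('k, 'w, 'y) module_scheme \<Rightarrow>
   'v \<Rightarrow> 'w \<Rightarrow> ('v \<times> 'w \<Rightarrow> 'k) set" where
  "tens K V W v w =
     tensor_kernel K V W +>\<^bsub>free_module K (carrier V \<times> carrier W)\<^esub> basis_vec K (v, w)"

text \<open>The linear map on \<open>tensor K V W\<close> induced by a bilinear map \<open>\<phi>\<close>.\<close>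

definition tensor_lift ::
  "('k, 'r) ring_scheme \<Rightarrow> ('k, 'v, 'x) module_scheme \<Rightarrow> ('k, 'w, 'y) module_scheme \<Rightarrow>
   ('k, 'u, 'z) module_scheme \<Rightarrow> ('v \<Rightarrow> 'w \<Rightarrow> 'u) \<Rightarrow> ('v \<times> 'w \<Rightarrow> 'k) set \<Rightarrow> 'u" where
  "tensor_lift K V W Z \<phi> = (THE h. h \<in> linear_maps K (tensor K V W) Z \<and>
     (\<forall>v \<in> carrier V. \<forall>w \<in> carrier W. h (tens K V W v w) = \<phi> v w))"

definition tensor_map ::
  "('k, 'r) ring_scheme \<Rightarrow> ('k, 'v, 'x) module_scheme \<Rightarrow> ('k, 'w, 'y) module_scheme \<Rightarrow>
   ('k, 'v', 'x') module_scheme \<Rightarrow> ('k, 'w', 'y') module_scheme \<Rightarrow>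
   ('v \<Rightarrow> 'v') \<Rightarrow> ('w \<Rightarrow> 'w') \<Rightarrow> ('v \<times> 'w \<Rightarrow> 'k) set \<Rightarrow> ('v' \<times> 'w' \<Rightarrow> 'k) set" where
  "tensor_map K V W V' W' f g =
     tensor_lift K V W (tensor K V' W') (\<lambda>v w. tens K V' W' (f v) (g w))"

definition tensor_assoc ::
  "('k, 'r) ring_scheme \<Rightarrow> ('k, 'v, 'x) module_scheme \<Rightarrow> ('k, 'w, 'y) module_scheme \<Rightarrow>
   ('k, 'u, 'z) module_scheme \<Rightarrow>
   (('v \<times> 'w \<Rightarrow> 'k) set \<times> 'u \<Rightarrow> 'k) set \<Rightarrow> ('v \<times> ('w \<times> 'u \<Rightarrow> 'k) set \<Rightarrow> 'k) set" where
  "tensor_assoc K V W Z =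
     tensor_lift K (tensor K V W) Z (tensor K V (tensor K W Z))
       (\<lambda>t z. tensor_lift K V W (tensor K V (tensor K W Z))
          (\<lambda>v w. tens K V (tensor K W Z) v (tens K W Z w z)) t)"

definition tensor_swap ::
  "('k, 'r) ring_scheme \<Rightarrow> ('k, 'v, 'x) module_scheme \<Rightarrow> ('k, 'w, 'y) module_scheme \<Rightarrow>
   ('v \<times> 'w \<Rightarrow> 'k) set \<Rightarrow> ('w \<times> 'v \<Rightarrow> 'k) set" where
  "tensor_swap K V W = tensor_lift K V W (tensor K W V) (\<lambda>v w. tens K W V w v)"

definition tensor_lunit ::
  "('k, 'r) ring_scheme \<Rightarrow> ('k, 'v, 'x) module_scheme \<Rightarrow> ('k \<times> 'v \<Rightarrow> 'k) set \<Rightarrow> 'v" where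
  "tensor_lunit K V = tensor_lift K (ground_module K) V V (\<lambda>r v. r \<odot>\<^bsub>V\<^esub> v)"

definition tensor_runit ::
  "('k, 'r) ring_scheme \<Rightarrow> ('k, 'v, 'x) module_scheme \<Rightarrow> ('v \<times> 'k \<Rightarrow> 'k) set \<Rightarrow> 'v" where
  "tensor_runit K V = tensor_lift K V (ground_module K) V (\<lambda>v r. r \<odot>\<^bsub>V\<^esub> v)"


section \<open>Cocommutative coalgebras\<close>

record ('k, 'v) coalgebra = "('k, 'v) module" +
  comult :: "'v \<Rightarrow> ('v \<times> 'v \<Rightarrow> 'k) set"
  counit :: "'v \<Rightarrow> 'k"

definition cocommutative_coalgebra ::
  "('k, 'r) ring_scheme \<Rightarrow> ('k, 'v) coalgebra \<Rightarrow> bool" where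
  "cocommutative_coalgebra K C \<longleftrightarrow> module K C \<and>
     comult C \<in> linear_maps K C (tensor K C C) \<and>
     counit C \<in> linear_maps K C (ground_module K) \<and>
     (\<forall>c \<in> carrier C.
        tensor_assoc K C C C
            (tensor_map K C C (tensor K C C) C (comult C) (\<lambda>x. x) (comult C c))
          = tensor_map K C C C (tensor K C C) (\<lambda>x. x) (comult C) (comult C c) \<and>
        tensor_lunit K C (tensor_map K C C (ground_module K) C (counit C) (\<lambda>x. x) (comult C c)) = c \<and>
        tensor_runit K C (tensor_map K C C C (ground_module K) (\<lambda>x. x) (counit C) (comult C c)) = c \<and>
        tensor_swap K C C (comult C c) = comult C c)"

definition coalgebra_hom ::
  "('k, 'r) ring_scheme \<Rightarrow> ('k, 'v) coalgebra \<Rightarrow> ('k, 'w) coalgebra \<Rightarrow> ('v \<Rightarrow> 'w) \<Rightarrow> bool" where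
  "coalgebra_hom K C D f \<longleftrightarrow> f \<in> linear_maps K C D \<and>
     (\<forall>c \<in> carrier C. tensor_map K C C D D f f (comult C c) = comult D (f c) \<and>
        counit D (f c) = counit C c)"

text \<open>The category of cocommutative coalgebras whose underlying sets are subsets of a given
  set \<open>U\<close>, which plays the role of the universe. If \<open>U\<close> is infinite and at least as large as
  the field, then every coalgebra of cardinality at most that of \<open>U\<close> is isomorphic to an object
  of this category, and finite products are given by tensor products over the field.\<close>

definition Coalg_coc ::
  "('k, 'r) ring_scheme \<Rightarrow> 'v set \<Rightarrow>
   (('k, 'v) coalgebra, ('k, 'v) coalgebra \<times> ('v \<Rightarrow> 'v) \<times> ('k, 'v) coalgebra) cat" where
  "Coalg_coc K U =
    (let objs = {C. cocommutative_coalgebra K C \<and> carrier C \<subseteq> U} in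
     \<lparr>Obj = objs,
      Arr = {(C, f, D). C \<in> objs \<and> D \<in> objs \<and> coalgebra_hom K C D f},
      Dom = (\<lambda>(C, f, D). C),
      Cod = (\<lambda>(C, f, D). D),
      Ident = (\<lambda>C. (C, (\<lambda>x\<in>carrier C. x), C)),
      Comp = (\<lambda>(D', g, E) (C, f, D). (C, compose (carrier C) g f, E))\<rparr>)"


section \<open>Coalgebraic models\<close>

definition coalg_models where
  "coalg_models K U T = product_functor_category (base T) (Coalg_coc K U)"

text \<open>Cocommutative Hopf algebras are the group objects in cocommutative coalgebras, that is,
  the coalgebraic models of the theory of groups.\<close>

definition Hopf_coc where
  "Hopf_coc K U = coalg_models K U theory_of_groups"

text \<open>Being a category of coalgebraic models is meant on the nose, not up to equivalence.
  The set of models determines the category underlying a theory (as the source of the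
  functors), but not which of its objects is the generator.\<close>

definition Omega_Hopf_category where
  "Omega_Hopf_category K U \<X> \<longleftrightarrow> (\<exists>T. Omega_group_theory T \<and> \<X> = coalg_models K U T)"

definition precomposition where
  "precomposition K U T S F =
     \<lparr>Src = coalg_models K U T,
      Trg = coalg_models K U S,
      OMap = (\<lambda>M\<in>Obj (coalg_models K U T). functor_comp M F),
      AMap = (\<lambda>\<eta>\<in>Arr (coalg_models K U T).
        \<lparr>NSrc = functor_comp (NSrc \<eta>) F, NTrg = functor_comp (NTrg \<eta>) F,
         Component = (\<lambda>A\<in>Obj (base S). Component \<eta> (OMap F A))\<rparr>)\<rparr>"

definition algebraic_functor where
  "algebraic_functor K U T S \<Phi> \<longleftrightarrow>
     is_functor (coalg_models K U T) (coalg_models K U S) \<Phi> \<and>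
     (\<exists>F. theory_morphism S T F \<and> \<Phi> = precomposition K U T S F)"

end

theory Submission
  imports Defs
begin

text \<open>
  A constant of a theory is an arrow out of the terminal object $T^0$. The terminal model is the
  constant functor at the terminal coalgebra $\mathbb{K}$.

  Suppose that the category of models is pointed. Then the terminal model maps to every model \<open>M\<close>, and
  naturality of this map forces \<open>M\<close> to identify any two constants of the same type
  (\<open>pointed_identifies_constants\<close>). On the other hand there is a model that separates constants:
  the functor $A \mapsto \mathbb{K}[\mathrm{Hom}(T^0, A)]$, which sends an object to the vector space on its
  constants with the comultiplication that makes constants grouplike (\<open>grouplike_model\<close>). So there is
  at most one constant $T^0 \to T$. An algebraic functor to Hopf algebras comes from a morphism of
  theories out of the theory of groups, that is, from a group structure on the generator
  (\<open>theory_morphism_natural_group\<close>). Its unit is the only constant, and every operation preserves it,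
  as the value of an operation at the constant tuple is again a constant.

  Conversely, let the category of models be that of the theory of a variety of \<open>\<Omega>\<close>-groups. Then the two
  theories have the same base category. Its terminal object is a zero object, and this makes the
  terminal model a zero object (\<open>zero_object_const_functor\<close>). The generator \<open>T\<close> of the given theory is a
  power of the generator of the other one, which is a group object; so \<open>T\<close> is a group object
  (\<open>natural_group_power\<close>). A group object is the image of the generator under a morphism from the
  theory of groups (\<open>natural_group_theory_morphism\<close>), and precomposition with it is the algebraic
  functor.

  The substantial part is that linearisation of sets preserves finite products
  (\<open>is_product_grouplike\<close>). A linear map from a coalgebra \<open>D\<close> to $\mathbb{K}[X]$ is a family of functionals on
  \<open>D\<close> indexed by \<open>X\<close>, and it is a coalgebra map exactly if the functionals are orthogonal idempotents of
  the convolution algebra of \<open>D\<close> and sum to its unit (\<open>hom_iff\<close>). As \<open>D\<close> is cocommutative, convolution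
  is commutative. So such families over $X_0, \dots, X_{n-1}$ multiply to a family over the product of
  these sets (\<open>finprod_idem_family\<close>), and it is the only one with the given marginals
  (\<open>family_eq_finprod_marginals\<close>). The coalgebra axioms are about tensor products given by generators and
  relations, so this needs their universal property. The cardinality assumptions ensure that the
  linearised sets have copies inside the universe \<open>U\<close> (\<open>free_module_lepoll\<close>).
\<close>

section \<open>Products in a category\<close>

lemma Hom_Arr: "f \<in> Hom C A B \<Longrightarrow> f \<in> Arr C"
  and Hom_Dom: "f \<in> Hom C A B \<Longrightarrow> Dom C f = A"
  and Hom_Cod: "f \<in> Hom C A B \<Longrightarrow> Cod C f = B"
  and Hom_Arr_self: "f \<in> Arr C \<Longrightarrow> f \<in> Hom C (Dom C f) (Cod C f)"
  unfolding Hom_def by auto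

lemma (in category) Hom_dom_obj: "f \<in> Hom C A B \<Longrightarrow> A \<in> Obj C"
  and Hom_cod_obj: "f \<in> Hom C A B \<Longrightarrow> B \<in> Obj C"
  using dom_obj cod_obj unfolding Hom_def by auto

lemma is_product_obj: "is_product C n A P p \<Longrightarrow> P \<in> Obj C"
  and is_product_proj: "is_product C n A P p \<Longrightarrow> i < n \<Longrightarrow> p i \<in> Hom C P (A i)"
  and is_product_ex1: "is_product C n A P p \<Longrightarrow> X \<in> Obj C \<Longrightarrow> (\<And>i. i < n \<Longrightarrow> f i \<in> Hom C X (A i)) \<Longrightarrow>
        \<exists>!h. h \<in> Hom C X P \<and> (\<forall>i<n. p i \<cdot>\<^bsub>C\<^esub> h = f i)"
  unfolding is_product_def by auto

lemma is_product_cong: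
  assumes "is_product C n A P p" "\<And>i. i < n \<Longrightarrow> A i = A' i" "\<And>i. i < n \<Longrightarrow> p i = p' i"
  shows "is_product C n A' P p'"
proof -
  have "is_product C n A P p \<longleftrightarrow> is_product C n A' P p'"
    unfolding is_product_def using assms(2,3) by (simp cong: conj_cong)
  then show ?thesis using assms(1) by blast
qed

text \<open>The factors do not occur in the mediating arrow, so \<open>lift\<close> takes only the product object and
  its projections. For the chosen powers of a theory it is the function \<open>tuple\<close>.\<close>

definition lift :: "('o, 'a) cat \<Rightarrow> nat \<Rightarrow> 'o \<Rightarrow> (nat \<Rightarrow> 'a) \<Rightarrow> 'o \<Rightarrow> (nat \<Rightarrow> 'a) \<Rightarrow> 'a" where
  "lift C n P p X f = (THE h. h \<in> Hom C X P \<and> (\<forall>i<n. p i \<cdot>\<^bsub>C\<^esub> h = f i))"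

lemma lift_cong: "(\<And>i. i < n \<Longrightarrow> f i = g i) \<Longrightarrow> lift C n P p X f = lift C n P p X g"
  unfolding lift_def by (metis (no_types, lifting))

lemma tuple_eq_lift: "tuple T n X f = lift (base T) n (pow T n) (prj T n) X f"
  unfolding tuple_def lift_def ..

lemma
  assumes "is_product C n A P p" "X \<in> Obj C" "\<And>i. i < n \<Longrightarrow> f i \<in> Hom C X (A i)"
  shows lift_hom: "lift C n P p X f \<in> Hom C X P"
    and proj_lift: "\<And>i. i < n \<Longrightarrow> p i \<cdot>\<^bsub>C\<^esub> lift C n P p X f = f i"
  using theI'[OF is_product_ex1[OF assms]] unfolding lift_def by auto

lemma (in category) product_eqI:
  assumes P: "is_product C n A P p" and g: "g \<in> Hom C X P" and h: "h \<in> Hom C X P"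
    and eq: "\<And>i. i < n \<Longrightarrow> p i \<cdot> g = p i \<cdot> h"
  shows "g = h"
  using is_product_ex1[OF P Hom_dom_obj[OF g], of "\<lambda>i. p i \<cdot> h"] comp_hom[OF h is_product_proj[OF P]] g h eq
  by blast

lemma (in category) lift_unique:
  assumes P: "is_product C n A P p" and h: "h \<in> Hom C X P" and eq: "\<And>i. i < n \<Longrightarrow> p i \<cdot> h = f i"
  shows "lift C n P p X f = h"
proof -
  have f: "f i \<in> Hom C X (A i)" if "i < n" for i
    using comp_hom[OF h is_product_proj[OF P that]] eq[OF that] by simp
  show ?thesis
    by (rule product_eqI[OF P lift_hom[OF P Hom_dom_obj[OF h] f] h])
      (simp_all add: proj_lift[OF P Hom_dom_obj[OF h] f] eq)
qed

lemma (in category) lift_comp: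
  assumes P: "is_product C n A P p" and f: "\<And>i. i < n \<Longrightarrow> f i \<in> Hom C X (A i)" and h: "h \<in> Hom C Y X"
  shows "lift C n P p X f \<cdot> h = lift C n P p Y (\<lambda>i. f i \<cdot> h)"
proof (rule lift_unique[OF P, symmetric])
  note X = Hom_cod_obj[OF h]
  note l = lift_hom[OF P X f]
  show "lift C n P p X f \<cdot> h \<in> Hom C Y P" using comp_hom[OF h l] by simp
  show "p i \<cdot> lift C n P p X f \<cdot> h = f i \<cdot> h" if "i < n" for i
    using comp_assoc[OF h l is_product_proj[OF P that]] proj_lift[OF P X f that] by simp
qed

lemma (in category) is_product_iso:
  assumes Q: "is_product C n A Q q" and t: "t \<in> Hom C P Q" and u: "u \<in> Hom C Q P"
    and tu: "t \<cdot> u = Ident C Q" and ut: "u \<cdot> t = Ident C P" and p: "\<And>i. i < n \<Longrightarrow> p i = q i \<cdot> t"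
  shows "is_product C n A P p"
  unfolding is_product_def
proof (intro conjI allI ballI impI)
  show "P \<in> Obj C" by (rule Hom_dom_obj[OF t])
  show "p i \<in> Hom C P (A i)" if "i < n" for i
    unfolding p[OF that] using comp_hom[OF t is_product_proj[OF Q that]] .
  fix X f assume X: "X \<in> Obj C" and f: "\<forall>i<n. f i \<in> Hom C X (A i)"
  then have f: "f i \<in> Hom C X (A i)" if "i < n" for i using that by blast
  let ?l = "lift C n Q q X f"
  note l = lift_hom[OF Q X f]
  show "\<exists>!h. h \<in> Hom C X P \<and> (\<forall>i<n. p i \<cdot> h = f i)"
  proof (rule ex1I[of _ "u \<cdot> ?l"])
    have "t \<cdot> u \<cdot> ?l = ?l" using comp_assoc[OF l u t] tu ident_left[OF l] by simp
    then show "u \<cdot> ?l \<in> Hom C X P \<and> (\<forall>i<n. p i \<cdot> u \<cdot> ?l = f i)"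
      using comp_hom[OF l u] comp_assoc[OF comp_hom[OF l u] t is_product_proj[OF Q]] proj_lift[OF Q X f]
      by (simp add: p)
  next
    fix h assume h: "h \<in> Hom C X P \<and> (\<forall>i<n. p i \<cdot> h = f i)"
    then have hX: "h \<in> Hom C X P" by blast
    have "?l = t \<cdot> h"
      by (rule lift_unique[OF Q comp_hom[OF hX t]])
        (use h comp_assoc[OF hX t is_product_proj[OF Q]] in \<open>simp add: p\<close>)
    then show "h = u \<cdot> ?l" using comp_assoc[OF hX t u] ut ident_left[OF hX] by simp
  qed
qed

text \<open>A product of powers of \<open>G\<close> is a power of \<open>G\<close> whose factors are indexed by pairs. The bijection
  \<open>\<beta>\<close> numbers these pairs, so no arithmetic of offsets is needed; a family of arrows into the
  powers is the same as a family of arrows into \<open>G\<close> indexed by the pairs.\<close>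

lemma (in category) is_product_regroup:
  fixes k :: "nat \<Rightarrow> nat"
  assumes Q: "is_product C N (\<lambda>_. G) Q r" and A: "\<And>i. i < n \<Longrightarrow> is_product C (k i) (\<lambda>_. G) (A i) (s i)"
    and \<beta>: "bij_betw \<beta> (Sigma {..<n} (\<lambda>i. {..<k i})) {..<N}"
    and q: "\<And>i. i < n \<Longrightarrow> q i \<in> Hom C Q (A i)"
    and sq: "\<And>i j. i < n \<Longrightarrow> j < k i \<Longrightarrow> s i j \<cdot> q i = r (\<beta> (i, j))"
  shows "is_product C n A Q q"
  unfolding is_product_def
proof (intro conjI allI ballI impI)
  show "Q \<in> Obj C" by (rule is_product_obj[OF Q])
  show "q i \<in> Hom C Q (A i)" if "i < n" for i using q[OF that] .
  fix X f assume X: "X \<in> Obj C" and f: "\<forall>i<n. f i \<in> Hom C X (A i)"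
  let ?S = "Sigma {..<n} (\<lambda>i. {..<k i})"
  define g where "g m = (case the_inv_into ?S \<beta> m of (i, j) \<Rightarrow> s i j \<cdot> f i)" for m
  have g\<beta>: "g (\<beta> (i, j)) = s i j \<cdot> f i" if "i < n" "j < k i" for i j
  proof -
    have "the_inv_into ?S \<beta> (\<beta> (i, j)) = (i, j)"
      using \<beta> that unfolding bij_betw_def by (intro the_inv_into_f_f) auto
    then show ?thesis unfolding g_def by simp
  qed
  have \<beta>N: "\<beta> (i, j) < N" if "i < n" "j < k i" for i j using bij_betwE[OF \<beta>] that by auto
  have ex: "\<exists>i j. i < n \<and> j < k i \<and> m = \<beta> (i, j)" if "m < N" for m
  proof -
    have "m \<in> \<beta> ` ?S" using \<beta> that by (simp add: bij_betw_def)
    then show ?thesis by blast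
  qed
  have g: "g m \<in> Hom C X G" if m: "m < N" for m
  proof -
    obtain i j where ij: "i < n" "j < k i" "m = \<beta> (i, j)" using ex[OF m] by blast
    show ?thesis unfolding ij(3) g\<beta>[OF ij(1,2)]
      using comp_hom is_product_proj[OF A[OF ij(1)] ij(2)] f ij(1) by blast
  qed
  let ?l = "lift C N Q r X g"
  have l: "?l \<in> Hom C X Q" by (rule lift_hom[OF Q X]) (rule g)
  show "\<exists>!h. h \<in> Hom C X Q \<and> (\<forall>i<n. q i \<cdot> h = f i)"
  proof (rule ex1I[of _ ?l])
    have "q i \<cdot> ?l = f i" if i: "i < n" for i
    proof (rule product_eqI[OF A[OF i] comp_hom[OF l q[OF i]]])
      show "f i \<in> Hom C X (A i)" using f i by blast
      fix j assume j: "j < k i"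
      have "s i j \<cdot> q i \<cdot> ?l = r (\<beta> (i, j)) \<cdot> ?l"
        using comp_assoc[OF l q[OF i] is_product_proj[OF A[OF i] j]] sq[OF i j] by simp
      also have "\<dots> = s i j \<cdot> f i" using proj_lift[OF Q X g \<beta>N[OF i j]] g\<beta>[OF i j] by simp
      finally show "s i j \<cdot> q i \<cdot> ?l = s i j \<cdot> f i" .
    qed
    then show "?l \<in> Hom C X Q \<and> (\<forall>i<n. q i \<cdot> ?l = f i)" using l by blast
  next
    fix h assume h: "h \<in> Hom C X Q \<and> (\<forall>i<n. q i \<cdot> h = f i)"
    then have hX: "h \<in> Hom C X Q" by blast
    have "?l = h"
    proof (rule lift_unique[OF Q hX])
      fix m assume "m < N"
      then obtain i j where ij: "i < n" "j < k i" "m = \<beta> (i, j)" using ex by blast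
      show "r m \<cdot> h = g m"
        unfolding ij(3) g\<beta>[OF ij(1,2)] sq[OF ij(1,2), symmetric]
        using comp_assoc[OF hX q[OF ij(1)] is_product_proj[OF A[OF ij(1)] ij(2)]] h ij(1) by simp
    qed
    then show "h = ?l" by simp
  qed
qed

section \<open>Functors and product preservation\<close>

lemma functor_hom: "is_functor C D F \<Longrightarrow> f \<in> Hom C A B \<Longrightarrow> AMap F f \<in> Hom D (OMap F A) (OMap F B)"
  unfolding is_functor_def Hom_def by auto

lemma functor_obj: "is_functor C D F \<Longrightarrow> A \<in> Obj C \<Longrightarrow> OMap F A \<in> Obj D"
  unfolding is_functor_def by auto

lemma functor_comp_arr: "is_functor C D F \<Longrightarrow> f \<in> Hom C X Y \<Longrightarrow> g \<in> Hom C Y Z \<Longrightarrow>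
    AMap F (g \<cdot>\<^bsub>C\<^esub> f) = AMap F g \<cdot>\<^bsub>D\<^esub> AMap F f"
  unfolding is_functor_def Hom_def by auto

lemma functor_ident: "is_functor C D F \<Longrightarrow> A \<in> Obj C \<Longrightarrow> AMap F (Ident C A) = Ident D (OMap F A)"
  unfolding is_functor_def by auto

text \<open>Every object of a theory is a power of the generator, and so every product is, up to isomorphism,
  a power with its projections regrouped. Preservation of the chosen powers is therefore enough.\<close>

lemma preserves_products_of_powers:
  assumes S: "lawvere_theory S" and D: "category D" and F: "is_functor (base S) D F"
    and pow: "\<And>n. is_product D n (\<lambda>_. OMap F (pow S 1)) (OMap F (pow S n)) (\<lambda>i. AMap F (prj S n i))"
  shows "preserves_finite_products F"
  unfolding preserves_finite_products_def
proof (intro allI impI)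
  interpret B: category "base S" using S unfolding lawvere_theory_def by blast
  interpret D: category D by fact
  have SF: "Src F = base S" "Trg F = D" using F unfolding is_functor_def by auto
  have Spow: "is_product (base S) n (\<lambda>_. pow S 1) (pow S n) (prj S n)" for n
    using S unfolding lawvere_theory_def by blast
  fix n A P p assume "is_product (Src F) n A P p"
  then have P: "is_product (base S) n A P p" by (simp add: SF)
  have "\<exists>m. A i = pow S m" if "i < n" for i
    using B.Hom_cod_obj[OF is_product_proj[OF P that]] S unfolding lawvere_theory_def by auto
  then obtain k where k: "\<And>i. i < n \<Longrightarrow> A i = pow S (k i)" by metis
  let ?I = "Sigma {..<n} (\<lambda>i. {..<k i})"
  obtain \<beta> where \<beta>: "bij_betw \<beta> ?I {..<card ?I}"
    using ex_bij_betw_finite_nat[of ?I] by (auto simp: atLeast0LessThan)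
  let ?N = "card ?I"
  let ?Q = "pow S ?N"
  have \<beta>N: "\<beta> (i, j) < ?N" if "i < n" "j < k i" for i j using bij_betwE[OF \<beta>] that by auto
  define q where "q i = lift (base S) (k i) (pow S (k i)) (prj S (k i)) ?Q (\<lambda>j. prj S ?N (\<beta> (i, j)))" for i
  have pr: "prj S ?N (\<beta> (i, j)) \<in> Hom (base S) ?Q (pow S 1)" if "i < n" "j < k i" for i j
    by (rule is_product_proj[OF Spow \<beta>N[OF that]])
  have QO: "?Q \<in> Obj (base S)" by (rule is_product_obj[OF Spow])
  have q: "q i \<in> Hom (base S) ?Q (A i)" if "i < n" for i
    unfolding q_def k[OF that] by (rule lift_hom[OF Spow QO pr[OF that]])
  have sq: "prj S (k i) j \<cdot>\<^bsub>base S\<^esub> q i = prj S ?N (\<beta> (i, j))" if "i < n" "j < k i" for i j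
    unfolding q_def by (rule proj_lift[OF Spow QO pr[OF that(1)] that(2)])
  have Q: "is_product (base S) n A ?Q q"
    by (rule B.is_product_regroup[OF Spow _ \<beta> q sq]) (use Spow in \<open>simp_all only: k\<close>)
  \<comment> \<open>The given product \<open>P\<close> and the power \<open>?Q\<close> are products of the same objects; \<open>?t\<close> and \<open>?u\<close> are the mutually inverse comparisons.\<close>
  let ?t = "lift (base S) n ?Q q P p" and ?u = "lift (base S) n P p ?Q q"
  note PO = is_product_obj[OF P]
  note pp = is_product_proj[OF P]
  have t: "?t \<in> Hom (base S) P ?Q" by (rule lift_hom[OF Q PO]) (rule pp)
  have u: "?u \<in> Hom (base S) ?Q P" by (rule lift_hom[OF P QO]) (rule q)
  have qt: "q i \<cdot>\<^bsub>base S\<^esub> ?t = p i" and pu: "p i \<cdot>\<^bsub>base S\<^esub> ?u = q i" if "i < n" for i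
    using proj_lift[OF Q PO pp] proj_lift[OF P QO q] that by simp_all
  have tu: "?t \<cdot>\<^bsub>base S\<^esub> ?u = Ident (base S) ?Q"
  proof (rule B.product_eqI[OF Q B.comp_hom[OF u t] B.ident_hom[OF QO]])
    show "q i \<cdot>\<^bsub>base S\<^esub> ?t \<cdot>\<^bsub>base S\<^esub> ?u = q i \<cdot>\<^bsub>base S\<^esub> Ident (base S) ?Q" if "i < n" for i
      using B.comp_assoc[OF u t q[OF that]] qt[OF that] pu[OF that] B.ident_right[OF q[OF that]] by simp
  qed
  have ut: "?u \<cdot>\<^bsub>base S\<^esub> ?t = Ident (base S) P"
  proof (rule B.product_eqI[OF P B.comp_hom[OF t u] B.ident_hom[OF PO]])
    show "p i \<cdot>\<^bsub>base S\<^esub> ?u \<cdot>\<^bsub>base S\<^esub> ?t = p i \<cdot>\<^bsub>base S\<^esub> Ident (base S) P" if "i < n" for i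
      using B.comp_assoc[OF t u pp[OF that]] qt[OF that] pu[OF that] B.ident_right[OF pp[OF that]] by simp
  qed
  have FQ: "is_product D n (\<lambda>i. OMap F (A i)) (OMap F ?Q) (\<lambda>i. AMap F (q i))"
  proof (rule D.is_product_regroup[OF pow _ \<beta>])
    fix i assume i: "i < n"
    show "is_product D (k i) (\<lambda>_. OMap F (pow S 1)) (OMap F (A i)) (\<lambda>j. AMap F (prj S (k i) j))"
      unfolding k[OF i] by (rule pow)
    show "AMap F (q i) \<in> Hom D (OMap F ?Q) (OMap F (A i))" by (rule functor_hom[OF F q[OF i]])
    show "AMap F (prj S (k i) j) \<cdot>\<^bsub>D\<^esub> AMap F (q i) = AMap F (prj S ?N (\<beta> (i, j)))" if "j < k i" for j
      using functor_comp_arr[OF F q[OF i, unfolded k[OF i]] is_product_proj[OF Spow that]] sq[OF i that] by simp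
  qed
  have "is_product D n (\<lambda>i. OMap F (A i)) (OMap F P) (\<lambda>i. AMap F (p i))"
  proof (rule D.is_product_iso[OF FQ functor_hom[OF F t] functor_hom[OF F u]])
    show "AMap F ?t \<cdot>\<^bsub>D\<^esub> AMap F ?u = Ident D (OMap F ?Q)"
      using functor_comp_arr[OF F u t] functor_ident[OF F QO] tu by simp
    show "AMap F ?u \<cdot>\<^bsub>D\<^esub> AMap F ?t = Ident D (OMap F P)"
      using functor_comp_arr[OF F t u] functor_ident[OF F PO] ut by simp
    show "AMap F (p i) = AMap F (q i) \<cdot>\<^bsub>D\<^esub> AMap F ?t" if "i < n" for i
      using functor_comp_arr[OF F t q[OF that]] qt[OF that] by simp
  qed
  then show "is_product (Trg F) n (\<lambda>i. OMap F (A i)) (OMap F P) (\<lambda>i. AMap F (p i))" by (simp add: SF)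
qed

lemma functor_comp_functor:
  assumes C: "\<And>A. A \<in> Obj C \<Longrightarrow> Ident C A \<in> Arr C"
    "\<And>f g. f \<in> Arr C \<Longrightarrow> g \<in> Arr C \<Longrightarrow> Dom C g = Cod C f \<Longrightarrow> g \<cdot>\<^bsub>C\<^esub> f \<in> Arr C"
    "\<And>f. f \<in> Arr C \<Longrightarrow> Dom C f \<in> Obj C \<and> Cod C f \<in> Obj C"
    and F: "is_functor C D F" and G: "is_functor D E G"
  shows "is_functor C E (functor_comp G F)"
  using F G C unfolding is_functor_def functor_comp_def
  by (auto simp: compose_def PiE_def Pi_def)

lemma functor_comp_preserves:
  assumes C: "category C" and F: "is_functor C D F" "preserves_finite_products F" and G: "is_functor D E G" "preserves_finite_products G"
  shows "preserves_finite_products (functor_comp G F)"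
  unfolding preserves_finite_products_def
proof (intro allI impI)
  interpret category C by fact
  fix n A P p assume "is_product (Src (functor_comp G F)) n A P p"
  then have P: "is_product C n A P p" using F(1) unfolding functor_comp_def is_functor_def by simp
  then have 1: "is_product D n (\<lambda>i. OMap F (A i)) (OMap F P) (\<lambda>i. AMap F (p i))"
    using F unfolding preserves_finite_products_def is_functor_def by auto
  then have 2: "is_product E n (\<lambda>i. OMap G (OMap F (A i))) (OMap G (OMap F P)) (\<lambda>i. AMap G (AMap F (p i)))"
    using G unfolding preserves_finite_products_def is_functor_def by auto
  have T: "Trg (functor_comp G F) = E" "Src F = C" using F(1) G(1) unfolding functor_comp_def is_functor_def by auto
  have o: "OMap (functor_comp G F) P = OMap G (OMap F P)"
    using is_product_obj[OF P] T unfolding functor_comp_def by (simp add: compose_def)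
  show "is_product (Trg (functor_comp G F)) n (\<lambda>i. OMap (functor_comp G F) (A i)) (OMap (functor_comp G F) P)
      (\<lambda>i. AMap (functor_comp G F) (p i))"
    unfolding T(1) o
  proof (rule is_product_cong[OF 2])
    fix i assume i: "i < n"
    note pi = is_product_proj[OF P i]
    show "OMap G (OMap F (A i)) = OMap (functor_comp G F) (A i)"
      using Hom_cod_obj[OF pi] T unfolding functor_comp_def by (simp add: compose_def)
    show "AMap G (AMap F (p i)) = AMap (functor_comp G F) (p i)"
      using Hom_Arr[OF pi] T unfolding functor_comp_def by (simp add: compose_def)
  qed
qed

section \<open>The Lawvere theory of groups\<close>

lemma gterms_simps [simp]: "GVar i \<in> gterms n \<longleftrightarrow> i < n" "GOne \<in> gterms n"
  "GInv t \<in> gterms n \<longleftrightarrow> t \<in> gterms n" "GMul t u \<in> gterms n \<longleftrightarrow> t \<in> gterms n \<and> u \<in> gterms n"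
  unfolding gterms_def by auto

lemma gsubst_gterms: "t \<in> gterms n \<Longrightarrow> (\<And>i. i < n \<Longrightarrow> \<sigma> i \<in> gterms m) \<Longrightarrow> gsubst \<sigma> t \<in> gterms m"
  by (induction t) auto

lemma gsubst_gsubst: "gsubst \<sigma> (gsubst \<tau> t) = gsubst (\<lambda>i. gsubst \<sigma> (\<tau> i)) t"
  by (induction t) auto

lemma gsubst_GVar: "gsubst GVar t = t"
  by (induction t) auto

lemma geq_gterms: "geq m t u \<Longrightarrow> t \<in> gterms m \<and> u \<in> gterms m"
  by (induction rule: geq.induct) auto

text \<open>Substitution is well defined on classes of terms: in the terms that are substituted by this lemma,
  in the term that they are substituted into by the next one.\<close>

lemma geq_gsubst_terms:
  "t \<in> gterms n \<Longrightarrow> (\<And>i. i < n \<Longrightarrow> geq m (\<sigma> i) (\<tau> i)) \<Longrightarrow> geq m (gsubst \<sigma> t) (gsubst \<tau> t)"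
  by (induction t) (auto intro: geq.intros)

lemma geq_gsubst:
  assumes "geq n t u" and \<sigma>: "\<And>i. i < n \<Longrightarrow> \<sigma> i \<in> gterms m"
  shows "geq m (gsubst \<sigma> t) (gsubst \<sigma> u)"
  using assms(1)
proof (induction rule: geq.induct)
  case (geq_sym t u) then show ?case by (blast intro: geq.geq_sym)
next
  case (geq_trans t u v) then show ?case by (blast intro: geq.geq_trans)
qed (auto intro: geq.intros gsubst_gterms[OF _ \<sigma>])

definition gclass :: "nat \<Rightarrow> nat gterm \<Rightarrow> nat gterm set" where
  "gclass m t = geq_rel m `` {t}"

lemma mem_gclass: "u \<in> gclass m t \<longleftrightarrow> geq m t u"
  unfolding gclass_def geq_rel_def by auto

lemma gclass_eq_iff: "t \<in> gterms m \<Longrightarrow> gclass m t = gclass m u \<longleftrightarrow> geq m t u"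
  unfolding set_eq_iff mem_gclass by (meson geq.geq_refl geq.geq_sym geq.geq_trans)

lemma quotient_gclass: "c \<in> gterms m // geq_rel m \<longleftrightarrow> (\<exists>t\<in>gterms m. c = gclass m t)"
  unfolding quotient_def gclass_def by auto

lemma gclass_subst_gclass:
  assumes t: "t \<in> gterms n" and \<sigma>: "\<And>i. i < n \<Longrightarrow> \<sigma> i \<in> gterms m"
  shows "gclass_subst m (map (\<lambda>i. gclass m (\<sigma> i)) [0..<n]) (gclass n t) = gclass m (gsubst \<sigma> t)"
proof (intro Set.set_eqI iffI)
  fix u assume "u \<in> gclass_subst m (map (\<lambda>i. gclass m (\<sigma> i)) [0..<n]) (gclass n t)"
  then obtain t' \<sigma>' where t': "geq n t t'" and \<sigma>': "\<forall>i<n. geq m (\<sigma> i) (\<sigma>' i)" and u: "geq m (gsubst \<sigma>' t') u"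
    unfolding gclass_subst_def by (auto simp: mem_gclass)
  have "geq m (gsubst \<sigma> t) (gsubst \<sigma> t')" by (rule geq_gsubst[OF t' \<sigma>])
  moreover have "geq m (gsubst \<sigma> t') (gsubst \<sigma>' t')"
    using geq_gsubst_terms[of t' n] \<sigma>' geq_gterms[OF t'] by blast
  ultimately show "u \<in> gclass m (gsubst \<sigma> t)" unfolding mem_gclass using u by (blast intro: geq.geq_trans)
next
  fix u assume u: "u \<in> gclass m (gsubst \<sigma> t)"
  have "t \<in> gclass n t" unfolding mem_gclass by (rule geq.geq_refl[OF t])
  moreover have "\<forall>i<n. \<sigma> i \<in> gclass m (\<sigma> i)" unfolding mem_gclass using geq.geq_refl[OF \<sigma>] by blast
  ultimately show "u \<in> gclass_subst m (map (\<lambda>i. gclass m (\<sigma> i)) [0..<n]) (gclass n t)"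
    unfolding gclass_subst_def mem_Collect_eq
    using u by (intro bexI[of _ t] exI[of _ \<sigma>]) (simp_all add: mem_gclass)
qed

text \<open>Arrows are handled through representing terms: \<open>garr m n \<sigma>\<close> is the arrow $m \to n$ given by the
  terms \<open>\<sigma> 0, \<dots>, \<sigma> (n - 1)\<close>, and composition becomes substitution of terms.\<close>

definition garr :: "nat \<Rightarrow> nat \<Rightarrow> (nat \<Rightarrow> nat gterm) \<Rightarrow> nat \<times> nat gterm set list" where
  "garr m n \<sigma> = (m, map (\<lambda>i. gclass m (\<sigma> i)) [0..<n])"

abbreviation "GrpB \<equiv> base theory_of_groups"

lemma Grp_simps: "Obj GrpB = UNIV" "Arr GrpB = {(m, cs). set cs \<subseteq> gterms m // geq_rel m}" "Dom GrpB = fst"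
  "Cod GrpB f = length (snd f)" "Ident GrpB n = garr n n GVar"
  "Comp GrpB g f = (fst f, map (gclass_subst (fst f) (snd f)) (snd g))"
  "pow theory_of_groups n = n" "prj theory_of_groups n i = garr n 1 (\<lambda>_. GVar i)"
  unfolding theory_of_groups_def garr_def gclass_def by simp_all

lemma Hom_Grp: "f \<in> Hom GrpB m n \<longleftrightarrow> (\<exists>\<sigma>. (\<forall>i<n. \<sigma> i \<in> gterms m) \<and> f = garr m n \<sigma>)"
proof
  assume "f \<in> Hom GrpB m n"
  then obtain cs where f: "f = (m, cs)" "length cs = n" "set cs \<subseteq> gterms m // geq_rel m"
    unfolding Hom_def Grp_simps by auto
  have "\<exists>t. t \<in> gterms m \<and> cs ! i = gclass m t" if "i < n" for i
    using f that quotient_gclass by (metis nth_mem subsetD)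
  then obtain \<sigma> where \<sigma>: "\<And>i. i < n \<Longrightarrow> \<sigma> i \<in> gterms m \<and> cs ! i = gclass m (\<sigma> i)" by metis
  have "cs = map (\<lambda>i. gclass m (\<sigma> i)) [0..<n]" by (rule nth_equalityI) (use f \<sigma> in auto)
  then show "\<exists>\<sigma>. (\<forall>i<n. \<sigma> i \<in> gterms m) \<and> f = garr m n \<sigma>" using \<sigma> f unfolding garr_def by blast
next
  assume "\<exists>\<sigma>. (\<forall>i<n. \<sigma> i \<in> gterms m) \<and> f = garr m n \<sigma>"
  then show "f \<in> Hom GrpB m n" unfolding Hom_def Grp_simps garr_def by (auto simp: quotient_gclass) blast
qed

lemma garr_hom: "(\<And>i. i < n \<Longrightarrow> \<sigma> i \<in> gterms m) \<Longrightarrow> garr m n \<sigma> \<in> Hom GrpB m n"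
  unfolding Hom_Grp by blast

lemma garr_comp:
  assumes "\<And>i. i < n \<Longrightarrow> \<sigma> i \<in> gterms m" "\<And>j. j < k \<Longrightarrow> \<tau> j \<in> gterms n"
  shows "garr n k \<tau> \<cdot>\<^bsub>GrpB\<^esub> garr m n \<sigma> = garr m k (\<lambda>j. gsubst \<sigma> (\<tau> j))"
  unfolding Grp_simps garr_def using assms by (auto simp: gclass_subst_gclass)

lemma garr_eq_iff: "(\<And>i. i < n \<Longrightarrow> \<sigma> i \<in> gterms m) \<Longrightarrow> garr m n \<sigma> = garr m n \<tau> \<longleftrightarrow> (\<forall>i<n. geq m (\<sigma> i) (\<tau> i))"
  unfolding garr_def by (auto simp: gclass_eq_iff)

lemma garr_cong: "(\<And>i. i < n \<Longrightarrow> \<sigma> i = \<tau> i) \<Longrightarrow> garr m n \<sigma> = garr m n \<tau>"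
  unfolding garr_def by simp

lemma category_Grp: "category GrpB"
proof
  fix f g A B D assume "f \<in> Hom GrpB A B" "g \<in> Hom GrpB B D"
  then obtain \<sigma> \<tau> where s: "\<And>i. i < B \<Longrightarrow> \<sigma> i \<in> gterms A" "f = garr A B \<sigma>"
    "\<And>i. i < D \<Longrightarrow> \<tau> i \<in> gterms B" "g = garr B D \<tau>" unfolding Hom_Grp by blast
  have "gsubst \<sigma> (\<tau> j) \<in> gterms A" if "j < D" for j using gsubst_gterms s that by blast
  then show "g \<cdot>\<^bsub>GrpB\<^esub> f \<in> Hom GrpB A D"
    using s by (simp add: garr_comp garr_hom)
next
  fix f A B assume "f \<in> Hom GrpB A B"
  then obtain \<sigma> where "\<And>i. i < B \<Longrightarrow> \<sigma> i \<in> gterms A" "f = garr A B \<sigma>" unfolding Hom_Grp by blast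
  then show "Ident GrpB B \<cdot>\<^bsub>GrpB\<^esub> f = f" "f \<cdot>\<^bsub>GrpB\<^esub> Ident GrpB A = f"
    by (simp_all add: Grp_simps(5) garr_comp gsubst_GVar)
next
  fix f g h A B D E assume "f \<in> Hom GrpB A B" "g \<in> Hom GrpB B D" "h \<in> Hom GrpB D E"
  then obtain \<sigma> \<tau> \<rho> where s: "\<And>i. i < B \<Longrightarrow> \<sigma> i \<in> gterms A" "f = garr A B \<sigma>" "\<And>i. i < D \<Longrightarrow> \<tau> i \<in> gterms B" "g = garr B D \<tau>"
    "\<And>i. i < E \<Longrightarrow> \<rho> i \<in> gterms D" "h = garr D E \<rho>" unfolding Hom_Grp by blast
  have "gsubst \<sigma> (\<tau> j) \<in> gterms A" if "j < D" for j using gsubst_gterms s that by blast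
  moreover have "gsubst \<tau> (\<rho> j) \<in> gterms B" if "j < E" for j using gsubst_gterms s that by blast
  ultimately show "(h \<cdot>\<^bsub>GrpB\<^esub> g) \<cdot>\<^bsub>GrpB\<^esub> f = h \<cdot>\<^bsub>GrpB\<^esub> (g \<cdot>\<^bsub>GrpB\<^esub> f)"
    using s by (simp add: garr_comp gsubst_gsubst)
qed (simp_all add: Grp_simps(1) Grp_simps(5) garr_hom)

lemma lawvere_Grp: "lawvere_theory theory_of_groups"
  unfolding lawvere_theory_def
proof (intro conjI allI)
  fix n
  show "is_product GrpB n (\<lambda>_. pow theory_of_groups 1) (pow theory_of_groups n) (prj theory_of_groups n)"
    unfolding is_product_def Grp_simps(7,8)
  proof (intro conjI allI ballI impI)
    show "n \<in> Obj GrpB" by (simp add: Grp_simps(1))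
    show "garr n 1 (\<lambda>_. GVar i) \<in> Hom GrpB n 1" if "i < n" for i using that by (intro garr_hom) auto
    fix X f assume "\<forall>i<n. f i \<in> Hom GrpB X 1"
    then have "\<exists>t. t \<in> gterms X \<and> f i = garr X 1 (\<lambda>_. t)" if "i < n" for i
      using that unfolding Hom_Grp by (metis (no_types, lifting) garr_cong less_one)
    then obtain t where t: "\<And>i. i < n \<Longrightarrow> t i \<in> gterms X" "\<And>i. i < n \<Longrightarrow> f i = garr X 1 (\<lambda>_. t i)" by metis
    have pt: "garr n 1 (\<lambda>_. GVar i) \<cdot>\<^bsub>GrpB\<^esub> garr X n s = garr X 1 (\<lambda>_. s i)" if "\<forall>i<n. s i \<in> gterms X" "i < n" for s i
      using that by (simp add: garr_comp)
    show "\<exists>!h. h \<in> Hom GrpB X n \<and> (\<forall>i<n. garr n 1 (\<lambda>_. GVar i) \<cdot>\<^bsub>GrpB\<^esub> h = f i)"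
    proof (rule ex1I[of _ "garr X n t"])
      show "garr X n t \<in> Hom GrpB X n \<and> (\<forall>i<n. garr n 1 (\<lambda>_. GVar i) \<cdot>\<^bsub>GrpB\<^esub> garr X n t = f i)"
        using t pt[of t] garr_hom[of n t X] by auto
      fix h assume h: "h \<in> Hom GrpB X n \<and> (\<forall>i<n. garr n 1 (\<lambda>_. GVar i) \<cdot>\<^bsub>GrpB\<^esub> h = f i)"
      then obtain s where s: "\<And>i. i < n \<Longrightarrow> s i \<in> gterms X" "h = garr X n s" unfolding Hom_Grp by blast
      have "garr X 1 (\<lambda>_. s i) = garr X 1 (\<lambda>_. t i)" if "i < n" for i
        using h that pt[of s i] s(1) t(2)[OF that] unfolding s(2) by simp
      then have "geq X (s i) (t i)" if "i < n" for i
        using garr_eq_iff[of 1 "\<lambda>_. s i" X "\<lambda>_. t i"] s(1) that by simp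
      then show "h = garr X n t" unfolding s(2) using garr_eq_iff[of n s X t] s(1) by blast
    qed
  qed
qed (auto simp: category_Grp Grp_simps)

section \<open>Group objects as natural group structures on hom-sets\<close>

text \<open>By the Yoneda lemma, a group object structure on \<open>G\<close> is a group structure on each set of arrows
  $X \to G$ that is natural in $X$. In this form no products of \<open>G\<close> with itself are mentioned, and
  the group laws are equations between elements. The neutral element depends on $X$; the other two
  operations find $X$ as the domain of their arguments.\<close>

locale natural_group = category C for C :: "('o, 'a) cat" (structure) +
  fixes G :: 'o and mul :: "'a \<Rightarrow> 'a \<Rightarrow> 'a" and unit :: "'o \<Rightarrow> 'a" and neg :: "'a \<Rightarrow> 'a"
  assumes G_obj: "G \<in> Obj C"
    and mul_hom: "a \<in> Hom C X G \<Longrightarrow> b \<in> Hom C X G \<Longrightarrow> mul a b \<in> Hom C X G"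
    and unit_hom: "X \<in> Obj C \<Longrightarrow> unit X \<in> Hom C X G"
    and neg_hom: "a \<in> Hom C X G \<Longrightarrow> neg a \<in> Hom C X G"
    and mul_assoc: "a \<in> Hom C X G \<Longrightarrow> b \<in> Hom C X G \<Longrightarrow> c \<in> Hom C X G \<Longrightarrow> mul (mul a b) c = mul a (mul b c)"
    and mul_unit_left: "a \<in> Hom C X G \<Longrightarrow> mul (unit X) a = a"
    and mul_unit_right: "a \<in> Hom C X G \<Longrightarrow> mul a (unit X) = a"
    and mul_neg_left: "a \<in> Hom C X G \<Longrightarrow> mul (neg a) a = unit X"
    and mul_neg_right: "a \<in> Hom C X G \<Longrightarrow> mul a (neg a) = unit X"
    and mul_comp: "a \<in> Hom C X G \<Longrightarrow> b \<in> Hom C X G \<Longrightarrow> h \<in> Hom C Y X \<Longrightarrow> mul a b \<cdot> h = mul (a \<cdot> h) (b \<cdot> h)"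
    and unit_comp: "h \<in> Hom C Y X \<Longrightarrow> unit X \<cdot> h = unit Y"
    and neg_comp: "a \<in> Hom C X G \<Longrightarrow> h \<in> Hom C Y X \<Longrightarrow> neg a \<cdot> h = neg (a \<cdot> h)"

text \<open>Arrows into a power are tuples of arrows, which are multiplied componentwise; every law holds
  because it holds after each projection.\<close>

lemma (in natural_group) natural_group_power:
  assumes A: "is_product C k (\<lambda>_. G) A p"
  shows "\<exists>mul' unit' neg'. natural_group C A mul' unit' neg'"
proof -
  define m where "m a b = lift C k A p (Dom C a) (\<lambda>i. mul (p i \<cdot> a) (p i \<cdot> b))" for a b
  define e where "e X = lift C k A p X (\<lambda>i. unit X)" for X
  define s where "s a = lift C k A p (Dom C a) (\<lambda>i. neg (p i \<cdot> a))" for a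
  have pa: "p i \<cdot> a \<in> Hom C X G" if "a \<in> Hom C X A" "i < k" for a X i
    using comp_hom[OF that(1) is_product_proj[OF A that(2)]] .
  have mh: "m a b \<in> Hom C X A" if "a \<in> Hom C X A" "b \<in> Hom C X A" for a b X
    unfolding m_def Hom_Dom[OF that(1)]
    by (rule lift_hom[OF A Hom_dom_obj[OF that(1)]]) (intro mul_hom pa that)
  have eh: "e X \<in> Hom C X A" if "X \<in> Obj C" for X
    unfolding e_def by (rule lift_hom[OF A that]) (intro unit_hom that)
  have sh: "s a \<in> Hom C X A" if "a \<in> Hom C X A" for a X
    unfolding s_def Hom_Dom[OF that(1)]
    by (rule lift_hom[OF A Hom_dom_obj[OF that(1)]]) (intro neg_hom pa that)
  have pm: "p i \<cdot> m a b = mul (p i \<cdot> a) (p i \<cdot> b)" if "a \<in> Hom C X A" "b \<in> Hom C X A" "i < k" for a b X i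
    unfolding m_def Hom_Dom[OF that(1)]
    by (rule proj_lift[OF A Hom_dom_obj[OF that(1)] _ that(3)]) (intro mul_hom pa that)
  have pe: "p i \<cdot> e X = unit X" if "X \<in> Obj C" "i < k" for X i
    unfolding e_def by (rule proj_lift[OF A that(1) _ that(2)]) (intro unit_hom that)
  have ps: "p i \<cdot> s a = neg (p i \<cdot> a)" if "a \<in> Hom C X A" "i < k" for a X i
    unfolding s_def Hom_Dom[OF that(1)]
    by (rule proj_lift[OF A Hom_dom_obj[OF that(1)] _ that(2)]) (intro neg_hom pa that)
  have pc: "p i \<cdot> (a \<cdot> h) = (p i \<cdot> a) \<cdot> h" if "a \<in> Hom C X A" "h \<in> Hom C Y X" "i < k" for a h X Y i
    using comp_assoc[OF that(2,1) is_product_proj[OF A that(3)]] by simp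
  have "natural_group C A m e s"
  proof (unfold_locales)
    show "A \<in> Obj C" by (rule is_product_obj[OF A])
  next
    fix a b c X assume a: "a \<in> Hom C X A" and b: "b \<in> Hom C X A" and c: "c \<in> Hom C X A"
    show "m (m a b) c = m a (m b c)"
      by (rule product_eqI[OF A mh[OF mh[OF a b] c] mh[OF a mh[OF b c]]])
        (simp add: pm[OF a b] pm[OF mh[OF a b] c] pm[OF b c] pm[OF a mh[OF b c]] mul_assoc[OF pa[OF a] pa[OF b] pa[OF c]])
  next
    fix a X assume a: "a \<in> Hom C X A"
    note X = Hom_dom_obj[OF a]
    show "m (e X) a = a"
      by (rule product_eqI[OF A mh[OF eh[OF X] a] a]) (simp add: pm[OF eh[OF X] a] pe[OF X] mul_unit_left[OF pa[OF a]])
    show "m a (e X) = a"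
      by (rule product_eqI[OF A mh[OF a eh[OF X]] a]) (simp add: pm[OF a eh[OF X]] pe[OF X] mul_unit_right[OF pa[OF a]])
    show "m (s a) a = e X"
      by (rule product_eqI[OF A mh[OF sh[OF a] a] eh[OF X]]) (simp add: pm[OF sh[OF a] a] pe[OF X] ps[OF a] mul_neg_left[OF pa[OF a]])
    show "m a (s a) = e X"
      by (rule product_eqI[OF A mh[OF a sh[OF a]] eh[OF X]]) (simp add: pm[OF a sh[OF a]] pe[OF X] ps[OF a] mul_neg_right[OF pa[OF a]])
  next
    fix a b h X Y assume a: "a \<in> Hom C X A" and b: "b \<in> Hom C X A" and h: "h \<in> Hom C Y X"
    note ah = comp_hom[OF h a] and bh = comp_hom[OF h b]
    show "m a b \<cdot> h = m (a \<cdot> h) (b \<cdot> h)"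
      by (rule product_eqI[OF A comp_hom[OF h mh[OF a b]] mh[OF ah bh]])
        (simp add: pm[OF ah bh] pc[OF mh[OF a b] h] pm[OF a b] pc[OF a h] pc[OF b h] mul_comp[OF pa[OF a] pa[OF b] h])
  next
    fix h X Y assume h: "h \<in> Hom C Y X"
    note X = Hom_cod_obj[OF h] and Y = Hom_dom_obj[OF h]
    show "e X \<cdot> h = e Y"
      by (rule product_eqI[OF A comp_hom[OF h eh[OF X]] eh[OF Y]]) (simp add: pc[OF eh[OF X] h] pe[OF X] pe[OF Y] unit_comp[OF h])
  next
    fix a h X Y assume a: "a \<in> Hom C X A" and h: "h \<in> Hom C Y X"
    note ah = comp_hom[OF h a]
    show "s a \<cdot> h = s (a \<cdot> h)"
      by (rule product_eqI[OF A comp_hom[OF h sh[OF a]] sh[OF ah]]) (simp add: pc[OF sh[OF a] h] ps[OF a] ps[OF ah] pc[OF a h] neg_comp[OF pa[OF a] h])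
  qed (fact mh eh sh)+
  then show ?thesis by blast
qed

primrec geval :: "('a \<Rightarrow> 'a \<Rightarrow> 'a) \<Rightarrow> 'a \<Rightarrow> ('a \<Rightarrow> 'a) \<Rightarrow> (nat \<Rightarrow> 'a) \<Rightarrow> nat gterm \<Rightarrow> 'a" where
  "geval m e s \<rho> (GVar i) = \<rho> i"
| "geval m e s \<rho> GOne = e"
| "geval m e s \<rho> (GInv t) = s (geval m e s \<rho> t)"
| "geval m e s \<rho> (GMul t u) = m (geval m e s \<rho> t) (geval m e s \<rho> u)"

context natural_group
begin

abbreviation "ev X \<equiv> geval mul (unit X) neg"

lemma ev_hom: "X \<in> Obj C \<Longrightarrow> t \<in> gterms n \<Longrightarrow> (\<And>i. i < n \<Longrightarrow> \<rho> i \<in> Hom C X G) \<Longrightarrow> ev X \<rho> t \<in> Hom C X G"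
  by (induction t) (auto intro: mul_hom unit_hom neg_hom)

lemma ev_comp: "t \<in> gterms n \<Longrightarrow> (\<And>i. i < n \<Longrightarrow> \<rho> i \<in> Hom C X G) \<Longrightarrow> h \<in> Hom C Y X \<Longrightarrow>
    ev X \<rho> t \<cdot> h = ev Y (\<lambda>i. \<rho> i \<cdot> h) t"
proof (induction t)
  case (GInv t)
  then show ?case using neg_comp[OF ev_hom[OF Hom_cod_obj, of h Y X t n \<rho>]] by simp
next
  case (GMul t u)
  then show ?case
    using mul_comp[OF ev_hom[OF Hom_cod_obj, of h Y X t n \<rho>] ev_hom[OF Hom_cod_obj, of h Y X u n \<rho>]] by simp
qed (auto simp: unit_comp)

lemma ev_gsubst: "ev X \<rho> (gsubst \<sigma> t) = ev X (\<lambda>i. ev X \<rho> (\<sigma> i)) t"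
  by (induction t) auto

lemma ev_cong: "t \<in> gterms n \<Longrightarrow> (\<And>i. i < n \<Longrightarrow> \<rho> i = \<rho>' i) \<Longrightarrow> ev X \<rho> t = ev X \<rho>' t"
  by (induction t) auto

text \<open>Soundness: equations derivable from the group axioms hold for all arrows into a group object.\<close>

lemma ev_geq: "geq n t u \<Longrightarrow> X \<in> Obj C \<Longrightarrow> (\<And>i. i < n \<Longrightarrow> \<rho> i \<in> Hom C X G) \<Longrightarrow> ev X \<rho> t = ev X \<rho> u"
proof (induction rule: geq.induct)
  case (geq_assoc t u v)
  then show ?case using mul_assoc[OF ev_hom ev_hom ev_hom] by simp
next
  case (geq_l_one t)
  then show ?case using mul_unit_left[OF ev_hom] by simp
next
  case (geq_r_one t)
  then show ?case using mul_unit_right[OF ev_hom] by simp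
next
  case (geq_l_inv t)
  then show ?case using mul_neg_left[OF ev_hom] by simp
next
  case (geq_r_inv t)
  then show ?case using mul_neg_right[OF ev_hom] by simp
qed auto

end

text \<open>A term in \<open>m\<close> variables is evaluated at the \<open>m\<close> projections of $T^m$, which gives an arrow
  $T^m \to T$. By naturality, evaluation at other arrows is composition with this one, and therefore
  substitution of terms goes to composition of arrows.\<close>

lemma natural_group_theory_morphism:
  assumes T: "lawvere_theory T" and G: "natural_group (base T) (pow T 1) mul unit neg"
  shows "\<exists>F. theory_morphism theory_of_groups T F"
proof -
  interpret natural_group "base T" "pow T 1" mul unit neg by (rule G)
  let ?B = "base T"
  have P: "is_product ?B n (\<lambda>_. pow T 1) (pow T n) (prj T n)" for n
    using T unfolding lawvere_theory_def by blast
  have PO: "pow T n \<in> Obj ?B" for n by (rule is_product_obj[OF P])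
  have pr: "prj T n i \<in> Hom ?B (pow T n) (pow T 1)" if "i < n" for n i by (rule is_product_proj[OF P that])
  define E where "E m n \<sigma> = lift ?B n (pow T n) (prj T n) (pow T m) (\<lambda>i. ev (pow T m) (prj T m) (\<sigma> i))" for m n \<sigma>
  have Eh: "E m n \<sigma> \<in> Hom ?B (pow T m) (pow T n)" if "\<forall>i<n. \<sigma> i \<in> gterms m" for m n \<sigma>
    unfolding E_def by (rule lift_hom[OF P PO]) (use that in \<open>blast intro: ev_hom[OF PO] pr\<close>)
  have pE: "prj T n i \<cdot>\<^bsub>?B\<^esub> E m n \<sigma> = ev (pow T m) (prj T m) (\<sigma> i)" if "\<forall>i<n. \<sigma> i \<in> gterms m" "i < n" for m n \<sigma> i
    unfolding E_def by (rule proj_lift[OF P PO _ that(2)]) (use that in \<open>blast intro: ev_hom[OF PO] pr\<close>)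
  have E_geq: "E m n \<sigma> = E m n \<tau>" if "\<And>i. i < n \<Longrightarrow> geq m (\<sigma> i) (\<tau> i)" for m n \<sigma> \<tau>
    unfolding E_def by (rule lift_cong) (rule ev_geq[OF that PO pr])
  have E_comp: "E n k \<tau> \<cdot>\<^bsub>?B\<^esub> E m n \<sigma> = E m k (\<lambda>j. gsubst \<sigma> (\<tau> j))"
    if \<sigma>: "\<forall>i<n. \<sigma> i \<in> gterms m" and \<tau>: "\<forall>j<k. \<tau> j \<in> gterms n" for m n k \<sigma> \<tau>
  proof -
    have gs: "\<forall>j<k. gsubst \<sigma> (\<tau> j) \<in> gterms m" using \<sigma> \<tau> gsubst_gterms by blast
    show ?thesis
    proof (rule product_eqI[OF P comp_hom[OF Eh[OF \<sigma>] Eh[OF \<tau>]] Eh[OF gs]])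
      fix j assume j: "j < k"
      have "prj T k j \<cdot>\<^bsub>?B\<^esub> E n k \<tau> \<cdot>\<^bsub>?B\<^esub> E m n \<sigma> = (prj T k j \<cdot>\<^bsub>?B\<^esub> E n k \<tau>) \<cdot>\<^bsub>?B\<^esub> E m n \<sigma>"
        using comp_assoc[OF Eh[OF \<sigma>] Eh[OF \<tau>] pr[OF j]] by simp
      also have "\<dots> = ev (pow T m) (\<lambda>i. prj T n i \<cdot>\<^bsub>?B\<^esub> E m n \<sigma>) (\<tau> j)"
        unfolding pE[OF \<tau> j] by (rule ev_comp[OF _ pr Eh[OF \<sigma>]]) (use \<tau> j in auto)
      also have "\<dots> = ev (pow T m) (\<lambda>i. ev (pow T m) (prj T m) (\<sigma> i)) (\<tau> j)"
        by (rule ev_cong[of _ n]) (use \<tau> j pE[OF \<sigma>] in auto)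
      also have "\<dots> = prj T k j \<cdot>\<^bsub>?B\<^esub> E m k (\<lambda>j. gsubst \<sigma> (\<tau> j))"
        unfolding pE[OF gs j] ev_gsubst ..
      finally show "prj T k j \<cdot>\<^bsub>?B\<^esub> E n k \<tau> \<cdot>\<^bsub>?B\<^esub> E m n \<sigma> = prj T k j \<cdot>\<^bsub>?B\<^esub> E m k (\<lambda>j. gsubst \<sigma> (\<tau> j))" .
    qed
  qed
  define F where "F = \<lparr>Src = GrpB, Trg = ?B, OMap = pow T,
     AMap = (\<lambda>f\<in>Arr GrpB. E (fst f) (length (snd f)) (\<lambda>i. SOME t. t \<in> snd f ! i))\<rparr>"
  have FO: "OMap F n = pow T n" for n unfolding F_def by simp
  have FA: "AMap F (garr m n \<sigma>) = E m n \<sigma>" if \<sigma>: "\<forall>i<n. \<sigma> i \<in> gterms m" for m n \<sigma>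
  proof -
    have "geq m (\<sigma> i) (SOME t. t \<in> snd (garr m n \<sigma>) ! i)" if "i < n" for i
      using someI[of "\<lambda>t. t \<in> gclass m (\<sigma> i)" "\<sigma> i"] geq.geq_refl[of "\<sigma> i" m] \<sigma> that by (simp add: garr_def mem_gclass)
    then have "E m n \<sigma> = E m n (\<lambda>i. SOME t. t \<in> snd (garr m n \<sigma>) ! i)" by (rule E_geq)
    moreover have "garr m n \<sigma> \<in> Arr GrpB" using \<sigma> garr_hom[of n \<sigma> m] by (blast intro: Hom_Arr)
    moreover have "fst (garr m n \<sigma>) = m" "length (snd (garr m n \<sigma>)) = n" unfolding garr_def by simp_all
    ultimately show ?thesis unfolding F_def by simp
  qed
  have E_id: "E n n GVar = Ident ?B (pow T n)" for n
    by (rule product_eqI[OF P Eh ident_hom[OF PO]]) (simp_all add: pE ident_right[OF pr])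
  have arr: "\<exists>m n \<sigma>. (\<forall>i<n. \<sigma> i \<in> gterms m) \<and> f = garr m n \<sigma>" if "f \<in> Arr GrpB" for f
    using Hom_Arr_self[OF that] unfolding Hom_Grp by blast
  have dc: "Dom GrpB (garr m n \<sigma>) = m" "Cod GrpB (garr m n \<sigma>) = n" for m n \<sigma>
    unfolding Grp_simps garr_def by simp_all
  have Fun: "is_functor GrpB ?B F"
    unfolding is_functor_def
  proof (intro conjI ballI impI)
    show "Src F = GrpB" "Trg F = ?B" unfolding F_def by simp_all
    show "OMap F \<in> Obj GrpB \<rightarrow>\<^sub>E Obj ?B" using PO by (auto simp: FO Grp_simps)
    show "AMap F \<in> Arr GrpB \<rightarrow>\<^sub>E Arr ?B"
    proof (rule PiE_I)
      fix f assume "f \<in> Arr GrpB"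
      then obtain m n \<sigma> where f: "\<forall>i<n. \<sigma> i \<in> gterms m" "f = garr m n \<sigma>" using arr by blast
      then show "AMap F f \<in> Arr ?B" using Hom_Arr[OF Eh[OF f(1)]] FA[OF f(1)] by simp
    qed (simp add: F_def)
    show "AMap F (Ident GrpB A) = Ident ?B (OMap F A)" for A by (simp add: Grp_simps(5) FA E_id FO)
  next
    fix f assume "f \<in> Arr GrpB"
    then obtain m n \<sigma> where f: "\<forall>i<n. \<sigma> i \<in> gterms m" "f = garr m n \<sigma>" using arr by blast
    show "Dom ?B (AMap F f) = OMap F (Dom GrpB f)" "Cod ?B (AMap F f) = OMap F (Cod GrpB f)"
      unfolding f(2) FA[OF f(1)] FO dc using Eh[OF f(1)] by (rule Hom_Dom, rule Hom_Cod)
    fix g assume "g \<in> Arr GrpB" "Dom GrpB g = Cod GrpB f"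
    then obtain k \<tau> where g: "\<forall>i<k. \<tau> i \<in> gterms n" "g = garr n k \<tau>" using arr f(2) dc by metis
    have gs: "\<forall>j<k. gsubst \<sigma> (\<tau> j) \<in> gterms m" using f(1) g(1) gsubst_gterms by blast
    have gc: "garr n k \<tau> \<cdot>\<^bsub>GrpB\<^esub> garr m n \<sigma> = garr m k (\<lambda>j. gsubst \<sigma> (\<tau> j))"
      by (rule garr_comp) (use f(1) g(1) in auto)
    show "AMap F (g \<cdot>\<^bsub>GrpB\<^esub> f) = AMap F g \<cdot>\<^bsub>?B\<^esub> AMap F f"
      unfolding f(2) g(2) gc FA[OF f(1)] FA[OF g(1)] FA[OF gs] by (rule E_comp[OF f(1) g(1), symmetric])
  qed
  have "preserves_finite_products F"
  proof (rule preserves_products_of_powers[OF lawvere_Grp category_axioms Fun])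
    fix n
    have "is_product ?B n (\<lambda>_. pow T 1) (pow T n) (\<lambda>i. AMap F (prj theory_of_groups n i))"
    \<comment> \<open>The arrow \<open>prj T 1 0\<close> is an isomorphism, but it need not be the identity. So the images of the projections are \<open>prj T n i\<close> only up to this isomorphism, and regrouping with groups of size one absorbs it.\<close>
    proof (rule is_product_regroup[OF P P])
      show "bij_betw fst (SIGMA i:{..<n}. {..<1::nat}) {..<n}"
        by (rule bij_betw_byWitness[where f' = "\<lambda>i. (i, 0)"]) auto
      fix i assume i: "i < n"
      then have FG: "AMap F (prj theory_of_groups n i) = E n 1 (\<lambda>_. GVar i)" by (simp add: Grp_simps(8) FA)
      show "AMap F (prj theory_of_groups n i) \<in> Hom ?B (pow T n) (pow T 1)"
        unfolding FG using i by (intro Eh) simp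
      show "prj T 1 j \<cdot>\<^bsub>?B\<^esub> AMap F (prj theory_of_groups n i) = prj T n (fst (i, j))" if "j < 1" for j
        unfolding FG using i that pE[of 1 "\<lambda>_. GVar i" n j] by simp
    qed
    then show "is_product ?B n (\<lambda>_. OMap F (pow theory_of_groups 1)) (OMap F (pow theory_of_groups n)) (\<lambda>i. AMap F (prj theory_of_groups n i))"
      by (simp only: FO Grp_simps)
  qed
  then show ?thesis unfolding theory_morphism_def using Fun FO Grp_simps(7) by auto
qed

context
  fixes T :: "('o, 'a) lawvere"
  assumes T: "lawvere_theory T"
begin

interpretation B: category "base T" using T unfolding lawvere_theory_def by blast

lemma power_product: "is_product (base T) n (\<lambda>_. pow T 1) (pow T n) (prj T n)"
  using T unfolding lawvere_theory_def by blast

lemma pow_obj: "pow T n \<in> Obj (base T)"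
  by (rule is_product_obj[OF power_product])

lemma prj_hom: "i < n \<Longrightarrow> prj T n i \<in> Hom (base T) (pow T n) (pow T 1)"
  by (rule is_product_proj[OF power_product])

lemma pair_hom:
  assumes "a \<in> Hom (base T) X (pow T 1)" "b \<in> Hom (base T) X (pow T 1)"
  shows "pair T X a b \<in> Hom (base T) X (pow T 2)"
  unfolding pair_def tuple_eq_lift
  by (rule lift_hom[OF power_product B.Hom_dom_obj[OF assms(1)]]) (use assms in auto)

lemma pair_comp:
  assumes "a \<in> Hom (base T) X (pow T 1)" "b \<in> Hom (base T) X (pow T 1)" "h \<in> Hom (base T) Y X"
  shows "pair T X a b \<cdot>\<^bsub>base T\<^esub> h = pair T Y (a \<cdot>\<^bsub>base T\<^esub> h) (b \<cdot>\<^bsub>base T\<^esub> h)"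
proof -
  have "pair T X a b \<cdot>\<^bsub>base T\<^esub> h = lift (base T) 2 (pow T 2) (prj T 2) Y (\<lambda>i. (if i = 0 then a else b) \<cdot>\<^bsub>base T\<^esub> h)"
    unfolding pair_def tuple_eq_lift
    by (rule B.lift_comp[OF power_product _ assms(3)]) (use assms in auto)
  also have "\<dots> = pair T Y (a \<cdot>\<^bsub>base T\<^esub> h) (b \<cdot>\<^bsub>base T\<^esub> h)"
    unfolding pair_def tuple_eq_lift by (rule lift_cong) simp
  finally show ?thesis .
qed

lemma prj_pair:
  assumes "a \<in> Hom (base T) X (pow T 1)" "b \<in> Hom (base T) X (pow T 1)" "i < 2"
  shows "prj T 2 i \<cdot>\<^bsub>base T\<^esub> pair T X a b = (if i = 0 then a else b)"
  unfolding pair_def tuple_eq_lift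
  by (rule proj_lift[OF power_product B.Hom_dom_obj[OF assms(1)] _ assms(3)]) (use assms in auto)

lemma bang_hom: "X \<in> Obj (base T) \<Longrightarrow> bang T X \<in> Hom (base T) X (pow T 0)"
  unfolding bang_def tuple_eq_lift by (rule lift_hom[OF power_product]) auto

lemma hom_terminal_eq: "f \<in> Hom (base T) X (pow T 0) \<Longrightarrow> g \<in> Hom (base T) X (pow T 0) \<Longrightarrow> f = g"
  by (rule B.product_eqI[OF power_product]) auto

lemma bang_comp: "h \<in> Hom (base T) Y X \<Longrightarrow> bang T X \<cdot>\<^bsub>base T\<^esub> h = bang T Y"
  by (rule hom_terminal_eq[OF B.comp_hom[OF _ bang_hom] bang_hom]) (auto intro: B.Hom_dom_obj B.Hom_cod_obj)

text \<open>Generalised elements: each group law is an equation between arrows out of a power of \<open>T\<close>, and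
  composing it with a tuple of arrows out of \<open>X\<close> gives the law for the arrows out of \<open>X\<close>.\<close>

lemma natural_group_of_structure:
  assumes gs: "group_structure T m e s"
  shows "natural_group (base T) (pow T 1) (\<lambda>a b. m \<cdot>\<^bsub>base T\<^esub> pair T (Dom (base T) a) a b)
     (\<lambda>X. e \<cdot>\<^bsub>base T\<^esub> bang T X) (\<lambda>a. s \<cdot>\<^bsub>base T\<^esub> a)"
proof -
  let ?B = "base T" and ?G = "pow T 1"
  let ?H = "\<lambda>X. Hom (base T) X (pow T 1)"
  have m: "m \<in> Hom ?B (pow T 2) ?G" and e: "e \<in> Hom ?B (pow T 0) ?G" and s: "s \<in> Hom ?B ?G ?G"
    using gs unfolding group_structure_def Let_def by blast+
  note mh = B.comp_hom[OF pair_hom m]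
  have eh: "e \<cdot>\<^bsub>?B\<^esub> bang T X \<in> ?H X" if "X \<in> Obj ?B" for X by (rule B.comp_hom[OF bang_hom[OF that] e])
  have mc: "(m \<cdot>\<^bsub>?B\<^esub> pair T X a b) \<cdot>\<^bsub>?B\<^esub> h = m \<cdot>\<^bsub>?B\<^esub> pair T Y (a \<cdot>\<^bsub>?B\<^esub> h) (b \<cdot>\<^bsub>?B\<^esub> h)"
    if "a \<in> ?H X" "b \<in> ?H X" "h \<in> Hom ?B Y X" for a b h X Y
    using B.comp_assoc[OF that(3) pair_hom[OF that(1,2)] m] pair_comp[OF that] by simp
  have ec: "(e \<cdot>\<^bsub>?B\<^esub> bang T X) \<cdot>\<^bsub>?B\<^esub> h = e \<cdot>\<^bsub>?B\<^esub> bang T Y" if "h \<in> Hom ?B Y X" for h X Y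
    using B.comp_assoc[OF that bang_hom[OF B.Hom_cod_obj[OF that]] e] bang_comp[OF that] by simp
  have GO: "?G \<in> Obj ?B" by (rule pow_obj)
  note one = B.ident_hom[OF GO]
  have eqs: "m \<cdot>\<^bsub>?B\<^esub> pair T (pow T 3) (m \<cdot>\<^bsub>?B\<^esub> pair T (pow T 3) (prj T 3 0) (prj T 3 1)) (prj T 3 2)
       = m \<cdot>\<^bsub>?B\<^esub> pair T (pow T 3) (prj T 3 0) (m \<cdot>\<^bsub>?B\<^esub> pair T (pow T 3) (prj T 3 1) (prj T 3 2))"
    "m \<cdot>\<^bsub>?B\<^esub> pair T ?G (e \<cdot>\<^bsub>?B\<^esub> bang T ?G) (Ident ?B ?G) = Ident ?B ?G"
    "m \<cdot>\<^bsub>?B\<^esub> pair T ?G (Ident ?B ?G) (e \<cdot>\<^bsub>?B\<^esub> bang T ?G) = Ident ?B ?G"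
    "m \<cdot>\<^bsub>?B\<^esub> pair T ?G s (Ident ?B ?G) = e \<cdot>\<^bsub>?B\<^esub> bang T ?G"
    "m \<cdot>\<^bsub>?B\<^esub> pair T ?G (Ident ?B ?G) s = e \<cdot>\<^bsub>?B\<^esub> bang T ?G"
    using gs unfolding group_structure_def Let_def by blast+
  show ?thesis
  proof (unfold_locales)
    show "?G \<in> Obj ?B" by (rule GO)
    show "m \<cdot>\<^bsub>?B\<^esub> pair T (Dom ?B a) a b \<in> ?H X" if "a \<in> ?H X" "b \<in> ?H X" for a b X
      unfolding Hom_Dom[OF that(1)] by (rule mh[OF that])
    show "e \<cdot>\<^bsub>?B\<^esub> bang T X \<in> ?H X" if "X \<in> Obj ?B" for X by (rule eh[OF that])
    show "s \<cdot>\<^bsub>?B\<^esub> a \<in> ?H X" if "a \<in> ?H X" for a X by (rule B.comp_hom[OF that s])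
  next
    fix a b c X assume a: "a \<in> ?H X" and b: "b \<in> ?H X" and c: "c \<in> ?H X"
    let ?f = "\<lambda>i::nat. if i = 0 then a else if i = 1 then b else c"
    let ?t = "lift ?B 3 (pow T 3) (prj T 3) X ?f"
    have f: "?f i \<in> ?H X" if "i < 3" for i using a b c by simp
    have t: "?t \<in> Hom ?B X (pow T 3)" by (rule lift_hom[OF power_product B.Hom_dom_obj[OF a] f])
    have pt: "prj T 3 i \<cdot>\<^bsub>?B\<^esub> ?t = ?f i" if "i < 3" for i
      by (rule proj_lift[OF power_product B.Hom_dom_obj[OF a] f that])
    have p: "prj T 3 0 \<in> ?H (pow T 3)" "prj T 3 1 \<in> ?H (pow T 3)" "prj T 3 2 \<in> ?H (pow T 3)"
      by (rule prj_hom, simp)+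
    have pts: "prj T 3 0 \<cdot>\<^bsub>?B\<^esub> ?t = a" "prj T 3 1 \<cdot>\<^bsub>?B\<^esub> ?t = b" "prj T 3 2 \<cdot>\<^bsub>?B\<^esub> ?t = c"
      using pt[of 0] pt[of 1] pt[of 2] by simp_all
    have "m \<cdot>\<^bsub>?B\<^esub> pair T X (m \<cdot>\<^bsub>?B\<^esub> pair T X a b) c = m \<cdot>\<^bsub>?B\<^esub> pair T X a (m \<cdot>\<^bsub>?B\<^esub> pair T X b c)"
      using arg_cong[OF eqs(1), of "\<lambda>x. x \<cdot>\<^bsub>?B\<^esub> ?t"]
      unfolding mc[OF mh[OF p(1,2)] p(3) t] mc[OF p(1) mh[OF p(2,3)] t] mc[OF p(1,2) t] mc[OF p(2,3) t] pts .
    then show "m \<cdot>\<^bsub>?B\<^esub> pair T (Dom ?B (m \<cdot>\<^bsub>?B\<^esub> pair T (Dom ?B a) a b)) (m \<cdot>\<^bsub>?B\<^esub> pair T (Dom ?B a) a b) c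
      = m \<cdot>\<^bsub>?B\<^esub> pair T (Dom ?B a) a (m \<cdot>\<^bsub>?B\<^esub> pair T (Dom ?B b) b c)"
      unfolding Hom_Dom[OF a] Hom_Dom[OF b] Hom_Dom[OF mh[OF a b]] .
  next
    fix a X assume a: "a \<in> ?H X"
    note X = B.Hom_dom_obj[OF a]
    note sh = B.comp_hom[OF a s]
    note r = mc[OF eh[OF GO] one a] mc[OF one eh[OF GO] a] mc[OF s one a] mc[OF one s a] ec[OF a] B.ident_left[OF a]
    have "m \<cdot>\<^bsub>?B\<^esub> pair T X (e \<cdot>\<^bsub>?B\<^esub> bang T X) a = a"
      using arg_cong[OF eqs(2), of "\<lambda>x. x \<cdot>\<^bsub>?B\<^esub> a"] unfolding r .
    then show "m \<cdot>\<^bsub>?B\<^esub> pair T (Dom ?B (e \<cdot>\<^bsub>?B\<^esub> bang T X)) (e \<cdot>\<^bsub>?B\<^esub> bang T X) a = a"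
      unfolding Hom_Dom[OF eh[OF X]] .
    show "m \<cdot>\<^bsub>?B\<^esub> pair T (Dom ?B a) a (e \<cdot>\<^bsub>?B\<^esub> bang T X) = a"
      using arg_cong[OF eqs(3), of "\<lambda>x. x \<cdot>\<^bsub>?B\<^esub> a"] unfolding r Hom_Dom[OF a] .
    have "m \<cdot>\<^bsub>?B\<^esub> pair T X (s \<cdot>\<^bsub>?B\<^esub> a) a = e \<cdot>\<^bsub>?B\<^esub> bang T X"
      using arg_cong[OF eqs(4), of "\<lambda>x. x \<cdot>\<^bsub>?B\<^esub> a"] unfolding r .
    then show "m \<cdot>\<^bsub>?B\<^esub> pair T (Dom ?B (s \<cdot>\<^bsub>?B\<^esub> a)) (s \<cdot>\<^bsub>?B\<^esub> a) a = e \<cdot>\<^bsub>?B\<^esub> bang T X"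
      unfolding Hom_Dom[OF sh] .
    show "m \<cdot>\<^bsub>?B\<^esub> pair T (Dom ?B a) a (s \<cdot>\<^bsub>?B\<^esub> a) = e \<cdot>\<^bsub>?B\<^esub> bang T X"
      using arg_cong[OF eqs(5), of "\<lambda>x. x \<cdot>\<^bsub>?B\<^esub> a"] unfolding r Hom_Dom[OF a] .
  next
    fix a b h X Y assume a: "a \<in> ?H X" and b: "b \<in> ?H X" and h: "h \<in> Hom ?B Y X"
    show "(m \<cdot>\<^bsub>?B\<^esub> pair T (Dom ?B a) a b) \<cdot>\<^bsub>?B\<^esub> h =
       m \<cdot>\<^bsub>?B\<^esub> pair T (Dom ?B (a \<cdot>\<^bsub>?B\<^esub> h)) (a \<cdot>\<^bsub>?B\<^esub> h) (b \<cdot>\<^bsub>?B\<^esub> h)"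
      unfolding Hom_Dom[OF a] Hom_Dom[OF B.comp_hom[OF h a]] by (rule mc[OF a b h])
  next
    show "(e \<cdot>\<^bsub>?B\<^esub> bang T X) \<cdot>\<^bsub>?B\<^esub> h = e \<cdot>\<^bsub>?B\<^esub> bang T Y" if "h \<in> Hom ?B Y X" for h X Y by (rule ec[OF that])
    show "(s \<cdot>\<^bsub>?B\<^esub> a) \<cdot>\<^bsub>?B\<^esub> h = s \<cdot>\<^bsub>?B\<^esub> a \<cdot>\<^bsub>?B\<^esub> h" if "a \<in> ?H X" "h \<in> Hom ?B Y X" for a h X Y
      by (rule B.comp_assoc[OF that(2,1) s])
  qed
qed

text \<open>The Yoneda direction: the multiplication is recovered as the product of the two projections of
  $T^2$, the inversion as the inverse of the identity of \<open>T\<close>.\<close>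

lemma structure_of_natural_group:
  assumes G: "natural_group (base T) (pow T 1) mul unit neg"
  shows "group_structure T (mul (prj T 2 0) (prj T 2 1)) (unit (pow T 0)) (neg (Ident (base T) (pow T 1)))"
proof -
  interpret natural_group "base T" "pow T 1" mul unit neg by (rule G)
  let ?B = "base T" and ?G = "pow T 1"
  let ?H = "\<lambda>X. Hom (base T) X (pow T 1)"
  let ?m = "mul (prj T 2 0) (prj T 2 1)"
  have p2: "prj T 2 0 \<in> ?H (pow T 2)" "prj T 2 1 \<in> ?H (pow T 2)" by (rule prj_hom, simp)+
  have p3: "prj T 3 0 \<in> ?H (pow T 3)" "prj T 3 1 \<in> ?H (pow T 3)" "prj T 3 2 \<in> ?H (pow T 3)" by (rule prj_hom, simp)+
  have m: "?m \<cdot>\<^bsub>?B\<^esub> pair T X a b = mul a b" if "a \<in> ?H X" "b \<in> ?H X" for a b X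
    using mul_comp[OF p2 pair_hom[OF that]] prj_pair[OF that, of 0] prj_pair[OF that, of 1] by simp
  have e: "unit (pow T 0) \<cdot>\<^bsub>?B\<^esub> bang T ?G = unit ?G" by (rule unit_comp[OF bang_hom[OF G_obj]])
  note one = B.ident_hom[OF G_obj]
  note eh = unit_hom[OF G_obj] and sh = neg_hom[OF one]
  show ?thesis
    unfolding group_structure_def Let_def e m[OF p3(1,2)] m[OF p3(2,3)] m[OF mul_hom[OF p3(1,2)] p3(3)]
      m[OF p3(1) mul_hom[OF p3(2,3)]] m[OF eh one] m[OF one eh] m[OF sh one] m[OF one sh]
    using mul_hom[OF p2] unit_hom[OF pow_obj] sh mul_assoc[OF p3] mul_unit_left[OF one] mul_unit_right[OF one]
      mul_neg_left[OF one] mul_neg_right[OF one] by blast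
qed

text \<open>The arrow of a term \<open>t\<close> is carried by \<open>F\<close> to an operation \<open>ev\<close> on arrows into the generator.
  Since \<open>F\<close> need not carry the chosen projections to the chosen projections, tuples are formed
  with respect to the images \<open>q\<close> of the projections, which again exhibit powers. Functoriality makes
  \<open>ev\<close> compatible with substitution, so the group laws hold because they hold in the theory of
  groups.\<close>

lemma theory_morphism_natural_group:
  assumes F: "theory_morphism theory_of_groups T F"
  shows "\<exists>mul unit neg. natural_group (base T) (pow T 1) mul unit neg"
proof -
  let ?B = "base T" and ?G = "pow T 1"
  let ?H = "\<lambda>X. Hom (base T) X (pow T 1)"
  have Fun: "is_functor GrpB ?B F" and pres: "preserves_finite_products F" and FO: "OMap F n = pow T n" for n
    using F unfolding theory_morphism_def Grp_simps(7) by blast+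
  define q where "q n i = AMap F (garr n 1 (\<lambda>_. GVar i))" for n i
  have "is_product GrpB n (\<lambda>_. 1) n (\<lambda>i. garr n 1 (\<lambda>_. GVar i))" for n
    using lawvere_Grp unfolding lawvere_theory_def Grp_simps(7,8) by blast
  then have Q: "is_product ?B n (\<lambda>_. ?G) (pow T n) (q n)" for n
    using pres Fun unfolding preserves_finite_products_def is_functor_def q_def FO[symmetric] by simp
  have Fh: "AMap F (garr n k \<sigma>) \<in> Hom ?B (pow T n) (pow T k)" if "\<forall>i<k. \<sigma> i \<in> gterms n" for n k \<sigma>
    using functor_hom[OF Fun, of "garr n k \<sigma>" n k] that garr_hom[of k \<sigma> n] unfolding FO by blast
  define tup where "tup n X \<rho> = lift ?B n (pow T n) (q n) X \<rho>" for n X \<rho>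
  have th: "tup n X \<rho> \<in> Hom ?B X (pow T n)" if "X \<in> Obj ?B" "\<forall>i<n. \<rho> i \<in> ?H X" for n X \<rho>
    unfolding tup_def by (rule lift_hom[OF Q that(1)]) (use that in auto)
  have qt: "q n i \<cdot>\<^bsub>?B\<^esub> tup n X \<rho> = \<rho> i" if "X \<in> Obj ?B" "\<forall>i<n. \<rho> i \<in> ?H X" "i < n" for n X \<rho> i
    unfolding tup_def by (rule proj_lift[OF Q that(1) _ that(3)]) (use that in auto)
  have tup_cong: "tup n X \<rho> = tup n X \<rho>'" if "\<forall>i<n. \<rho> i = \<rho>' i" for n X \<rho> \<rho>'
    unfolding tup_def by (rule lift_cong) (use that in auto)
  have tup_comp: "tup n X \<rho> \<cdot>\<^bsub>?B\<^esub> h = tup n Y (\<lambda>i. \<rho> i \<cdot>\<^bsub>?B\<^esub> h)" if "\<forall>i<n. \<rho> i \<in> ?H X" "h \<in> Hom ?B Y X" for n X Y \<rho> h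
    unfolding tup_def by (rule B.lift_comp[OF Q _ that(2)]) (use that in auto)
  define ev where "ev n t X \<rho> = AMap F (garr n 1 (\<lambda>_. t)) \<cdot>\<^bsub>?B\<^esub> tup n X \<rho>" for n t X \<rho>
  have ev_hom: "ev n t X \<rho> \<in> ?H X" if "t \<in> gterms n" "X \<in> Obj ?B" "\<forall>i<n. \<rho> i \<in> ?H X" for n t X \<rho>
    unfolding ev_def using B.comp_hom[OF th[OF that(2,3)] Fh[of 1]] that(1) by simp
  have ev_var: "ev n (GVar i) X \<rho> = \<rho> i" if "X \<in> Obj ?B" "\<forall>i<n. \<rho> i \<in> ?H X" "i < n" for n X \<rho> i
    unfolding ev_def using qt[OF that] unfolding q_def .
  have ev_cong: "ev n t X \<rho> = ev n t X \<rho>'" if "\<forall>i<n. \<rho> i = \<rho>' i" for n t X \<rho> \<rho>'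
    unfolding ev_def using tup_cong[OF that] by simp
  have ev_geq: "ev n t X \<rho> = ev n u X \<rho>" if "geq n t u" for n t u X \<rho>
    unfolding ev_def using garr_eq_iff[of 1 "\<lambda>_. t" n "\<lambda>_. u"] that geq_gterms[OF that] by simp
  have ev_comp: "ev n t X \<rho> \<cdot>\<^bsub>?B\<^esub> h = ev n t Y (\<lambda>i. \<rho> i \<cdot>\<^bsub>?B\<^esub> h)"
    if "t \<in> gterms n" "\<forall>i<n. \<rho> i \<in> ?H X" "h \<in> Hom ?B Y X" for n t X Y \<rho> h
    unfolding ev_def using B.comp_assoc[OF that(3) th[OF B.Hom_cod_obj[OF that(3)] that(2)] Fh[of 1 "\<lambda>_. t"]] that(1) tup_comp[OF that(2,3)]
    by simp
  have F_comp: "AMap F (garr k l \<tau>) \<cdot>\<^bsub>?B\<^esub> AMap F (garr n k \<sigma>) = AMap F (garr n l (\<lambda>j. gsubst \<sigma> (\<tau> j)))"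
    if "\<forall>i<k. \<sigma> i \<in> gterms n" "\<forall>j<l. \<tau> j \<in> gterms k" for k l n \<sigma> \<tau>
    using functor_comp_arr[OF Fun garr_hom[of k \<sigma> n] garr_hom[of l \<tau> k]] garr_comp[of k \<sigma> n l \<tau>] that by simp
  have F_tup: "AMap F (garr n k \<sigma>) \<cdot>\<^bsub>?B\<^esub> tup n X \<rho> = tup k X (\<lambda>i. ev n (\<sigma> i) X \<rho>)"
    if \<sigma>: "\<forall>i<k. \<sigma> i \<in> gterms n" and X: "X \<in> Obj ?B" and \<rho>: "\<forall>i<n. \<rho> i \<in> ?H X" for n k \<sigma> X \<rho>
  proof -
    have evk: "\<forall>i<k. ev n (\<sigma> i) X \<rho> \<in> ?H X" using ev_hom X \<rho> \<sigma> by blast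
    show ?thesis
    proof (rule B.product_eqI[OF Q B.comp_hom[OF th[OF X \<rho>] Fh[OF \<sigma>]] th[OF X evk]])
      fix i assume i: "i < k"
      have "q k i \<cdot>\<^bsub>?B\<^esub> AMap F (garr n k \<sigma>) \<cdot>\<^bsub>?B\<^esub> tup n X \<rho> = (q k i \<cdot>\<^bsub>?B\<^esub> AMap F (garr n k \<sigma>)) \<cdot>\<^bsub>?B\<^esub> tup n X \<rho>"
        using B.comp_assoc[OF th[OF X \<rho>] Fh[OF \<sigma>] is_product_proj[OF Q i]] by simp
      also have "q k i \<cdot>\<^bsub>?B\<^esub> AMap F (garr n k \<sigma>) = AMap F (garr n 1 (\<lambda>_. \<sigma> i))"
        unfolding q_def using F_comp[OF \<sigma>, of 1 "\<lambda>_. GVar i"] i by simp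
      finally show "q k i \<cdot>\<^bsub>?B\<^esub> AMap F (garr n k \<sigma>) \<cdot>\<^bsub>?B\<^esub> tup n X \<rho> = q k i \<cdot>\<^bsub>?B\<^esub> tup k X (\<lambda>i. ev n (\<sigma> i) X \<rho>)"
        unfolding qt[OF X evk i] unfolding ev_def .
    qed
  qed
  have ev_gsubst: "ev n (gsubst \<sigma> t) X \<rho> = ev k t X (\<lambda>i. ev n (\<sigma> i) X \<rho>)"
    if "\<forall>i<k. \<sigma> i \<in> gterms n" "t \<in> gterms k" "X \<in> Obj ?B" "\<forall>i<n. \<rho> i \<in> ?H X" for n k \<sigma> t X \<rho>
  proof -
    have "AMap F (garr n 1 (\<lambda>_. gsubst \<sigma> t)) = AMap F (garr k 1 (\<lambda>_. t)) \<cdot>\<^bsub>?B\<^esub> AMap F (garr n k \<sigma>)"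
      using F_comp[OF that(1), of 1 "\<lambda>_. t"] that(2) by simp
    then show ?thesis
      unfolding ev_def[of n "gsubst \<sigma> t"] ev_def[of k t]
      using B.comp_assoc[OF th[OF that(3,4)] Fh[OF that(1)] Fh[of 1 "\<lambda>_. t" k]] that(2) F_tup[OF that(1,3,4)] by simp
  qed
  define mul where "mul a b = ev 2 (GMul (GVar 0) (GVar 1)) (Dom ?B a) (\<lambda>i. if i = 0 then a else b)" for a b
  define unit where "unit X = ev 0 GOne X (\<lambda>_. undefined)" for X
  define neg where "neg a = ev 1 (GInv (GVar 0)) (Dom ?B a) (\<lambda>_. a)" for a
  have ev_mul: "ev n (GMul t u) X \<rho> = mul (ev n t X \<rho>) (ev n u X \<rho>)"
    if "t \<in> gterms n" "u \<in> gterms n" "X \<in> Obj ?B" "\<forall>i<n. \<rho> i \<in> ?H X" for n t u X \<rho>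
  proof -
    let ?\<sigma> = "\<lambda>i::nat. if i = 0 then t else u"
    have "ev n (gsubst ?\<sigma> (GMul (GVar 0) (GVar 1))) X \<rho> = ev 2 (GMul (GVar 0) (GVar 1)) X (\<lambda>i. ev n (?\<sigma> i) X \<rho>)"
      by (rule ev_gsubst[of 2 ?\<sigma>]) (use that in auto)
    also have "\<dots> = mul (ev n t X \<rho>) (ev n u X \<rho>)"
      unfolding mul_def Hom_Dom[OF ev_hom[OF that(1,3,4)]] by (rule ev_cong) simp
    finally show ?thesis by simp
  qed
  have ev_one: "ev n GOne X \<rho> = unit X" if "X \<in> Obj ?B" "\<forall>i<n. \<rho> i \<in> ?H X" for n X \<rho>
  proof -
    have "ev n (gsubst (\<lambda>_::nat. GOne) GOne) X \<rho> = ev 0 GOne X (\<lambda>i. ev n GOne X \<rho>)"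
      by (rule ev_gsubst[of 0 "\<lambda>_. GOne"]) (use that in auto)
    also have "\<dots> = unit X" unfolding unit_def by (rule ev_cong) simp
    finally show ?thesis by simp
  qed
  have ev_neg: "ev n (GInv t) X \<rho> = neg (ev n t X \<rho>)" if "t \<in> gterms n" "X \<in> Obj ?B" "\<forall>i<n. \<rho> i \<in> ?H X" for n t X \<rho>
  proof -
    have "ev n (gsubst (\<lambda>_::nat. t) (GInv (GVar 0))) X \<rho> = ev 1 (GInv (GVar 0)) X (\<lambda>i. ev n t X \<rho>)"
      by (rule ev_gsubst[of 1 "\<lambda>_. t"]) (use that in auto)
    then show ?thesis unfolding neg_def Hom_Dom[OF ev_hom[OF that]] by simp
  qed
  have "natural_group ?B ?G mul unit neg"
  proof (unfold_locales)
    show "?G \<in> Obj ?B" by (rule pow_obj)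
    show "mul a b \<in> ?H X" if "a \<in> ?H X" "b \<in> ?H X" for a b X
      unfolding mul_def Hom_Dom[OF that(1)] by (rule ev_hom) (use that B.Hom_dom_obj in auto)
    show "unit X \<in> ?H X" if "X \<in> Obj ?B" for X
      unfolding unit_def by (rule ev_hom) (use that in auto)
    show "neg a \<in> ?H X" if "a \<in> ?H X" for a X
      unfolding neg_def Hom_Dom[OF that(1)] by (rule ev_hom) (use that B.Hom_dom_obj in auto)
  next
    fix a b c X assume abc: "a \<in> ?H X" "b \<in> ?H X" "c \<in> ?H X"
    let ?\<rho> = "\<lambda>i::nat. if i = 0 then a else if i = 1 then b else c"
    note X = B.Hom_dom_obj[OF abc(1)]
    have \<rho>: "\<forall>i<3. ?\<rho> i \<in> ?H X" using abc by simp
    have v: "ev 3 (GVar 0) X ?\<rho> = a" "ev 3 (GVar 1) X ?\<rho> = b" "ev 3 (GVar 2) X ?\<rho> = c"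
      using ev_var[OF X \<rho>, of 0] ev_var[OF X \<rho>, of 1] ev_var[OF X \<rho>, of 2] by simp_all
    have g: "GVar 0 \<in> gterms 3" "GVar 1 \<in> gterms 3" "GVar 2 \<in> gterms 3" by simp_all
    have gg: "GMul (GVar 0) (GVar 1) \<in> gterms 3" "GMul (GVar 1) (GVar 2) \<in> gterms 3" by simp_all
    show "mul (mul a b) c = mul a (mul b c)"
      using ev_geq[OF geq_assoc[OF g], of X ?\<rho>]
      unfolding ev_mul[OF gg(1) g(3) X \<rho>] ev_mul[OF g(1) gg(2) X \<rho>] ev_mul[OF g(1,2) X \<rho>] ev_mul[OF g(2,3) X \<rho>] v .
  next
    fix a X assume a: "a \<in> ?H X"
    let ?\<rho> = "\<lambda>i::nat. a"
    note X = B.Hom_dom_obj[OF a]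
    have \<rho>: "\<forall>i<1. ?\<rho> i \<in> ?H X" using a by simp
    have g: "GVar 0 \<in> gterms 1" "GOne \<in> gterms 1" "GInv (GVar 0) \<in> gterms 1" by simp_all
    have v: "ev 1 (GVar 0) X ?\<rho> = a" using ev_var[OF X \<rho>, of 0] by simp
    note r = ev_mul[OF g(2,1) X \<rho>] ev_mul[OF g(1,2) X \<rho>] ev_mul[OF g(3,1) X \<rho>] ev_mul[OF g(1,3) X \<rho>]
      ev_neg[OF g(1) X \<rho>] ev_one[OF X \<rho>] v
    show "mul (unit X) a = a" using ev_geq[OF geq_l_one[OF g(1)], of X ?\<rho>] unfolding r .
    show "mul a (unit X) = a" using ev_geq[OF geq_r_one[OF g(1)], of X ?\<rho>] unfolding r .
    show "mul (neg a) a = unit X" using ev_geq[OF geq_l_inv[OF g(1)], of X ?\<rho>] unfolding r .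
    show "mul a (neg a) = unit X" using ev_geq[OF geq_r_inv[OF g(1)], of X ?\<rho>] unfolding r .
  next
    fix a b h X Y assume a: "a \<in> ?H X" "b \<in> ?H X" and h: "h \<in> Hom ?B Y X"
    have "mul a b \<cdot>\<^bsub>?B\<^esub> h = ev 2 (GMul (GVar 0) (GVar 1)) Y (\<lambda>i. (if i = 0 then a else b) \<cdot>\<^bsub>?B\<^esub> h)"
      unfolding mul_def Hom_Dom[OF a(1)] by (rule ev_comp[OF _ _ h]) (use a in auto)
    also have "\<dots> = mul (a \<cdot>\<^bsub>?B\<^esub> h) (b \<cdot>\<^bsub>?B\<^esub> h)"
      unfolding mul_def Hom_Dom[OF B.comp_hom[OF h a(1)]] by (rule ev_cong) simp
    finally show "mul a b \<cdot>\<^bsub>?B\<^esub> h = mul (a \<cdot>\<^bsub>?B\<^esub> h) (b \<cdot>\<^bsub>?B\<^esub> h)" .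
  next
    fix h X Y assume h: "h \<in> Hom ?B Y X"
    have "unit X \<cdot>\<^bsub>?B\<^esub> h = ev 0 GOne Y (\<lambda>i. undefined \<cdot>\<^bsub>?B\<^esub> h)"
      unfolding unit_def by (rule ev_comp[OF _ _ h]) auto
    also have "\<dots> = unit Y" unfolding unit_def by (rule ev_cong) simp
    finally show "unit X \<cdot>\<^bsub>?B\<^esub> h = unit Y" .
  next
    fix a h X Y assume a: "a \<in> ?H X" and h: "h \<in> Hom ?B Y X"
    show "neg a \<cdot>\<^bsub>?B\<^esub> h = neg (a \<cdot>\<^bsub>?B\<^esub> h)"
      unfolding neg_def Hom_Dom[OF a] Hom_Dom[OF B.comp_hom[OF h a]] by (rule ev_comp[OF _ _ h]) (use a in auto)
  qed
  then show ?thesis by blast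
qed

end

section \<open>Linear maps, free modules and quotients\<close>

lemma linear_mapsI:
  assumes "f \<in> carrier V \<rightarrow>\<^sub>E carrier W"
    and "\<And>v v'. v \<in> carrier V \<Longrightarrow> v' \<in> carrier V \<Longrightarrow> f (v \<oplus>\<^bsub>V\<^esub> v') = f v \<oplus>\<^bsub>W\<^esub> f v'"
    and "\<And>r v. r \<in> carrier K \<Longrightarrow> v \<in> carrier V \<Longrightarrow> f (r \<odot>\<^bsub>V\<^esub> v) = r \<odot>\<^bsub>W\<^esub> f v"
  shows "f \<in> linear_maps K V W"
  using assms unfolding linear_maps_def by blast

lemma restrict_linear_mapsI:
  assumes V: "module K V"
    and cl: "\<And>v. v \<in> carrier V \<Longrightarrow> f v \<in> carrier W"
    and add: "\<And>v v'. v \<in> carrier V \<Longrightarrow> v' \<in> carrier V \<Longrightarrow> f (v \<oplus>\<^bsub>V\<^esub> v') = f v \<oplus>\<^bsub>W\<^esub> f v'"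
    and smult: "\<And>r v. r \<in> carrier K \<Longrightarrow> v \<in> carrier V \<Longrightarrow> f (r \<odot>\<^bsub>V\<^esub> v) = r \<odot>\<^bsub>W\<^esub> f v"
  shows "restrict f (carrier V) \<in> linear_maps K V W"
proof -
  interpret V: module K V by fact
  show ?thesis by (rule linear_mapsI) (auto simp: cl add smult)
qed

lemma linear_map_closed: "f \<in> linear_maps K V W \<Longrightarrow> v \<in> carrier V \<Longrightarrow> f v \<in> carrier W"
  and linear_map_add: "f \<in> linear_maps K V W \<Longrightarrow> v \<in> carrier V \<Longrightarrow> v' \<in> carrier V \<Longrightarrow>
    f (v \<oplus>\<^bsub>V\<^esub> v') = f v \<oplus>\<^bsub>W\<^esub> f v'"
  and linear_map_smult: "f \<in> linear_maps K V W \<Longrightarrow> r \<in> carrier K \<Longrightarrow> v \<in> carrier V \<Longrightarrow>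
    f (r \<odot>\<^bsub>V\<^esub> v) = r \<odot>\<^bsub>W\<^esub> f v"
  and linear_map_ext: "f \<in> linear_maps K V W \<Longrightarrow> f \<in> extensional (carrier V)"
  unfolding linear_maps_def by (auto simp: PiE_def)

lemma linear_map_zero:
  assumes V: "module K V" and W: "module K W" and f: "f \<in> linear_maps K V W"
  shows "f \<zero>\<^bsub>V\<^esub> = \<zero>\<^bsub>W\<^esub>"
proof -
  interpret V: module K V by fact
  interpret W: module K W by fact
  have "f \<zero>\<^bsub>V\<^esub> = f (\<zero>\<^bsub>K\<^esub> \<odot>\<^bsub>V\<^esub> \<zero>\<^bsub>V\<^esub>)" by simp
  also have "\<dots> = \<zero>\<^bsub>K\<^esub> \<odot>\<^bsub>W\<^esub> f \<zero>\<^bsub>V\<^esub>" using f by (simp only: linear_map_smult V.R.zero_closed V.M.zero_closed)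
  also have "\<dots> = \<zero>\<^bsub>W\<^esub>" by (simp add: linear_map_closed[OF f])
  finally show ?thesis .
qed

lemma linear_map_minus:
  assumes V: "module K V" and W: "module K W" and f: "f \<in> linear_maps K V W"
    and "v \<in> carrier V" "v' \<in> carrier V"
  shows "f (v \<ominus>\<^bsub>V\<^esub> v') = f v \<ominus>\<^bsub>W\<^esub> f v'"
proof -
  interpret V: module K V by fact
  interpret W: module K W by fact
  have "f (v \<ominus>\<^bsub>V\<^esub> v') = f (v \<oplus>\<^bsub>V\<^esub> (\<ominus>\<^bsub>K\<^esub> \<one>\<^bsub>K\<^esub>) \<odot>\<^bsub>V\<^esub> v')"
    using assms by (simp add: V.smult_l_minus V.minus_eq)
  also have "\<dots> = f v \<oplus>\<^bsub>W\<^esub> (\<ominus>\<^bsub>K\<^esub> \<one>\<^bsub>K\<^esub>) \<odot>\<^bsub>W\<^esub> f v'"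
    using assms by (simp add: linear_map_add linear_map_smult)
  also have "\<dots> = f v \<ominus>\<^bsub>W\<^esub> f v'"
    using assms by (simp add: W.smult_l_minus W.minus_eq linear_map_closed)
  finally show ?thesis .
qed

lemma linear_map_comp:
  assumes "module K V" "f \<in> linear_maps K V W" "g \<in> linear_maps K W Z"
  shows "compose (carrier V) g f \<in> linear_maps K V Z"
  unfolding compose_def
  by (rule restrict_linear_mapsI[OF assms(1)])
     (auto simp: linear_map_closed[OF assms(2)] linear_map_closed[OF assms(3)]
       linear_map_add[OF assms(2)] linear_map_add[OF assms(3)]
       linear_map_smult[OF assms(2)] linear_map_smult[OF assms(3)])

lemma linear_map_id: "module K V \<Longrightarrow> (\<lambda>x\<in>carrier V. x) \<in> linear_maps K V V"
  by (rule restrict_linear_mapsI) auto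

lemma linear_map_eqI:
  assumes "f \<in> linear_maps K V W" "g \<in> linear_maps K V W" "\<And>v. v \<in> carrier V \<Longrightarrow> f v = g v"
  shows "f = g"
  using assms by (meson extensionalityI linear_map_ext)

lemma linear_map_finsum:
  assumes V: "module K V" and W: "module K W" and f: "f \<in> linear_maps K V W"
    and A: "finite A" and v: "v \<in> A \<rightarrow> carrier V"
  shows "f (finsum V v A) = finsum W (\<lambda>x. f (v x)) A"
proof -
  interpret V: module K V by fact
  interpret W: module K W by fact
  show ?thesis using A v
  proof (induction)
    case empty then show ?case by (simp add: linear_map_zero[OF V W f])
  next
    case (insert x A)
    then show ?case
      by (simp add: linear_map_add[OF f] V.finsum_closed linear_map_closed[OF f] Pi_def)
  qed
qed

lemma ground_module_simps [simp]:
  "carrier (ground_module K) = carrier K" "zero (ground_module K) = \<zero>\<^bsub>K\<^esub>"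
  "add (ground_module K) = add K" "smult (ground_module K) = mult K"
  unfolding ground_module_def by auto

lemma ground_module_module:
  assumes "cring K" shows "module K (ground_module K)"
proof -
  interpret cring K by fact
  have "\<exists>y\<in>carrier K. y \<oplus>\<^bsub>K\<^esub> x = \<zero>\<^bsub>K\<^esub>" if "x \<in> carrier K" for x
    using that l_neg by blast
  then show ?thesis
    by (intro moduleI abelian_groupI) (simp_all add: l_distr r_distr m_assoc a_ac assms)
qed

lemma free_module_simps [simp]:
  "zero (free_module K X) = (\<lambda>x. \<zero>\<^bsub>K\<^esub>)"
  "add (free_module K X) = (\<lambda>f g x. f x \<oplus>\<^bsub>K\<^esub> g x)"
  "smult (free_module K X) = (\<lambda>r f x. r \<otimes>\<^bsub>K\<^esub> f x)"
  unfolding free_module_def by auto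

lemma free_module_carrier:
  "f \<in> carrier (free_module K X) \<longleftrightarrow>
    (\<forall>x. f x \<in> carrier K) \<and> finite {x. f x \<noteq> \<zero>\<^bsub>K\<^esub>} \<and> {x. f x \<noteq> \<zero>\<^bsub>K\<^esub>} \<subseteq> X"
  unfolding free_module_def by auto

lemma free_module_module:
  assumes "cring K" shows "module K (free_module K X)"
proof -
  interpret cring K by fact
  have add: "(\<lambda>x. f x \<oplus>\<^bsub>K\<^esub> g x) \<in> carrier (free_module K X)"
    if "f \<in> carrier (free_module K X)" "g \<in> carrier (free_module K X)" for f g
  proof -
    have "{x. f x \<oplus>\<^bsub>K\<^esub> g x \<noteq> \<zero>\<^bsub>K\<^esub>} \<subseteq> {x. f x \<noteq> \<zero>\<^bsub>K\<^esub>} \<union> {x. g x \<noteq> \<zero>\<^bsub>K\<^esub>}" by auto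
    then show ?thesis using that
      unfolding free_module_carrier by (meson add.m_closed finite_UnI finite_subset le_sup_iff order_trans)
  qed
  have smult: "(\<lambda>x. r \<otimes>\<^bsub>K\<^esub> f x) \<in> carrier (free_module K X)"
    if f: "f \<in> carrier (free_module K X)" and r: "r \<in> carrier K" for f r
  proof -
    have f': "f x \<in> carrier K" for x using f by (simp add: free_module_carrier)
    have "f x \<noteq> \<zero>\<^bsub>K\<^esub>" if "r \<otimes>\<^bsub>K\<^esub> f x \<noteq> \<zero>\<^bsub>K\<^esub>" for x
      using that r by (metis r_null)
    then have "{x. r \<otimes>\<^bsub>K\<^esub> f x \<noteq> \<zero>\<^bsub>K\<^esub>} \<subseteq> {x. f x \<noteq> \<zero>\<^bsub>K\<^esub>}" by blast
    moreover have "finite {x. f x \<noteq> \<zero>\<^bsub>K\<^esub>}" "{x. f x \<noteq> \<zero>\<^bsub>K\<^esub>} \<subseteq> X"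
      using f by (simp_all add: free_module_carrier)
    ultimately show ?thesis using f' r
      unfolding free_module_carrier by (meson finite_subset m_closed order_trans)
  qed
  have neg: "\<exists>y\<in>carrier (free_module K X). (\<lambda>x. y x \<oplus>\<^bsub>K\<^esub> f x) = (\<lambda>x. \<zero>\<^bsub>K\<^esub>)"
    if "f \<in> carrier (free_module K X)" for f
  proof (rule bexI[of _ "\<lambda>x. (\<ominus>\<^bsub>K\<^esub> \<one>\<^bsub>K\<^esub>) \<otimes>\<^bsub>K\<^esub> f x"])
    have "(\<ominus>\<^bsub>K\<^esub> \<one>\<^bsub>K\<^esub>) \<otimes>\<^bsub>K\<^esub> a \<oplus>\<^bsub>K\<^esub> a = \<zero>\<^bsub>K\<^esub>" if "a \<in> carrier K" for a
      using that by (simp add: l_minus l_neg)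
    then show "(\<lambda>x. (\<ominus>\<^bsub>K\<^esub> \<one>\<^bsub>K\<^esub>) \<otimes>\<^bsub>K\<^esub> f x \<oplus>\<^bsub>K\<^esub> f x) = (\<lambda>x. \<zero>\<^bsub>K\<^esub>)"
      using that by (simp add: free_module_carrier)
  qed (rule smult[OF that], simp)
  have cl: "f x \<in> carrier K" if "f \<in> carrier (free_module K X)" for f x
    using that by (simp add: free_module_carrier)
  let ?F = "free_module K X"
  show ?thesis
  proof (intro moduleI abelian_groupI)
    show "\<zero>\<^bsub>?F\<^esub> \<in> carrier ?F"
      by (simp add: free_module_carrier)
    show "\<exists>y\<in>carrier ?F. y \<oplus>\<^bsub>?F\<^esub> f = \<zero>\<^bsub>?F\<^esub>" if "f \<in> carrier ?F" for f using neg[OF that] by simp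
  next
    fix f assume "f \<in> carrier ?F"
    then have f: "f x \<in> carrier K" for x by (rule cl)
    show "\<zero>\<^bsub>?F\<^esub> \<oplus>\<^bsub>?F\<^esub> f = f" "\<one>\<^bsub>K\<^esub> \<odot>\<^bsub>?F\<^esub> f = f" by (simp_all add: f)
    show "(a \<oplus>\<^bsub>K\<^esub> b) \<odot>\<^bsub>?F\<^esub> f = a \<odot>\<^bsub>?F\<^esub> f \<oplus>\<^bsub>?F\<^esub> b \<odot>\<^bsub>?F\<^esub> f" "(a \<otimes>\<^bsub>K\<^esub> b) \<odot>\<^bsub>?F\<^esub> f = a \<odot>\<^bsub>?F\<^esub> (b \<odot>\<^bsub>?F\<^esub> f)"
      if "a \<in> carrier K" "b \<in> carrier K" for a b using that by (simp_all add: f l_distr m_assoc)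
    fix g assume "g \<in> carrier ?F"
    then have g: "g x \<in> carrier K" for x by (rule cl)
    show "f \<oplus>\<^bsub>?F\<^esub> g = g \<oplus>\<^bsub>?F\<^esub> f" by (auto simp: f g a_comm)
    show "a \<odot>\<^bsub>?F\<^esub> (f \<oplus>\<^bsub>?F\<^esub> g) = a \<odot>\<^bsub>?F\<^esub> f \<oplus>\<^bsub>?F\<^esub> a \<odot>\<^bsub>?F\<^esub> g"
      if "a \<in> carrier K" for a using that by (simp add: f g r_distr)
    fix h assume "h \<in> carrier ?F"
    then have h: "h x \<in> carrier K" for x by (rule cl)
    show "f \<oplus>\<^bsub>?F\<^esub> g \<oplus>\<^bsub>?F\<^esub> h = f \<oplus>\<^bsub>?F\<^esub> (g \<oplus>\<^bsub>?F\<^esub> h)" by (simp add: f g h a_assoc)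
  qed (simp_all only: assms free_module_simps add smult)
qed

lemma basis_vec_carrier:
  assumes "cring K" "x \<in> X" shows "basis_vec K x \<in> carrier (free_module K X)"
proof -
  interpret cring K by fact
  have "{y. basis_vec K x y \<noteq> \<zero>\<^bsub>K\<^esub>} \<subseteq> {x}" unfolding basis_vec_def by auto
  then show ?thesis using assms
    unfolding free_module_carrier
    by (auto simp: basis_vec_def finite_subset)
qed

lemma free_module_induct [consumes 2, case_names zero step]:
  assumes K: "cring K" and v: "v \<in> carrier (free_module K X)"
    and zero: "P (\<lambda>x. \<zero>\<^bsub>K\<^esub>)"
    and step: "\<And>r x v. r \<in> carrier K \<Longrightarrow> x \<in> X \<Longrightarrow> v \<in> carrier (free_module K X) \<Longrightarrow> P v \<Longrightarrow>
       P ((r \<odot>\<^bsub>free_module K X\<^esub> basis_vec K x) \<oplus>\<^bsub>free_module K X\<^esub> v)"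
  shows "P v"
proof -
  interpret cring K by fact
  have "finite S \<Longrightarrow> v \<in> carrier (free_module K X) \<Longrightarrow> {x. v x \<noteq> \<zero>\<^bsub>K\<^esub>} = S \<Longrightarrow> P v" for S
  proof (induction S arbitrary: v rule: finite_induct)
    case empty
    then have "v = (\<lambda>x. \<zero>\<^bsub>K\<^esub>)" by auto
    then show ?case using zero by simp
  next
    case (insert x S)
    let ?w = "v(x := \<zero>\<^bsub>K\<^esub>)"
    have sup: "{y. ?w y \<noteq> \<zero>\<^bsub>K\<^esub>} = S" using insert by auto
    have w: "?w \<in> carrier (free_module K X)"
      unfolding free_module_carrier sup using insert.prems insert.hyps
      by (auto simp: free_module_carrier)
    have x: "x \<in> X" using insert.prems by (auto simp: free_module_carrier)
    have "(v x \<odot>\<^bsub>free_module K X\<^esub> basis_vec K x) \<oplus>\<^bsub>free_module K X\<^esub> ?w = v"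
      using insert.prems by (auto simp: basis_vec_def free_module_carrier)
    then show ?case using step[OF _ x w insert.IH[OF w sup], of "v x"] insert.prems
      by (auto simp: free_module_carrier)
  qed
  then show ?thesis using v unfolding free_module_carrier by blast
qed

text \<open>With the linear extensions constructed below, this is the universal property of the free module.\<close>

lemma free_module_linear_eq:
  assumes K: "cring K" and W: "module K W"
    and f: "f \<in> linear_maps K (free_module K X) W" and g: "g \<in> linear_maps K (free_module K X) W"
    and eq: "\<And>x. x \<in> X \<Longrightarrow> f (basis_vec K x) = g (basis_vec K x)"
  shows "f = g"
proof (rule linear_map_eqI[OF f g])
  interpret F: module K "free_module K X" using free_module_module[OF K] .
  note z = linear_map_zero[OF free_module_module[OF K] W]
  fix v assume "v \<in> carrier (free_module K X)"
  with K show "f v = g v"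
  proof (induction rule: free_module_induct)
    case zero
    show ?case using z[OF f] z[OF g] by simp
  next
    case (step r x v)
    have "basis_vec K x \<in> carrier (free_module K X)" by (rule basis_vec_carrier[OF K step(2)])
    then show ?case
      using step eq[OF step(2)]
      by (simp only: linear_map_add[OF f] linear_map_add[OF g] linear_map_smult[OF f] 
          linear_map_smult[OF g] F.smult_closed)
  qed
qed

text \<open>The sum runs over the support of \<open>v\<close>; lemma \<open>lin_ext_finsum\<close> allows any larger finite set, which
  is what makes additivity provable.\<close>

definition lin_ext ::
  "('k, 'r) ring_scheme \<Rightarrow> 'x set \<Rightarrow> ('k, 'w, 'y) module_scheme \<Rightarrow> ('x \<Rightarrow> 'w) \<Rightarrow> ('x \<Rightarrow> 'k) \<Rightarrow> 'w" where
  "lin_ext K X W f = (\<lambda>v\<in>carrier (free_module K X).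
     finsum W (\<lambda>x. v x \<odot>\<^bsub>W\<^esub> f x) {x. v x \<noteq> \<zero>\<^bsub>K\<^esub>})"

lemma lin_ext_finsum:
  assumes W: "module K W" and f: "f \<in> X \<rightarrow> carrier W" and v: "v \<in> carrier (free_module K X)"
    and A: "finite A" "{x. v x \<noteq> \<zero>\<^bsub>K\<^esub>} \<subseteq> A" "A \<subseteq> X"
  shows "lin_ext K X W f v = finsum W (\<lambda>x. v x \<odot>\<^bsub>W\<^esub> f x) A"
proof -
  interpret W: module K W by fact
  have "finsum W (\<lambda>x. v x \<odot>\<^bsub>W\<^esub> f x) {x. v x \<noteq> \<zero>\<^bsub>K\<^esub>} = finsum W (\<lambda>x. v x \<odot>\<^bsub>W\<^esub> f x) A"
    using A f v by (intro W.M.add.finprod_mono_neutral_cong_left) (auto simp: free_module_carrier Pi_def subset_iff)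
  then show ?thesis using v by (simp add: lin_ext_def)
qed

lemma lin_ext_linear:
  assumes W: "module K W" and f: "f \<in> X \<rightarrow> carrier W"
  shows "lin_ext K X W f \<in> linear_maps K (free_module K X) W"
proof -
  interpret W: module K W by fact
  have K: "cring K" by (rule W.R.is_cring)
  interpret F: module K "free_module K X" using free_module_module[OF K] .
  let ?h = "lin_ext K X W f"
  show ?thesis
  proof (rule linear_mapsI)
    show "?h \<in> carrier (free_module K X) \<rightarrow>\<^sub>E carrier W"
      unfolding lin_ext_def using f
      by (auto intro!: W.finsum_closed simp: free_module_carrier Pi_def subset_iff)
  next
    fix v v' assume v: "v \<in> carrier (free_module K X)" and v': "v' \<in> carrier (free_module K X)"
    let ?A = "{x. v x \<noteq> \<zero>\<^bsub>K\<^esub>} \<union> {x. v' x \<noteq> \<zero>\<^bsub>K\<^esub>}"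
    have A: "finite ?A" "?A \<subseteq> X" using v v' by (auto simp: free_module_carrier)
    have fA: "f x \<in> carrier W" if "x \<in> ?A" for x using A(2) f that by blast
    have k: "v x \<in> carrier K" "v' x \<in> carrier K" for x using v v' by (auto simp: free_module_carrier)
    have sup: "{x. (v \<oplus>\<^bsub>free_module K X\<^esub> v') x \<noteq> \<zero>\<^bsub>K\<^esub>} \<subseteq> ?A" by auto
    have 1: "?h (v \<oplus>\<^bsub>free_module K X\<^esub> v') = finsum W (\<lambda>x. (v x \<oplus>\<^bsub>K\<^esub> v' x) \<odot>\<^bsub>W\<^esub> f x) ?A"
      using lin_ext_finsum[OF W f F.M.add.m_closed[OF v v'] A(1) sup A(2)] by simp
    have 2: "?h v = finsum W (\<lambda>x. v x \<odot>\<^bsub>W\<^esub> f x) ?A"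
      by (rule lin_ext_finsum[OF W f v A(1) _ A(2)]) auto
    have 3: "?h v' = finsum W (\<lambda>x. v' x \<odot>\<^bsub>W\<^esub> f x) ?A"
      by (rule lin_ext_finsum[OF W f v' A(1) _ A(2)]) auto
    have "(\<Oplus>\<^bsub>W\<^esub>x\<in>?A. (v x \<oplus>\<^bsub>K\<^esub> v' x) \<odot>\<^bsub>W\<^esub> f x) = (\<Oplus>\<^bsub>W\<^esub>x\<in>?A. v x \<odot>\<^bsub>W\<^esub> f x \<oplus>\<^bsub>W\<^esub> v' x \<odot>\<^bsub>W\<^esub> f x)"
      by (rule W.finsum_cong') (use fA k W.smult_l_distr in auto)
    also have "\<dots> = (\<Oplus>\<^bsub>W\<^esub>x\<in>?A. v x \<odot>\<^bsub>W\<^esub> f x) \<oplus>\<^bsub>W\<^esub> (\<Oplus>\<^bsub>W\<^esub>x\<in>?A. v' x \<odot>\<^bsub>W\<^esub> f x)"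
      by (rule W.finsum_addf) (use fA k in auto)
    finally show "?h (v \<oplus>\<^bsub>free_module K X\<^esub> v') = ?h v \<oplus>\<^bsub>W\<^esub> ?h v'" unfolding 1 2 3 .
  next
    fix r v assume r: "r \<in> carrier K" and v: "v \<in> carrier (free_module K X)"
    let ?A = "{x. v x \<noteq> \<zero>\<^bsub>K\<^esub>}"
    have A: "finite ?A" "?A \<subseteq> X" using v by (auto simp: free_module_carrier)
    have fA: "f x \<in> carrier W" if "x \<in> ?A" for x using A(2) f that by blast
    have k: "v x \<in> carrier K" for x using v by (auto simp: free_module_carrier)
    have "v x \<noteq> \<zero>\<^bsub>K\<^esub>" if "r \<otimes>\<^bsub>K\<^esub> v x \<noteq> \<zero>\<^bsub>K\<^esub>" for x
      using that r by (metis W.R.r_null)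
    then have sup: "{x. (r \<odot>\<^bsub>free_module K X\<^esub> v) x \<noteq> \<zero>\<^bsub>K\<^esub>} \<subseteq> ?A" by auto
    have 1: "?h (r \<odot>\<^bsub>free_module K X\<^esub> v) = finsum W (\<lambda>x. (r \<otimes>\<^bsub>K\<^esub> v x) \<odot>\<^bsub>W\<^esub> f x) ?A"
      using lin_ext_finsum[OF W f F.smult_closed[OF r v] A(1) sup A(2)] by simp
    have 2: "?h v = finsum W (\<lambda>x. v x \<odot>\<^bsub>W\<^esub> f x) ?A"
      by (rule lin_ext_finsum[OF W f v A(1) _ A(2)]) auto
    have "(\<Oplus>\<^bsub>W\<^esub>x\<in>?A. (r \<otimes>\<^bsub>K\<^esub> v x) \<odot>\<^bsub>W\<^esub> f x) = (\<Oplus>\<^bsub>W\<^esub>x\<in>?A. r \<odot>\<^bsub>W\<^esub> (v x \<odot>\<^bsub>W\<^esub> f x))"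
      by (rule W.finsum_cong') (use fA k r W.smult_assoc1 in auto)
    also have "\<dots> = r \<odot>\<^bsub>W\<^esub> (\<Oplus>\<^bsub>W\<^esub>x\<in>?A. v x \<odot>\<^bsub>W\<^esub> f x)"
      by (rule W.finsum_smult_ldistr[symmetric]) (use A(1) fA k r in auto)
    finally show "?h (r \<odot>\<^bsub>free_module K X\<^esub> v) = r \<odot>\<^bsub>W\<^esub> ?h v" unfolding 1 2 .
  qed
qed

lemma lin_ext_basis:
  assumes W: "module K W" and f: "f \<in> X \<rightarrow> carrier W" and x: "x \<in> X"
  shows "lin_ext K X W f (basis_vec K x) = f x"
proof -
  interpret W: module K W by fact
  have K: "cring K" by (rule W.R.is_cring)
  have "lin_ext K X W f (basis_vec K x) = finsum W (\<lambda>y. basis_vec K x y \<odot>\<^bsub>W\<^esub> f y) {x}"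
    by (rule lin_ext_finsum[OF W f basis_vec_carrier[OF K x]]) (use x in \<open>auto simp: basis_vec_def\<close>)
  also have "\<dots> = f x" using x f by (simp add: basis_vec_def Pi_def)
  finally show ?thesis .
qed

lemma submodule_span_submodule:
  assumes M: "module K M" and S: "S \<subseteq> carrier M"
  shows "submodule (submodule_span K M S) K M"
proof -
  interpret M: module K M by fact
  note E = M.submoduleE
  show ?thesis
  proof (rule M.submoduleI)
    show "submodule_span K M S \<subseteq> carrier M"
      using M.carrier_is_submodule S unfolding submodule_span_def by blast
    show "\<zero>\<^bsub>M\<^esub> \<in> submodule_span K M S"
      unfolding submodule_span_def by (auto simp: submodule_def dest: subgroup.one_closed)
  qed (unfold submodule_span_def, use E(3) in blast, use E(5) in blast, use E(4) in blast)
qed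

lemma submodule_span_superset: "S \<subseteq> submodule_span K M S"
  unfolding submodule_span_def by blast

text \<open>The vectors on which a linear map vanishes form a submodule.\<close>

lemma linear_map_vanishes_on_span:
  assumes M: "module K M" and W: "module K W" and h: "h \<in> linear_maps K M W"
    and S: "S \<subseteq> carrier M" "\<And>s. s \<in> S \<Longrightarrow> h s = \<zero>\<^bsub>W\<^esub>" and v: "v \<in> submodule_span K M S"
  shows "h v = \<zero>\<^bsub>W\<^esub>"
proof -
  interpret M: module K M by fact
  interpret W: module K W by fact
  have "submodule {v \<in> carrier M. h v = \<zero>\<^bsub>W\<^esub>} K M"
  proof (rule M.submoduleI)
    show "\<ominus>\<^bsub>M\<^esub> a \<in> {v \<in> carrier M. h v = \<zero>\<^bsub>W\<^esub>}" if "a \<in> {v \<in> carrier M. h v = \<zero>\<^bsub>W\<^esub>}" for a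
      using linear_map_minus[OF M W h M.zero_closed, of a] that linear_map_zero[OF M W h]
      by (simp add: M.minus_eq W.minus_eq)
  qed (auto simp: linear_map_zero[OF M W h] linear_map_add[OF h] linear_map_smult[OF h])
  then show ?thesis using v S unfolding submodule_span_def by auto
qed

context
  fixes K :: "('k, 'r) ring_scheme" and M :: "('k, 'v, 'x) module_scheme" and N
  assumes M: "module K M" and N: "submodule N K M"
begin

lemma submodule_abelian_subgroup: "abelian_subgroup N M"
proof -
  interpret M: module K M by (rule M)
  show ?thesis
    using N by (intro abelian_subgroupI3 additive_subgroup.intro)
     (simp_all add: submodule_def M.abelian_group_axioms)
qed

lemma quotient_module_carrier: "carrier (quotient_module M N) = (\<lambda>x. N +>\<^bsub>M\<^esub> x) ` carrier M"
  unfolding quotient_module_def A_RCOSETS_def' by auto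

lemma quotient_module_add:
  assumes "x \<in> carrier M" "y \<in> carrier M"
  shows "(N +>\<^bsub>M\<^esub> x) \<oplus>\<^bsub>quotient_module M N\<^esub> (N +>\<^bsub>M\<^esub> y) = N +>\<^bsub>M\<^esub> (x \<oplus>\<^bsub>M\<^esub> y)"
  unfolding quotient_module_def
  using abelian_subgroup.a_rcos_sum[OF submodule_abelian_subgroup assms] by simp

lemma quotient_eq_iff:
  assumes "x \<in> carrier M" "y \<in> carrier M"
  shows "N +>\<^bsub>M\<^esub> x = N +>\<^bsub>M\<^esub> y \<longleftrightarrow> x \<ominus>\<^bsub>M\<^esub> y \<in> N"
proof -
  interpret M: module K M by (rule M)
  interpret N: abelian_subgroup N M by (rule submodule_abelian_subgroup)
  show ?thesis
    unfolding M.minus_eq N.a_rcos_module[OF assms(2,1), symmetric]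
    using N.a_repr_independence'[OF _ assms(2)] N.a_rcos_self[OF assms(1)] by blast
qed

lemma quotient_module_smult:
  assumes r: "r \<in> carrier K" and x: "x \<in> carrier M"
  shows "r \<odot>\<^bsub>quotient_module M N\<^esub> (N +>\<^bsub>M\<^esub> x) = N +>\<^bsub>M\<^esub> (r \<odot>\<^bsub>M\<^esub> x)"
proof -
  interpret M: module K M by (rule M)
  interpret N: abelian_subgroup N M by (rule submodule_abelian_subgroup)
  have "N +>\<^bsub>M\<^esub> (r \<odot>\<^bsub>M\<^esub> y) = N +>\<^bsub>M\<^esub> (r \<odot>\<^bsub>M\<^esub> x)" if y: "y \<in> N +>\<^bsub>M\<^esub> x" for y
  proof -
    have yc: "y \<in> carrier M" using N.a_elemrcos_carrier x y by blast
    have "N +>\<^bsub>M\<^esub> x = N +>\<^bsub>M\<^esub> y" using N.a_repr_independence'[OF y x] .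
    then have "y \<ominus>\<^bsub>M\<^esub> x \<in> N" using quotient_eq_iff[OF yc x] by simp
    then have "r \<odot>\<^bsub>M\<^esub> (y \<ominus>\<^bsub>M\<^esub> x) \<in> N" using M.submoduleE(4)[OF N r] by blast
    then have "r \<odot>\<^bsub>M\<^esub> y \<ominus>\<^bsub>M\<^esub> r \<odot>\<^bsub>M\<^esub> x \<in> N"
      using r x yc by (simp add: M.minus_eq M.smult_r_distr M.smult_r_minus)
    then show ?thesis using quotient_eq_iff r x yc by simp
  qed
  moreover have "x \<in> N +>\<^bsub>M\<^esub> x" using N.a_rcos_self x by simp
  ultimately have "(\<Union>y\<in>N +>\<^bsub>M\<^esub> x. N +>\<^bsub>M\<^esub> (r \<odot>\<^bsub>M\<^esub> y)) = N +>\<^bsub>M\<^esub> (r \<odot>\<^bsub>M\<^esub> x)"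
    by (intro UN_constant_eq ballI)
  then show ?thesis by (simp add: quotient_module_def)
qed

lemma quotient_module_zero: "\<zero>\<^bsub>quotient_module M N\<^esub> = N +>\<^bsub>M\<^esub> \<zero>\<^bsub>M\<^esub>"
proof -
  interpret M: module K M by (rule M)
  interpret N: abelian_subgroup N M by (rule submodule_abelian_subgroup)
  show ?thesis unfolding quotient_module_def by (simp add: M.a_coset_add_zero N.a_subset)
qed

lemma quotient_module_module: "module K (quotient_module M N)"
proof -
  interpret M: module K M by (rule M)
  note q = quotient_module_carrier quotient_module_add quotient_module_smult quotient_module_zero
  have neg: "\<exists>y\<in>carrier M. N +>\<^bsub>M\<^esub> (x \<oplus>\<^bsub>M\<^esub> y) = N +>\<^bsub>M\<^esub> \<zero>\<^bsub>M\<^esub>" if "x \<in> carrier M" for x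
    using M.r_neg[OF that] that by (metis M.a_inv_closed)
  show ?thesis
    by (intro moduleI abelian_groupI M.R.is_cring)
     (auto simp: q neg M.smult_l_distr M.smult_r_distr M.smult_assoc1 M.a_ac)
qed

lemma quotient_module_lift:
  assumes W: "module K W" and h: "h \<in> linear_maps K M W" and hN: "\<And>v. v \<in> N \<Longrightarrow> h v = \<zero>\<^bsub>W\<^esub>"
  shows "\<exists>h' \<in> linear_maps K (quotient_module M N) W. \<forall>v\<in>carrier M. h' (N +>\<^bsub>M\<^esub> v) = h v"
proof -
  interpret M: module K M by (rule M)
  interpret W: module K W by (rule W)
  interpret Q: module K "quotient_module M N" by (rule quotient_module_module)
  define h' where "h' = (\<lambda>X\<in>carrier (quotient_module M N). h (SOME v. v \<in> carrier M \<and> X = N +>\<^bsub>M\<^esub> v))"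
  have h': "h' (N +>\<^bsub>M\<^esub> v) = h v" if v: "v \<in> carrier M" for v
  proof -
    define w where "w = (SOME w. w \<in> carrier M \<and> N +>\<^bsub>M\<^esub> v = N +>\<^bsub>M\<^esub> w)"
    have w: "w \<in> carrier M \<and> N +>\<^bsub>M\<^esub> v = N +>\<^bsub>M\<^esub> w"
      unfolding w_def by (rule someI[of _ v]) (use v in auto)
    then have "v \<ominus>\<^bsub>M\<^esub> w \<in> N" using v quotient_eq_iff by blast
    then have "h v \<ominus>\<^bsub>W\<^esub> h w = \<zero>\<^bsub>W\<^esub>" using linear_map_minus[OF M W h v, of w] hN w by simp
    then have "\<ominus>\<^bsub>W\<^esub> (\<ominus>\<^bsub>W\<^esub> h w) = h v"
      using v w linear_map_closed[OF h] by (intro W.M.minus_equality) (simp_all add: W.minus_eq)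
    then have "h w = h v" using w linear_map_closed[OF h] by simp
    moreover have "h' (N +>\<^bsub>M\<^esub> v) = h w"
      unfolding h'_def w_def using v by (simp add: quotient_module_carrier)
    ultimately show ?thesis by simp
  qed
  have "h' \<in> linear_maps K (quotient_module M N) W"
  proof (rule linear_mapsI)
    have "h' X = undefined" if "X \<notin> carrier (quotient_module M N)" for X
      using that unfolding h'_def by simp
    then show "h' \<in> carrier (quotient_module M N) \<rightarrow>\<^sub>E carrier W"
      by (force simp: quotient_module_carrier h' linear_map_closed[OF h])
  qed (auto simp: quotient_module_carrier h' quotient_module_add quotient_module_smult
        linear_map_add[OF h] linear_map_smult[OF h])
  then show ?thesis using h' by blast
qed

end

section \<open>Tensor products\<close>

definition bilinear_map ::
  "('k, 'r) ring_scheme \<Rightarrow> ('k, 'v, 'x) module_scheme \<Rightarrow> ('k, 'w, 'y) module_scheme \<Rightarrow>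
   ('k, 'u, 'z) module_scheme \<Rightarrow> ('v \<Rightarrow> 'w \<Rightarrow> 'u) \<Rightarrow> bool" where
  "bilinear_map K V W Z \<phi> \<longleftrightarrow>
     (\<forall>v\<in>carrier V. \<forall>w\<in>carrier W. \<phi> v w \<in> carrier Z) \<and>
     (\<forall>v\<in>carrier V. \<forall>v'\<in>carrier V. \<forall>w\<in>carrier W. \<phi> (v \<oplus>\<^bsub>V\<^esub> v') w = \<phi> v w \<oplus>\<^bsub>Z\<^esub> \<phi> v' w) \<and>
     (\<forall>v\<in>carrier V. \<forall>w\<in>carrier W. \<forall>w'\<in>carrier W. \<phi> v (w \<oplus>\<^bsub>W\<^esub> w') = \<phi> v w \<oplus>\<^bsub>Z\<^esub> \<phi> v w') \<and>
     (\<forall>r\<in>carrier K. \<forall>v\<in>carrier V. \<forall>w\<in>carrier W. \<phi> (r \<odot>\<^bsub>V\<^esub> v) w = r \<odot>\<^bsub>Z\<^esub> \<phi> v w) \<and>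
     (\<forall>r\<in>carrier K. \<forall>v\<in>carrier V. \<forall>w\<in>carrier W. \<phi> v (r \<odot>\<^bsub>W\<^esub> w) = r \<odot>\<^bsub>Z\<^esub> \<phi> v w)"

lemma bilinear_mapI:
  assumes "\<And>v w. v \<in> carrier V \<Longrightarrow> w \<in> carrier W \<Longrightarrow> \<phi> v w \<in> carrier Z"
    and "\<And>v v' w. v \<in> carrier V \<Longrightarrow> v' \<in> carrier V \<Longrightarrow> w \<in> carrier W \<Longrightarrow> \<phi> (v \<oplus>\<^bsub>V\<^esub> v') w = \<phi> v w \<oplus>\<^bsub>Z\<^esub> \<phi> v' w"
    and "\<And>v w w'. v \<in> carrier V \<Longrightarrow> w \<in> carrier W \<Longrightarrow> w' \<in> carrier W \<Longrightarrow> \<phi> v (w \<oplus>\<^bsub>W\<^esub> w') = \<phi> v w \<oplus>\<^bsub>Z\<^esub> \<phi> v w'"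
    and "\<And>r v w. r \<in> carrier K \<Longrightarrow> v \<in> carrier V \<Longrightarrow> w \<in> carrier W \<Longrightarrow> \<phi> (r \<odot>\<^bsub>V\<^esub> v) w = r \<odot>\<^bsub>Z\<^esub> \<phi> v w"
    and "\<And>r v w. r \<in> carrier K \<Longrightarrow> v \<in> carrier V \<Longrightarrow> w \<in> carrier W \<Longrightarrow> \<phi> v (r \<odot>\<^bsub>W\<^esub> w) = r \<odot>\<^bsub>Z\<^esub> \<phi> v w"
  shows "bilinear_map K V W Z \<phi>"
  using assms unfolding bilinear_map_def by blast

context
  fixes K :: "('k, 'r) ring_scheme" and V :: "('k, 'v, 'x) module_scheme" and W :: "('k, 'w, 'y) module_scheme"
  assumes V: "module K V" and W: "module K W"
begin

interpretation V: module K V by (rule V)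
interpretation W: module K W by (rule W)

abbreviation (input) "free_pairs \<equiv> free_module K (carrier V \<times> carrier W)"

lemma free_pairs_module: "module K free_pairs"
  by (rule free_module_module[OF V.R.is_cring])

interpretation F: module K free_pairs by (rule free_pairs_module)

lemma basis_pair: "v \<in> carrier V \<Longrightarrow> w \<in> carrier W \<Longrightarrow> basis_vec K (v, w) \<in> carrier free_pairs"
  by (rule basis_vec_carrier[OF V.R.is_cring]) auto

lemma tensor_relations_subset: "tensor_relations K V W \<subseteq> carrier free_pairs"
  unfolding tensor_relations_def Let_def
  by (intro Un_least subsetI; elim CollectE exE conjE; hypsubst;
      intro F.minus_closed F.M.add.m_closed F.smult_closed basis_pair V.M.add.m_closed W.M.add.m_closed
        V.smult_closed W.smult_closed; assumption)

lemma tensor_kernel_submodule: "submodule (tensor_kernel K V W) K free_pairs"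
  unfolding tensor_kernel_def
  by (rule submodule_span_submodule[OF free_pairs_module tensor_relations_subset])

lemma tensor_module: "module K (tensor K V W)"
  unfolding tensor_def by (rule quotient_module_module[OF free_pairs_module tensor_kernel_submodule])

lemma tens_closed: "v \<in> carrier V \<Longrightarrow> w \<in> carrier W \<Longrightarrow> tens K V W v w \<in> carrier (tensor K V W)"
  unfolding tens_def tensor_def quotient_module_carrier[OF free_pairs_module tensor_kernel_submodule]
  by (intro imageI basis_pair)

lemma tens_bilinear: "bilinear_map K V W (tensor K V W) (tens K V W)"
proof -
  note q = quotient_module_add[OF free_pairs_module tensor_kernel_submodule]
    quotient_module_smult[OF free_pairs_module tensor_kernel_submodule]
    quotient_eq_iff[OF free_pairs_module tensor_kernel_submodule]
  have eqI: "tensor_kernel K V W +>\<^bsub>free_pairs\<^esub> x = tensor_kernel K V W +>\<^bsub>free_pairs\<^esub> y"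
    if "x \<in> carrier free_pairs" "y \<in> carrier free_pairs" "x \<ominus>\<^bsub>free_pairs\<^esub> y \<in> tensor_relations K V W" for x y
    unfolding q(3)[OF that(1,2)] by (rule subsetD[OF submodule_span_superset[of "tensor_relations K V W" K free_pairs] that(3), folded tensor_kernel_def])
  note R = tensor_relations_def[of K V W, unfolded Let_def]
  note cl = basis_pair V.M.add.m_closed W.M.add.m_closed V.smult_closed W.smult_closed
  show ?thesis
  proof (rule bilinear_mapI)
    show "tens K V W v w \<in> carrier (tensor K V W)" if "v \<in> carrier V" "w \<in> carrier W" for v w
      using tens_closed that .
  next
    fix v v' w assume *: "v \<in> carrier V" "v' \<in> carrier V" "w \<in> carrier W"
    have "basis_vec K (v \<oplus>\<^bsub>V\<^esub> v', w) \<ominus>\<^bsub>free_pairs\<^esub> (basis_vec K (v, w) \<oplus>\<^bsub>free_pairs\<^esub> basis_vec K (v', w)) \<in> tensor_relations K V W"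
      unfolding R by (rule UnI1, rule UnI1, rule UnI1, rule CollectI, intro exI conjI, rule refl, (rule *)+)
    from eqI[OF _ _ this]
    show "tens K V W (v \<oplus>\<^bsub>V\<^esub> v') w = tens K V W v w \<oplus>\<^bsub>tensor K V W\<^esub> tens K V W v' w"
      unfolding tens_def tensor_def q(1)[OF basis_pair[OF *(1,3)] basis_pair[OF *(2,3)]]
      using * by (auto simp del: free_module_simps intro!: cl F.M.add.m_closed)
  next
    fix v w w' assume *: "v \<in> carrier V" "w \<in> carrier W" "w' \<in> carrier W"
    have "basis_vec K (v, w \<oplus>\<^bsub>W\<^esub> w') \<ominus>\<^bsub>free_pairs\<^esub> (basis_vec K (v, w) \<oplus>\<^bsub>free_pairs\<^esub> basis_vec K (v, w')) \<in> tensor_relations K V W"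
      unfolding R by (rule UnI1, rule UnI1, rule UnI2, rule CollectI, intro exI conjI, rule refl, (rule *)+)
    from eqI[OF _ _ this]
    show "tens K V W v (w \<oplus>\<^bsub>W\<^esub> w') = tens K V W v w \<oplus>\<^bsub>tensor K V W\<^esub> tens K V W v w'"
      unfolding tens_def tensor_def q(1)[OF basis_pair[OF *(1,2)] basis_pair[OF *(1,3)]]
      using * by (auto simp del: free_module_simps intro!: cl F.M.add.m_closed)
  next
    fix r v w assume *: "r \<in> carrier K" "v \<in> carrier V" "w \<in> carrier W"
    have "basis_vec K (r \<odot>\<^bsub>V\<^esub> v, w) \<ominus>\<^bsub>free_pairs\<^esub> (r \<odot>\<^bsub>free_pairs\<^esub> basis_vec K (v, w)) \<in> tensor_relations K V W"
      unfolding R by (rule UnI1, rule UnI2, rule CollectI, intro exI conjI, rule refl, (rule *)+)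
    from eqI[OF _ _ this]
    show "tens K V W (r \<odot>\<^bsub>V\<^esub> v) w = r \<odot>\<^bsub>tensor K V W\<^esub> tens K V W v w"
      unfolding tens_def tensor_def q(2)[OF *(1) basis_pair[OF *(2,3)]]
      using * by (auto simp del: free_module_simps intro!: cl F.smult_closed)
    have "basis_vec K (v, r \<odot>\<^bsub>W\<^esub> w) \<ominus>\<^bsub>free_pairs\<^esub> (r \<odot>\<^bsub>free_pairs\<^esub> basis_vec K (v, w)) \<in> tensor_relations K V W"
      unfolding R by (rule UnI2, rule CollectI, intro exI conjI, rule refl, (rule *)+)
    from eqI[OF _ _ this]
    show "tens K V W v (r \<odot>\<^bsub>W\<^esub> w) = r \<odot>\<^bsub>tensor K V W\<^esub> tens K V W v w"
      unfolding tens_def tensor_def q(2)[OF *(1) basis_pair[OF *(2,3)]]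
      using * by (auto simp del: free_module_simps intro!: cl F.smult_closed)
  qed
qed

lemma tens_add_left: "v \<in> carrier V \<Longrightarrow> v' \<in> carrier V \<Longrightarrow> w \<in> carrier W \<Longrightarrow>
    tens K V W (v \<oplus>\<^bsub>V\<^esub> v') w = tens K V W v w \<oplus>\<^bsub>tensor K V W\<^esub> tens K V W v' w"
  and tens_add_right: "v \<in> carrier V \<Longrightarrow> w \<in> carrier W \<Longrightarrow> w' \<in> carrier W \<Longrightarrow>
    tens K V W v (w \<oplus>\<^bsub>W\<^esub> w') = tens K V W v w \<oplus>\<^bsub>tensor K V W\<^esub> tens K V W v w'"
  and tens_smult_left: "r \<in> carrier K \<Longrightarrow> v \<in> carrier V \<Longrightarrow> w \<in> carrier W \<Longrightarrow>
    tens K V W (r \<odot>\<^bsub>V\<^esub> v) w = r \<odot>\<^bsub>tensor K V W\<^esub> tens K V W v w"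
  and tens_smult_right: "r \<in> carrier K \<Longrightarrow> v \<in> carrier V \<Longrightarrow> w \<in> carrier W \<Longrightarrow>
    tens K V W v (r \<odot>\<^bsub>W\<^esub> w) = r \<odot>\<^bsub>tensor K V W\<^esub> tens K V W v w"
  using tens_bilinear unfolding bilinear_map_def by blast+

text \<open>Sums of elementary tensors exhaust the tensor product; scalars are absorbed into the left factor.\<close>

lemma tens_induct [consumes 1, case_names zero tens add]:
  assumes t: "t \<in> carrier (tensor K V W)"
    and zero: "P \<zero>\<^bsub>tensor K V W\<^esub>"
    and tens: "\<And>v w. v \<in> carrier V \<Longrightarrow> w \<in> carrier W \<Longrightarrow> P (tens K V W v w)"
    and add: "\<And>s t. s \<in> carrier (tensor K V W) \<Longrightarrow> t \<in> carrier (tensor K V W) \<Longrightarrow> P s \<Longrightarrow> P t \<Longrightarrow>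
      P (s \<oplus>\<^bsub>tensor K V W\<^esub> t)"
  shows "P t"
proof -
  let ?N = "tensor_kernel K V W"
  note q = quotient_module_add[OF free_pairs_module tensor_kernel_submodule]
    quotient_module_smult[OF free_pairs_module tensor_kernel_submodule]
    quotient_module_carrier[OF free_pairs_module tensor_kernel_submodule]
    quotient_module_zero[OF free_pairs_module tensor_kernel_submodule]
  interpret T: module K "tensor K V W" by (rule tensor_module)
  obtain x where x: "x \<in> carrier free_pairs" "t = ?N +>\<^bsub>free_pairs\<^esub> x"
    using t unfolding tensor_def q(3) by blast
  have "P (?N +>\<^bsub>free_pairs\<^esub> x)" using V.R.is_cring x(1)
  proof (induction rule: free_module_induct)
    case zero
    show ?case using assms(2) unfolding tensor_def q(4) by simp
  next
    case (step r p x)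
    obtain v w where p: "p = (v, w)" "v \<in> carrier V" "w \<in> carrier W" using step by auto
    have b: "basis_vec K p \<in> carrier free_pairs" unfolding p(1) using p by (intro basis_pair)
    have x: "?N +>\<^bsub>free_pairs\<^esub> x \<in> carrier (tensor K V W)" unfolding tensor_def q(3) using step by blast
    have "P (tens K V W (r \<odot>\<^bsub>V\<^esub> v) w \<oplus>\<^bsub>tensor K V W\<^esub> (?N +>\<^bsub>free_pairs\<^esub> x))"
      using step p x by (intro add tens tens_closed V.smult_closed)
    also have "tens K V W (r \<odot>\<^bsub>V\<^esub> v) w \<oplus>\<^bsub>tensor K V W\<^esub> (?N +>\<^bsub>free_pairs\<^esub> x)
        = ?N +>\<^bsub>free_pairs\<^esub> (r \<odot>\<^bsub>free_pairs\<^esub> basis_vec K p \<oplus>\<^bsub>free_pairs\<^esub> x)"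
      unfolding tens_smult_left[OF step(1) p(2,3)]
      unfolding tensor_def tens_def p(1)[symmetric] q(2)[OF step(1) b]
        q(1)[OF F.smult_closed[OF step(1) b] step(3)] ..
    finally show ?case .
  qed
  then show ?thesis using x by simp
qed

lemma tensor_linear_eq:
  assumes Z: "module K Z"
    and f: "f \<in> linear_maps K (tensor K V W) Z" and g: "g \<in> linear_maps K (tensor K V W) Z"
    and eq: "\<And>v w. v \<in> carrier V \<Longrightarrow> w \<in> carrier W \<Longrightarrow> f (tens K V W v w) = g (tens K V W v w)"
  shows "f = g"
proof (rule linear_map_eqI[OF f g])
  fix t assume "t \<in> carrier (tensor K V W)"
  then show "f t = g t"
    by (induction rule: tens_induct)
       (simp_all add: eq linear_map_add[OF f] linear_map_add[OF g]
         linear_map_zero[OF tensor_module Z f] linear_map_zero[OF tensor_module Z g])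
qed

text \<open>A bilinear map extends linearly to the free module on pairs, and bilinearity says exactly that the
  extension kills the defining relations.\<close>

lemma tensor_lift_exists:
  assumes Z: "module K Z" and \<phi>: "bilinear_map K V W Z \<phi>"
  shows "\<exists>h \<in> linear_maps K (tensor K V W) Z. \<forall>v\<in>carrier V. \<forall>w\<in>carrier W. h (tens K V W v w) = \<phi> v w"
proof -
  interpret Z: module K Z by (rule Z)
  let ?X = "carrier V \<times> carrier W"
  have \<phi>c: "(\<lambda>(v, w). \<phi> v w) \<in> ?X \<rightarrow> carrier Z" using \<phi> unfolding bilinear_map_def by auto
  let ?h = "lin_ext K ?X Z (\<lambda>(v, w). \<phi> v w)"
  have h: "?h \<in> linear_maps K free_pairs Z" by (rule lin_ext_linear[OF Z \<phi>c])
  have hb: "?h (basis_vec K (v, w)) = \<phi> v w" if "v \<in> carrier V" "w \<in> carrier W" for v w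
    using lin_ext_basis[OF Z \<phi>c, of "(v, w)"] that by simp
  note hl = linear_map_minus[OF free_pairs_module Z h] linear_map_add[OF h] linear_map_smult[OF h] hb
  have "?h s = \<zero>\<^bsub>Z\<^esub>" if "s \<in> tensor_relations K V W" for s
    using that \<phi> unfolding tensor_relations_def Let_def
    by (auto simp del: free_module_simps simp: hl basis_pair bilinear_map_def Z.minus_eq Z.r_neg)
  then have "?h s = \<zero>\<^bsub>Z\<^esub>" if "s \<in> tensor_kernel K V W" for s
    using linear_map_vanishes_on_span[OF free_pairs_module Z h tensor_relations_subset] that
    unfolding tensor_kernel_def by blast
  from quotient_module_lift[OF free_pairs_module tensor_kernel_submodule Z h this]
  obtain h' where "h' \<in> linear_maps K (tensor K V W) Z"
    "\<forall>x\<in>carrier free_pairs. h' (tensor_kernel K V W +>\<^bsub>free_pairs\<^esub> x) = ?h x" unfolding tensor_def by blast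
  then show ?thesis unfolding tens_def using hb basis_pair by (intro bexI[of _ h']) auto
qed

lemma
  assumes Z: "module K Z" and \<phi>: "bilinear_map K V W Z \<phi>"
  shows tensor_lift_linear: "tensor_lift K V W Z \<phi> \<in> linear_maps K (tensor K V W) Z"
    and tensor_lift_tens: "\<And>v w. v \<in> carrier V \<Longrightarrow> w \<in> carrier W \<Longrightarrow> tensor_lift K V W Z \<phi> (tens K V W v w) = \<phi> v w"
proof -
  have "\<exists>!h. h \<in> linear_maps K (tensor K V W) Z \<and>
     (\<forall>v \<in> carrier V. \<forall>w \<in> carrier W. h (tens K V W v w) = \<phi> v w)"
    using tensor_lift_exists[OF Z \<phi>] tensor_linear_eq[OF Z] by (metis (no_types, lifting))
  from theI'[OF this]
  show "tensor_lift K V W Z \<phi> \<in> linear_maps K (tensor K V W) Z"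
    "\<And>v w. v \<in> carrier V \<Longrightarrow> w \<in> carrier W \<Longrightarrow> tensor_lift K V W Z \<phi> (tens K V W v w) = \<phi> v w"
    unfolding tensor_lift_def by auto
qed

lemma bilinear_compose:
  assumes "module K V'" "module K W'" "bilinear_map K V' W' Z \<phi>"
    and f: "f \<in> carrier V \<rightarrow> carrier V'" "\<And>x y. x \<in> carrier V \<Longrightarrow> y \<in> carrier V \<Longrightarrow> f (x \<oplus>\<^bsub>V\<^esub> y) = f x \<oplus>\<^bsub>V'\<^esub> f y"
      "\<And>r x. r \<in> carrier K \<Longrightarrow> x \<in> carrier V \<Longrightarrow> f (r \<odot>\<^bsub>V\<^esub> x) = r \<odot>\<^bsub>V'\<^esub> f x"
    and g: "g \<in> carrier W \<rightarrow> carrier W'" "\<And>x y. x \<in> carrier W \<Longrightarrow> y \<in> carrier W \<Longrightarrow> g (x \<oplus>\<^bsub>W\<^esub> y) = g x \<oplus>\<^bsub>W'\<^esub> g y"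
      "\<And>r x. r \<in> carrier K \<Longrightarrow> x \<in> carrier W \<Longrightarrow> g (r \<odot>\<^bsub>W\<^esub> x) = r \<odot>\<^bsub>W'\<^esub> g x"
  shows "bilinear_map K V W Z (\<lambda>v w. \<phi> (f v) (g w))"
proof -
  have fc: "x \<in> carrier V \<Longrightarrow> f x \<in> carrier V'" and gc: "y \<in> carrier W \<Longrightarrow> g y \<in> carrier W'" for x y
    using f(1) g(1) by auto
  show ?thesis
    using assms(3) fc gc by (intro bilinear_mapI) (auto simp: f g bilinear_map_def)
qed

end

text \<open>Linearity without the extensionality built into \<open>linear_maps\<close>: the identity and the composites that
  occur in the coalgebra axioms are plain abstractions, which differ from extensional maps outside
  the carrier.\<close>

definition is_linear where
  "is_linear K V W f \<longleftrightarrow> f \<in> carrier V \<rightarrow> carrier W \<and>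
     (\<forall>v \<in> carrier V. \<forall>v' \<in> carrier V. f (v \<oplus>\<^bsub>V\<^esub> v') = f v \<oplus>\<^bsub>W\<^esub> f v') \<and>
     (\<forall>r \<in> carrier K. \<forall>v \<in> carrier V. f (r \<odot>\<^bsub>V\<^esub> v) = r \<odot>\<^bsub>W\<^esub> f v)"

lemma linear_map_is_linear: "f \<in> linear_maps K V W \<Longrightarrow> is_linear K V W f"
  unfolding is_linear_def linear_maps_def by auto

lemma is_linear_id: "is_linear K V V (\<lambda>x. x)"
  unfolding is_linear_def by auto

lemma is_linear_compose: "is_linear K V W f \<Longrightarrow> is_linear K W Z g \<Longrightarrow> is_linear K V Z (\<lambda>x. g (f x))"
  unfolding is_linear_def by (auto simp: Pi_def)

lemma is_linear_closed: "is_linear K V W f \<Longrightarrow> v \<in> carrier V \<Longrightarrow> f v \<in> carrier W"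
  unfolding is_linear_def by auto

context
  fixes K :: "('k, 'r) ring_scheme" and V :: "('k, 'v, 'x) module_scheme" and W :: "('k, 'w, 'y) module_scheme"
  and V' :: "('k, 'v', 'x') module_scheme" and W' :: "('k, 'w', 'y') module_scheme" and f g
  assumes V: "module K V" and W: "module K W" and V': "module K V'" and W': "module K W'"
    and f: "is_linear K V V' f" and g: "is_linear K W W' g"
begin

lemma tensor_map_bilinear: "bilinear_map K V W (tensor K V' W') (\<lambda>v w. tens K V' W' (f v) (g w))"
  using f g unfolding is_linear_def
  by (intro bilinear_compose[OF V W V' W' tens_bilinear[OF V' W']]) auto

lemma tensor_map_linear: "tensor_map K V W V' W' f g \<in> linear_maps K (tensor K V W) (tensor K V' W')"
  unfolding tensor_map_def by (rule tensor_lift_linear[OF V W tensor_module[OF V' W'] tensor_map_bilinear])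

lemma tensor_map_tens: "v \<in> carrier V \<Longrightarrow> w \<in> carrier W \<Longrightarrow>
    tensor_map K V W V' W' f g (tens K V W v w) = tens K V' W' (f v) (g w)"
  unfolding tensor_map_def by (rule tensor_lift_tens[OF V W tensor_module[OF V' W'] tensor_map_bilinear])

end

lemma tensor_map_cong:
  assumes V: "module K V" and W: "module K W" and V': "module K V'" and W': "module K W'"
    and f: "is_linear K V V' f" and g: "is_linear K W W' g"
    and eq: "\<And>v. v \<in> carrier V \<Longrightarrow> f v = f' v" "\<And>w. w \<in> carrier W \<Longrightarrow> g w = g' w"
  shows "tensor_map K V W V' W' f g = tensor_map K V W V' W' f' g'"
proof -
  interpret V: module K V by fact
  interpret W: module K W by fact
  have f': "is_linear K V V' f'" and g': "is_linear K W W' g'"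
    using f g eq unfolding is_linear_def by (auto simp: Pi_def) 
  show ?thesis
    by (rule tensor_linear_eq[OF V W tensor_module[OF V' W'] tensor_map_linear[OF V W V' W' f g] tensor_map_linear[OF V W V' W' f' g']])
       (simp add: tensor_map_tens[OF V W V' W' f g] tensor_map_tens[OF V W V' W' f' g'] eq)
qed

lemma tensor_map_comp:
  assumes V: "module K V" and W: "module K W" and V': "module K V'" and W': "module K W'"
    and V'': "module K V''" and W'': "module K W''"
    and f: "is_linear K V V' f" and g: "is_linear K W W' g"
    and f': "is_linear K V' V'' f'" and g': "is_linear K W' W'' g'" and t: "t \<in> carrier (tensor K V W)"
  shows "tensor_map K V' W' V'' W'' f' g' (tensor_map K V W V' W' f g t)
       = tensor_map K V W V'' W'' (\<lambda>x. f' (f x)) (\<lambda>x. g' (g x)) t"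
proof -
  note ff = is_linear_compose[OF f f'] and gg = is_linear_compose[OF g g']
  note T = tensor_map_tens[OF V W V' W' f g] tensor_map_tens[OF V' W' V'' W'' f' g']
    tensor_map_tens[OF V W V'' W'' ff gg]
  note L = tensor_map_linear[OF V W V' W' f g] tensor_map_linear[OF V' W' V'' W'' f' g']
    tensor_map_linear[OF V W V'' W'' ff gg]
  show ?thesis using t
    by (induction rule: tens_induct[OF V W, consumes 1])
       (simp_all add: T is_linear_closed[OF f] is_linear_closed[OF g]
         linear_map_zero[OF tensor_module[OF V W] tensor_module[OF V' W'] L(1)]
         linear_map_zero[OF tensor_module[OF V' W'] tensor_module[OF V'' W''] L(2)]
         linear_map_zero[OF tensor_module[OF V W] tensor_module[OF V'' W''] L(3)]
         linear_map_add[OF L(1)] linear_map_add[OF L(2)] linear_map_add[OF L(3)] linear_map_closed[OF L(1)])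
qed

lemma tensor_map_id:
  assumes V: "module K V" and W: "module K W" and t: "t \<in> carrier (tensor K V W)"
  shows "tensor_map K V W V W (\<lambda>x. x) (\<lambda>x. x) t = t"
  using t
  by (induction rule: tens_induct[OF V W, consumes 1])
     (simp_all add: tensor_map_tens[OF V W V W is_linear_id is_linear_id]
         linear_map_zero[OF tensor_module[OF V W] tensor_module[OF V W] tensor_map_linear[OF V W V W is_linear_id is_linear_id]]
         linear_map_add[OF tensor_map_linear[OF V W V W is_linear_id is_linear_id]])

lemma tensor_assoc_inner_bilinear:
  assumes V: "module K V" and W: "module K W" and Z: "module K Z" and z: "z \<in> carrier Z"
  shows "bilinear_map K V W (tensor K V (tensor K W Z)) (\<lambda>v w. tens K V (tensor K W Z) v (tens K W Z w z))"
proof -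
  interpret V: module K V by fact
  interpret W: module K W by fact
  note WZ = tensor_module[OF W Z]
  show ?thesis
    by (rule bilinear_mapI) (auto simp: z tens_closed[OF V WZ] tens_closed[OF W Z] tens_add_left[OF V WZ] tens_add_right[OF V WZ]
      tens_smult_left[OF V WZ] tens_smult_right[OF V WZ] tens_add_left[OF W Z] tens_smult_left[OF W Z])
qed

context
  fixes K :: "('k, 'r) ring_scheme" and V :: "('k, 'v, 'x) module_scheme" and W :: "('k, 'w, 'y) module_scheme"
    and Z :: "('k, 'z, 't) module_scheme"
  assumes V: "module K V" and W: "module K W" and Z: "module K Z"
begin

text \<open>Linearity in the tensor argument is built into \<open>tensor_lift\<close>; linearity in \<open>z\<close> has to be checked
  on elementary tensors.\<close>

lemma tensor_assoc_outer_bilinear: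
  "bilinear_map K (tensor K V W) Z (tensor K V (tensor K W Z))
       (\<lambda>t z. tensor_lift K V W (tensor K V (tensor K W Z))
          (\<lambda>v w. tens K V (tensor K W Z) v (tens K W Z w z)) t)"
proof -
  interpret V: module K V by (rule V)
  interpret W: module K W by (rule W)
  interpret Z: module K Z by (rule Z)
  note WZ = tensor_module[OF W Z]
  note VW = tensor_module[OF V W]
  note VWZ = tensor_module[OF V WZ]
  interpret VWZ: module K "tensor K V (tensor K W Z)" by (rule VWZ)
  note L = tensor_lift_linear[OF V W VWZ tensor_assoc_inner_bilinear[OF V W Z]]
  note T = tensor_lift_tens[OF V W VWZ tensor_assoc_inner_bilinear[OF V W Z]]
  show ?thesis
  proof (rule bilinear_mapI)
    fix t z z' assume t: "t \<in> carrier (tensor K V W)" and z: "z \<in> carrier Z" "z' \<in> carrier Z"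
    then have zz: "z \<oplus>\<^bsub>Z\<^esub> z' \<in> carrier Z" by simp
    note l = L[OF z(1)] L[OF z(2)] L[OF zz]
    show "tensor_lift K V W (tensor K V (tensor K W Z)) (\<lambda>v w. tens K V (tensor K W Z) v (tens K W Z w (z \<oplus>\<^bsub>Z\<^esub> z'))) t =
        tensor_lift K V W (tensor K V (tensor K W Z)) (\<lambda>v w. tens K V (tensor K W Z) v (tens K W Z w z)) t 
       \<oplus>\<^bsub>tensor K V (tensor K W Z)\<^esub>
        tensor_lift K V W (tensor K V (tensor K W Z)) (\<lambda>v w. tens K V (tensor K W Z) v (tens K W Z w z')) t"
      using t
    proof (induction rule: tens_induct[OF V W, consumes 1, case_names zero tens add])
      case zero
      show ?case using l[THEN linear_map_zero[OF VW VWZ]] by simp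
    next
      case (tens v w)
      then show ?case using z zz by (simp add: T tens_add_right[OF W Z] tens_add_right[OF V WZ] tens_closed[OF W Z])
    next
      case (add s t)
      then show ?case
        by (simp add: l[THEN linear_map_add] VWZ.M.a_ac l[THEN linear_map_closed])
    qed
  next
    fix r t z assume r: "r \<in> carrier K" and t: "t \<in> carrier (tensor K V W)" and z: "z \<in> carrier Z"
    then have zz: "r \<odot>\<^bsub>Z\<^esub> z \<in> carrier Z" by simp
    note l = L[OF z(1)] L[OF zz]
    show "tensor_lift K V W (tensor K V (tensor K W Z)) (\<lambda>v w. tens K V (tensor K W Z) v (tens K W Z w (r \<odot>\<^bsub>Z\<^esub> z))) t =
        r \<odot>\<^bsub>tensor K V (tensor K W Z)\<^esub>
        tensor_lift K V W (tensor K V (tensor K W Z)) (\<lambda>v w. tens K V (tensor K W Z) v (tens K W Z w z)) t"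
      using t
    proof (induction rule: tens_induct[OF V W, consumes 1, case_names zero tens add])
      case zero
      show ?case using l[THEN linear_map_zero[OF VW VWZ]] r by simp
    next
      case (tens v w)
      then show ?case using z zz r by (simp add: T tens_smult_right[OF W Z] tens_smult_right[OF V WZ] tens_closed[OF W Z])
    next
      case (add s t)
      then show ?case using r
        by (simp add: l[THEN linear_map_add] VWZ.smult_r_distr l[THEN linear_map_closed])
    qed
  qed (auto simp: L[THEN linear_map_closed] L[THEN linear_map_add] L[THEN linear_map_smult])
qed

lemma tensor_assoc_linear: "tensor_assoc K V W Z \<in> linear_maps K (tensor K (tensor K V W) Z) (tensor K V (tensor K W Z))"
  unfolding tensor_assoc_def
  by (intro tensor_lift_linear tensor_module V W Z tensor_assoc_outer_bilinear)

lemma tensor_assoc_tens: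
  assumes "v \<in> carrier V" "w \<in> carrier W" "z \<in> carrier Z"
  shows "tensor_assoc K V W Z (tens K (tensor K V W) Z (tens K V W v w) z) =
    tens K V (tensor K W Z) v (tens K W Z w z)"
  unfolding tensor_assoc_def using assms
  by (simp add: tensor_lift_tens[OF tensor_module[OF V W] Z tensor_module[OF V tensor_module[OF W Z]] tensor_assoc_outer_bilinear]
     tens_closed[OF V W] tensor_lift_tens[OF V W tensor_module[OF V tensor_module[OF W Z]] tensor_assoc_inner_bilinear[OF V W Z]])

end

context
  fixes K :: "('k, 'r) ring_scheme" and V :: "('k, 'v, 'x) module_scheme" and W :: "('k, 'w, 'y) module_scheme"
  assumes V: "module K V" and W: "module K W"
begin

lemma tensor_swap_bilinear: "bilinear_map K V W (tensor K W V) (\<lambda>v w. tens K W V w v)"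
  using tens_bilinear[OF W V] unfolding bilinear_map_def by blast

lemma tensor_swap_linear: "tensor_swap K V W \<in> linear_maps K (tensor K V W) (tensor K W V)"
  unfolding tensor_swap_def
  by (intro tensor_lift_linear tensor_module V W tensor_swap_bilinear)

lemma tensor_swap_tens:
  assumes "v \<in> carrier V" "w \<in> carrier W"
  shows "tensor_swap K V W (tens K V W v w) = tens K W V w v"
  unfolding tensor_swap_def 
  by (rule tensor_lift_tens[OF V W tensor_module[OF W V] tensor_swap_bilinear assms])

end

context
  fixes K :: "('k, 'r) ring_scheme" and V :: "('k, 'v, 'x) module_scheme"
  assumes V: "module K V"
begin

lemma tensor_lunit_bilinear: "bilinear_map K (ground_module K) V V (\<lambda>r v. r \<odot>\<^bsub>V\<^esub> v)"
proof -
  interpret V: module K V by (rule V)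
  show ?thesis by (rule bilinear_mapI) (auto simp: V.smult_l_distr V.smult_r_distr V.smult_assoc1 V.R.m_comm
    simp flip: V.smult_assoc1)
qed

lemma tensor_runit_bilinear: "bilinear_map K V (ground_module K) V (\<lambda>v r. r \<odot>\<^bsub>V\<^esub> v)"
  using tensor_lunit_bilinear unfolding bilinear_map_def by blast

lemma module_ground: "module K (ground_module K)"
proof -
  interpret V: module K V by (rule V)
  show ?thesis by (rule ground_module_module[OF V.R.is_cring])
qed

lemma tensor_lunit_linear: "tensor_lunit K V \<in> linear_maps K (tensor K (ground_module K) V) V"
  and tensor_lunit_tens: "r \<in> carrier K \<Longrightarrow> v \<in> carrier V \<Longrightarrow> tensor_lunit K V (tens K (ground_module K) V r v) = r \<odot>\<^bsub>V\<^esub> v"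
  unfolding tensor_lunit_def
  using tensor_lift_linear[OF module_ground V V tensor_lunit_bilinear]
    tensor_lift_tens[OF module_ground V V tensor_lunit_bilinear] by simp_all

lemma tensor_runit_linear: "tensor_runit K V \<in> linear_maps K (tensor K V (ground_module K)) V"
  and tensor_runit_tens: "r \<in> carrier K \<Longrightarrow> v \<in> carrier V \<Longrightarrow> tensor_runit K V (tens K V (ground_module K) v r) = r \<odot>\<^bsub>V\<^esub> v"
  unfolding tensor_runit_def
  using tensor_lift_linear[OF V module_ground V tensor_runit_bilinear]
    tensor_lift_tens[OF V module_ground V tensor_runit_bilinear] by simp_all

end

section \<open>Sums with finitely many nonzero terms\<close>

text \<open>The families of scalars below have infinite index sets and finitely many nonzero terms, whereas
  \<open>finsum\<close> is meaningful for finite index sets only. As a relation, with the finite set left open,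
  such sums can be added and multiplied without computing supports.\<close>

definition has_fsum :: "('k, 'r) ring_scheme \<Rightarrow> 'x set \<Rightarrow> ('x \<Rightarrow> 'k) \<Rightarrow> 'k \<Rightarrow> bool" where
  "has_fsum K X f a \<longleftrightarrow> f \<in> X \<rightarrow> carrier K \<and>
     (\<exists>A. finite A \<and> A \<subseteq> X \<and> (\<forall>x\<in>X - A. f x = \<zero>\<^bsub>K\<^esub>) \<and> finsum K f A = a)"

context cring
begin

lemma has_fsumI: "f \<in> X \<rightarrow> carrier R \<Longrightarrow> finite A \<Longrightarrow> A \<subseteq> X \<Longrightarrow> (\<And>x. x \<in> X - A \<Longrightarrow> f x = \<zero>) \<Longrightarrow>
    finsum R f A = a \<Longrightarrow> has_fsum R X f a"
  unfolding has_fsum_def by blast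

lemma has_fsumE:
  assumes "has_fsum R X f a"
  obtains A where "f \<in> X \<rightarrow> carrier R" "finite A" "A \<subseteq> X" "\<And>B. finite B \<Longrightarrow> A \<subseteq> B \<Longrightarrow> B \<subseteq> X \<Longrightarrow> finsum R f B = a"
    "\<And>x. x \<in> X \<Longrightarrow> x \<notin> A \<Longrightarrow> f x = \<zero>"
proof -
  obtain A where f: "f \<in> X \<rightarrow> carrier R" and A: "finite A" "A \<subseteq> X" "\<And>x. x \<in> X - A \<Longrightarrow> f x = \<zero>" "finsum R f A = a"
    using assms unfolding has_fsum_def by blast
  have "finsum R f A = finsum R f B" if "finite B" "A \<subseteq> B" "B \<subseteq> X" for B
    by (rule add.finprod_mono_neutral_cong_left) (use that A f in \<open>auto simp: Pi_def subset_iff\<close>)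
  then show ?thesis using that[OF f A(1,2)] A(3,4) by auto
qed

lemma has_fsum_unique:
  assumes "has_fsum R X f a" "has_fsum R X f b" shows "a = b"
proof -
  obtain A where A: "finite A" "A \<subseteq> X" "\<And>B. finite B \<Longrightarrow> A \<subseteq> B \<Longrightarrow> B \<subseteq> X \<Longrightarrow> finsum R f B = a"
    using has_fsumE[OF assms(1)] by metis
  obtain B where B: "finite B" "B \<subseteq> X" "\<And>A. finite A \<Longrightarrow> B \<subseteq> A \<Longrightarrow> A \<subseteq> X \<Longrightarrow> finsum R f A = b"
    using has_fsumE[OF assms(2)] by metis
  show ?thesis using A(3)[of "A \<union> B"] B(3)[of "A \<union> B"] A(1,2) B(1,2) by simp
qed

lemma has_fsum_cong: "has_fsum R X f a \<Longrightarrow> (\<And>x. x \<in> X \<Longrightarrow> f x = g x) \<Longrightarrow> has_fsum R X g a"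
proof -
  assume f: "has_fsum R X f a" and eq: "\<And>x. x \<in> X \<Longrightarrow> f x = g x"
  obtain A where A: "f \<in> X \<rightarrow> carrier R" "finite A" "A \<subseteq> X" "finsum R f A = a" "\<And>x. x \<in> X \<Longrightarrow> x \<notin> A \<Longrightarrow> f x = \<zero>"
    using f by (metis has_fsumE subset_refl)
  show ?thesis
  proof (rule has_fsumI[OF _ A(2,3)])
    show gX: "g \<in> X \<rightarrow> carrier R" using A(1) eq by (metis Pi_cong)
    show "finsum R g A = a" unfolding A(4)[symmetric]
      by (rule finsum_cong'[OF refl]) (use A eq in \<open>auto simp: subset_iff\<close>)
  qed (use A eq in auto)
qed

lemma has_fsum_zero: "has_fsum R X (\<lambda>x. \<zero>) \<zero>"
  by (rule has_fsumI[of _ _ "{}"]) auto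

lemma has_fsum_single:
  assumes "x \<in> X" "f x \<in> carrier R" "\<And>y. y \<in> X \<Longrightarrow> y \<noteq> x \<Longrightarrow> f y = \<zero>"
  shows "has_fsum R X f (f x)"
  by (rule has_fsumI[of _ _ "{x}"]) (use assms in \<open>auto simp: Pi_def\<close>, metis zero_closed)

lemma has_fsum_add:
  assumes "has_fsum R X f a" "has_fsum R X g b"
  shows "has_fsum R X (\<lambda>x. f x \<oplus> g x) (a \<oplus> b)"
proof -
  obtain A where A: "f \<in> X \<rightarrow> carrier R" "finite A" "A \<subseteq> X" "\<And>B. finite B \<Longrightarrow> A \<subseteq> B \<Longrightarrow> B \<subseteq> X \<Longrightarrow> finsum R f B = a"
    "\<And>x. x \<in> X \<Longrightarrow> x \<notin> A \<Longrightarrow> f x = \<zero>"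
    by (rule has_fsumE[OF assms(1)]) blast
  obtain B where B: "g \<in> X \<rightarrow> carrier R" "finite B" "B \<subseteq> X" "\<And>A. finite A \<Longrightarrow> B \<subseteq> A \<Longrightarrow> A \<subseteq> X \<Longrightarrow> finsum R g A = b"
    "\<And>x. x \<in> X \<Longrightarrow> x \<notin> B \<Longrightarrow> g x = \<zero>"
    by (rule has_fsumE[OF assms(2)]) blast
  have "finsum R (\<lambda>x. f x \<oplus> g x) (A \<union> B) = finsum R f (A \<union> B) \<oplus> finsum R g (A \<union> B)"
    by (rule finsum_addf) (use A B in blast)+
  then show ?thesis
    using A B by (intro has_fsumI[of _ _ "A \<union> B"]) auto
qed

lemma has_fsum_reindex:
  assumes \<beta>: "bij_betw \<beta> Y X" and f: "has_fsum R X f a"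
  shows "has_fsum R Y (\<lambda>y. f (\<beta> y)) a"
proof -
  obtain A where A: "f \<in> X \<rightarrow> carrier R" "finite A" "A \<subseteq> X" "finsum R f A = a" "\<And>x. x \<in> X \<Longrightarrow> x \<notin> A \<Longrightarrow> f x = \<zero>"
    using f by (metis has_fsumE subset_refl)
  let ?B = "{y \<in> Y. \<beta> y \<in> A}"
  have im: "\<beta> ` ?B = A" using A(3) \<beta> unfolding bij_betw_def by auto
  have inj: "inj_on \<beta> ?B" using \<beta> unfolding bij_betw_def by (auto intro: inj_on_subset)
  have "finsum R f (\<beta> ` ?B) = finsum R (\<lambda>y. f (\<beta> y)) ?B"
    by (rule finsum_reindex[OF _ inj]) (use A im in auto)
  then show ?thesis
    using A im inj \<beta> finite_imageD[of \<beta> ?B] by (intro has_fsumI[of _ _ ?B]) (auto simp: bij_betw_def dest: finite_imageD[rotated])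
qed

lemma finsum_product:
  assumes "finite A" "finite B" "f \<in> A \<rightarrow> carrier R" "g \<in> B \<rightarrow> carrier R"
  shows "finsum R (\<lambda>(x, y). f x \<otimes> g y) (A \<times> B) = finsum R f A \<otimes> finsum R g B"
  using assms(1,3)
proof (induction rule: finite_induct)
  case empty
  then show ?case using assms by (simp add: finsum_closed)
next
  case (insert x A)
  let ?h = "\<lambda>(x, y). f x \<otimes> g y"
  have fc: "f a \<in> carrier R" if "a \<in> insert x A" for a using insert that by auto
  have gc: "g b \<in> carrier R" if "b \<in> B" for b using assms that by auto
  have "insert x A \<times> B = Pair x ` B \<union> A \<times> B" by auto
  then have "finsum R ?h (insert x A \<times> B) = finsum R ?h (Pair x ` B) \<oplus> finsum R ?h (A \<times> B)"
    using insert(1,2) assms(2) fc gc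
    by (simp only:, intro finsum_Un_disjoint) (auto simp: Pi_def)
  also have "finsum R ?h (Pair x ` B) = finsum R (\<lambda>y. f x \<otimes> g y) B"
    using fc gc by (subst finsum_reindex) (auto simp: inj_on_def)
  also have "\<dots> = f x \<otimes> finsum R g B"
    using fc assms by (intro finsum_rdistr[symmetric]) auto
  finally show ?case
    using insert fc gc by (simp add: l_distr finsum_closed Pi_def)
qed

lemma has_fsum_product:
  assumes "has_fsum R X f a" "has_fsum R Y g b"
  shows "has_fsum R (X \<times> Y) (\<lambda>(x, y). f x \<otimes> g y) (a \<otimes> b)"
proof -
  obtain A where A: "f \<in> X \<rightarrow> carrier R" "finite A" "A \<subseteq> X" "finsum R f A = a" "\<And>x. x \<in> X \<Longrightarrow> x \<notin> A \<Longrightarrow> f x = \<zero>"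
    using assms(1) by (metis has_fsumE subset_refl)
  obtain B where B: "g \<in> Y \<rightarrow> carrier R" "finite B" "B \<subseteq> Y" "finsum R g B = b" "\<And>x. x \<in> Y \<Longrightarrow> x \<notin> B \<Longrightarrow> g x = \<zero>"
    using assms(2) by (metis has_fsumE subset_refl)
  have fc: "f x \<in> carrier R" if "x \<in> X" for x using A(1) that by auto
  have gc: "g y \<in> carrier R" if "y \<in> Y" for y using B(1) that by auto
  show ?thesis
  proof (rule has_fsumI[of _ _ "A \<times> B"])
    show "finsum R (\<lambda>(x, y). f x \<otimes> g y) (A \<times> B) = a \<otimes> b"
      using finsum_product[OF A(2) B(2), of f g] A B by (auto simp: subset_iff Pi_def)
    fix p assume "p \<in> X \<times> Y - A \<times> B"
    then obtain x y where p: "p = (x, y)" "x \<in> X" "y \<in> Y" "x \<notin> A \<or> y \<notin> B" by auto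
    then show "(case p of (x, y) \<Rightarrow> f x \<otimes> g y) = \<zero>" using A(5) B(5) fc gc by auto
  qed (use A B fc gc in auto)
qed

end

section \<open>The convolution monoid of a coalgebra\<close>

definition dual :: "('k, 'r) ring_scheme \<Rightarrow> ('k, 'v, 'x) module_scheme \<Rightarrow> ('v \<Rightarrow> 'k) set" where
  "dual K V = linear_maps K V (ground_module K)"

lemma ground_mult_bilinear:
  assumes V: "module K V" and W: "module K W" and f: "f \<in> dual K V" and g: "g \<in> dual K W"
  shows "bilinear_map K V W (ground_module K) (\<lambda>v w. f v \<otimes>\<^bsub>K\<^esub> g w)"
proof -
  interpret V: module K V by fact
  note c = linear_map_closed[OF f[unfolded dual_def], simplified] linear_map_closed[OF g[unfolded dual_def], simplified]
  show ?thesis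
    by (rule bilinear_mapI)
       (auto simp: c linear_map_add[OF f[unfolded dual_def]] linear_map_add[OF g[unfolded dual_def]]
        linear_map_smult[OF f[unfolded dual_def]] linear_map_smult[OF g[unfolded dual_def]]
        V.R.l_distr V.R.r_distr V.R.m_assoc V.R.m_lcomm)
qed

context
  fixes K :: "('k, 'r) ring_scheme" and V :: "('k, 'v, 'x) module_scheme"
  assumes V: "module K V"
begin

lemma dual_closed: "f \<in> dual K V \<Longrightarrow> v \<in> carrier V \<Longrightarrow> f v \<in> carrier K"
  unfolding dual_def by (auto dest: linear_map_closed)

lemma dual_add: "f \<in> dual K V \<Longrightarrow> v \<in> carrier V \<Longrightarrow> v' \<in> carrier V \<Longrightarrow> f (v \<oplus>\<^bsub>V\<^esub> v') = f v \<oplus>\<^bsub>K\<^esub> f v'"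
  unfolding dual_def by (auto dest: linear_map_add)

lemma dual_zero: "f \<in> dual K V \<Longrightarrow> f \<zero>\<^bsub>V\<^esub> = \<zero>\<^bsub>K\<^esub>"
  unfolding dual_def by (auto dest: linear_map_zero[OF V module_ground[OF V]])

lemma dual_compose: "is_linear K V W h \<Longrightarrow> f \<in> dual K W \<Longrightarrow> (\<lambda>v\<in>carrier V. f (h v)) \<in> dual K V"
  unfolding dual_def
  by (rule restrict_linear_mapsI[OF V])
     (auto simp: is_linear_def Pi_def linear_map_add linear_map_smult dest: linear_map_closed)

end

text \<open>The functional $f \otimes g$ on the tensor product.\<close>

definition tensor_form where
  "tensor_form K V W f g = tensor_lift K V W (ground_module K) (\<lambda>v w. f v \<otimes>\<^bsub>K\<^esub> g w)"

context
  fixes K :: "('k, 'r) ring_scheme" and V :: "('k, 'v, 'x) module_scheme" and W :: "('k, 'w, 'y) module_scheme"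
  assumes V: "module K V" and W: "module K W"
begin

interpretation V: module K V by (rule V)

lemma tensor_form_linear: "f \<in> dual K V \<Longrightarrow> g \<in> dual K W \<Longrightarrow> tensor_form K V W f g \<in> dual K (tensor K V W)"
  unfolding tensor_form_def dual_def[of K "tensor K V W"]
  by (rule tensor_lift_linear[OF V W module_ground[OF V] ground_mult_bilinear[OF V W]])

lemma tensor_form_tens: "f \<in> dual K V \<Longrightarrow> g \<in> dual K W \<Longrightarrow> v \<in> carrier V \<Longrightarrow> w \<in> carrier W \<Longrightarrow>
    tensor_form K V W f g (tens K V W v w) = f v \<otimes>\<^bsub>K\<^esub> g w"
  unfolding tensor_form_def
  by (rule tensor_lift_tens[OF V W module_ground[OF V] ground_mult_bilinear[OF V W]])

lemma tensor_dual_eq: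
  assumes f: "f \<in> dual K (tensor K V W)" and g: "g \<in> dual K (tensor K V W)"
    and eq: "\<And>v w. v \<in> carrier V \<Longrightarrow> w \<in> carrier W \<Longrightarrow> f (tens K V W v w) = g (tens K V W v w)"
  shows "f = g"
  by (rule tensor_linear_eq[OF V W module_ground[OF V] f[unfolded dual_def] g[unfolded dual_def] eq])

end

text \<open>For an elementary tensor \<open>v \<otimes> w\<close> this is the product of two finite sums, and every tensor is a finite
  sum of elementary ones. Finiteness holds pointwise only, which is why the sums are not sums of
  functionals.\<close>

lemma has_fsum_tensor_form:
  assumes V: "module K V" and W: "module K W"
    and f: "\<And>x. x \<in> X \<Longrightarrow> f x \<in> dual K V" and F: "F \<in> dual K V"
    and g: "\<And>y. y \<in> Y \<Longrightarrow> g y \<in> dual K W" and G: "G \<in> dual K W"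
    and fF: "\<And>v. v \<in> carrier V \<Longrightarrow> has_fsum K X (\<lambda>x. f x v) (F v)"
    and gG: "\<And>w. w \<in> carrier W \<Longrightarrow> has_fsum K Y (\<lambda>y. g y w) (G w)"
    and t: "t \<in> carrier (tensor K V W)"
  shows "has_fsum K (X \<times> Y) (\<lambda>(x, y). tensor_form K V W (f x) (g y) t) (tensor_form K V W F G t)"
proof -
  interpret V: module K V by fact
  note L = tensor_form_linear[OF V W]
  note T = tensor_module[OF V W]
  show ?thesis using t
  proof (induction rule: tens_induct[OF V W, consumes 1, case_names zero tens add])
    case zero
    show ?case
      unfolding dual_zero[OF T L[OF F G]]
      by (rule V.R.has_fsum_cong[OF V.R.has_fsum_zero]) (auto simp: dual_zero[OF T L[OF f g]])
  next
    case (tens v w)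
    have "has_fsum K (X \<times> Y) (\<lambda>(x, y). f x v \<otimes>\<^bsub>K\<^esub> g y w) (F v \<otimes>\<^bsub>K\<^esub> G w)"
      by (rule V.R.has_fsum_product[OF fF gG]) (use tens in auto)
    then show ?case
      unfolding tensor_form_tens[OF V W F G tens]
      by (rule V.R.has_fsum_cong) (auto simp: tensor_form_tens[OF V W f g tens])
  next
    case (add s t)
    show ?case
      unfolding dual_add[OF T L[OF F G] add(1,2)]
      by (rule V.R.has_fsum_cong[OF V.R.has_fsum_add[OF add(3,4)]]) (auto simp: dual_add[OF T L[OF f g] add(1,2)])
  qed
qed

definition conv where
  "conv K C f g = (\<lambda>c\<in>carrier C. tensor_form K C C f g (comult C c))"

text \<open>A structure in the sense of the algebra library, so that products of finitely many functionals are
  available as \<open>finprod\<close>.\<close>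

definition dual_monoid where
  "dual_monoid K C = \<lparr>carrier = dual K C, mult = conv K C, one = counit C\<rparr>"

locale coalg =
  fixes K :: "('k, 'r) ring_scheme" and C :: "('k, 'v) coalgebra"
  assumes coalg: "cocommutative_coalgebra K C"
begin

lemma module_C: "module K C"
  using coalg unfolding cocommutative_coalgebra_def by blast

sublocale C: module K C by (rule module_C)

lemma comult_linear: "comult C \<in> linear_maps K C (tensor K C C)"
  using coalg unfolding cocommutative_coalgebra_def by blast

lemma counit_dual: "counit C \<in> dual K C"
  using coalg unfolding cocommutative_coalgebra_def dual_def by blast

lemma counit_linear: "counit C \<in> linear_maps K C (ground_module K)"
  using counit_dual unfolding dual_def .

lemma comult_closed: "c \<in> carrier C \<Longrightarrow> comult C c \<in> carrier (tensor K C C)"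
  by (rule linear_map_closed[OF comult_linear])

lemma conv_apply: "c \<in> carrier C \<Longrightarrow> conv K C f g c = tensor_form K C C f g (comult C c)"
  unfolding conv_def by simp

lemmas ground_C = ground_module_module[OF C.R.is_cring]
lemmas CC_module = tensor_module[OF module_C module_C]

lemma conv_closed:
  assumes "f \<in> dual K C" "g \<in> dual K C" shows "conv K C f g \<in> dual K C"
  unfolding conv_def
  by (rule dual_compose[OF module_C linear_map_is_linear[OF comult_linear] tensor_form_linear[OF module_C module_C assms]])

text \<open>Commutativity of the convolution product is cocommutativity read through functionals; in the same
  way the next two lemmas translate the counit law and coassociativity.\<close>

lemma conv_comm:
  assumes f: "f \<in> dual K C" and g: "g \<in> dual K C" shows "conv K C f g = conv K C g f"
proof -
  note sw = tensor_swap_linear[OF module_C module_C]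
  have "(\<lambda>t\<in>carrier (tensor K C C). tensor_form K C C f g (tensor_swap K C C t)) = tensor_form K C C g f"
    by (rule tensor_dual_eq[OF module_C module_C dual_compose[OF CC_module linear_map_is_linear[OF sw] tensor_form_linear[OF module_C module_C f g]]
           tensor_form_linear[OF module_C module_C g f]])
       (simp add: tens_closed[OF module_C module_C] tensor_swap_tens[OF module_C module_C]
         tensor_form_tens[OF module_C module_C f g] tensor_form_tens[OF module_C module_C g f]
         C.R.m_comm dual_closed[OF module_C f] dual_closed[OF module_C g])
  note eq = this
  have "tensor_form K C C f g (tensor_swap K C C t) = tensor_form K C C g f t" if "t \<in> carrier (tensor K C C)" for t
    using fun_cong[OF eq, of t] that by simp
  moreover have "tensor_swap K C C (comult C c) = comult C c" if "c \<in> carrier C" for c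
    using coalg that unfolding cocommutative_coalgebra_def by blast
  ultimately show ?thesis
    unfolding conv_def using comult_closed by (intro restrict_ext) metis
qed

lemma conv_counit_left:
  assumes f: "f \<in> dual K C" shows "conv K C (counit C) f = f"
proof -
  note M = tensor_map_linear[OF module_C module_C ground_C module_C linear_map_is_linear[OF counit_linear] is_linear_id]
  note l = tensor_lunit_linear[OF module_C]
  note G = tensor_module[OF ground_C module_C]
  note e = counit_dual
  have "(\<lambda>t\<in>carrier (tensor K C C). f (tensor_lunit K C (tensor_map K C C (ground_module K) C (counit C) (\<lambda>x. x) t)))
      = tensor_form K C C (counit C) f"
    by (rule tensor_dual_eq[OF module_C module_C
          dual_compose[OF CC_module is_linear_compose[OF linear_map_is_linear[OF M] linear_map_is_linear[OF l]] f]
           tensor_form_linear[OF module_C module_C e f]])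
       (simp add: tens_closed[OF module_C module_C] tensor_lunit_tens[OF module_C] 
         tensor_map_tens[OF module_C module_C ground_C module_C linear_map_is_linear[OF counit_linear] is_linear_id]
         tensor_form_tens[OF module_C module_C e f] dual_closed[OF module_C e]
         linear_map_smult[OF f[unfolded dual_def]])
  note eq = this
  have *: "f (tensor_lunit K C (tensor_map K C C (ground_module K) C (counit C) (\<lambda>x. x) t)) = tensor_form K C C (counit C) f t"
    if "t \<in> carrier (tensor K C C)" for t
    using fun_cong[OF eq, of t] that by simp
  have "tensor_lunit K C (tensor_map K C C (ground_module K) C (counit C) (\<lambda>x. x) (comult C c)) = c" if "c \<in> carrier C" for c
    using coalg that unfolding cocommutative_coalgebra_def by blast
  then have "conv K C (counit C) f c = f c" if "c \<in> carrier C" for c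
    using *[OF comult_closed[OF that]] that by (simp add: conv_apply)
  then show ?thesis
    using linear_map_eqI[of _ K C "ground_module K" f] conv_closed[OF e f] f unfolding dual_def by blast
qed

lemma conv_assoc:
  assumes f: "f \<in> dual K C" and g: "g \<in> dual K C" and h: "h \<in> dual K C"
  shows "conv K C (conv K C f g) h = conv K C f (conv K C g h)"
proof -
  note m = module_C
  note fg = tensor_form_linear[OF m m f g] and gh = tensor_form_linear[OF m m g h]
  note cfg = conv_closed[OF f g] and cgh = conv_closed[OF g h]
  note D = linear_map_is_linear[OF comult_linear]
  note M1 = tensor_map_linear[OF m m CC_module m D is_linear_id]
  note M2 = tensor_map_linear[OF m m m CC_module is_linear_id D]
  note A = tensor_assoc_linear[OF m m m]
  note CC_C = tensor_module[OF CC_module m] and C_CC = tensor_module[OF m CC_module]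
  have 1: "(\<lambda>t\<in>carrier (tensor K C C). tensor_form K (tensor K C C) C (tensor_form K C C f g) h
        (tensor_map K C C (tensor K C C) C (comult C) (\<lambda>x. x) t)) = tensor_form K C C (conv K C f g) h"
    by (rule tensor_dual_eq[OF m m dual_compose[OF CC_module linear_map_is_linear[OF M1] tensor_form_linear[OF CC_module m fg h]]
          tensor_form_linear[OF m m cfg h]])
       (simp add: tens_closed[OF m m] tensor_map_tens[OF m m CC_module m D is_linear_id] tensor_form_tens[OF CC_module m fg h] 
         comult_closed tensor_form_tens[OF m m cfg h] conv_apply)
  have 2: "(\<lambda>t\<in>carrier (tensor K C C). tensor_form K C (tensor K C C) f (tensor_form K C C g h)
        (tensor_map K C C C (tensor K C C) (\<lambda>x. x) (comult C) t)) = tensor_form K C C f (conv K C g h)"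
    by (rule tensor_dual_eq[OF m m dual_compose[OF CC_module linear_map_is_linear[OF M2] tensor_form_linear[OF m CC_module f gh]]
          tensor_form_linear[OF m m f cgh]])
       (simp add: tens_closed[OF m m] tensor_map_tens[OF m m m CC_module is_linear_id D] tensor_form_tens[OF m CC_module f gh] 
         comult_closed tensor_form_tens[OF m m f cgh] conv_apply)
  \<comment> \<open>Both sides are the functional $f \otimes g \otimes h$, compared on tensors that are elementary in the last factor.\<close>
  have tA: "tensor_form K C (tensor K C C) f (tensor_form K C C g h) (tensor_assoc K C C C (tens K (tensor K C C) C s c))
     = tensor_form K (tensor K C C) C (tensor_form K C C f g) h (tens K (tensor K C C) C s c)"
    if s: "s \<in> carrier (tensor K C C)" and c: "c \<in> carrier C" for s c
    using s
  proof (induction rule: tens_induct[OF m m, consumes 1, case_names zero tens add])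
    case zero
    have "tens K (tensor K C C) C \<zero>\<^bsub>tensor K C C\<^esub> c = \<zero>\<^bsub>tensor K (tensor K C C) C\<^esub>"
    proof -
      interpret T: module K "tensor K C C" by (rule CC_module)
      interpret T3: module K "tensor K (tensor K C C) C" by (rule CC_C)
      have "tens K (tensor K C C) C (\<zero>\<^bsub>K\<^esub> \<odot>\<^bsub>tensor K C C\<^esub> \<zero>\<^bsub>tensor K C C\<^esub>) c = \<zero>\<^bsub>tensor K (tensor K C C) C\<^esub>"
        by (subst tens_smult_left[OF CC_module m _ _ c]) (auto simp: tens_closed[OF CC_module m _ c])
      then show ?thesis by simp
    qed
    then show ?case
      by (simp add: linear_map_zero[OF CC_C C_CC A] dual_zero[OF C_CC tensor_form_linear[OF m CC_module f gh]] 
        dual_zero[OF CC_C tensor_form_linear[OF CC_module m fg h]])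
  next
    case (tens v w)
    then show ?case using c
      by (simp add: tensor_assoc_tens[OF m m m] tensor_form_tens[OF m CC_module f gh] tensor_form_tens[OF CC_module m fg h]
       tensor_form_tens[OF m m f g] tensor_form_tens[OF m m g h] tens_closed[OF m m] C.R.m_assoc
       dual_closed[OF m f] dual_closed[OF m g] dual_closed[OF m h])
  next
    case (add s t)
    then show ?case using c
      by (simp add: tens_add_left[OF CC_module m] linear_map_add[OF A] tens_closed[OF CC_module m] linear_map_closed[OF A]
         dual_add[OF C_CC tensor_form_linear[OF m CC_module f gh]] dual_add[OF CC_C tensor_form_linear[OF CC_module m fg h]])
  qed
  have "(\<lambda>t\<in>carrier (tensor K (tensor K C C) C). tensor_form K C (tensor K C C) f (tensor_form K C C g h) (tensor_assoc K C C C t))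
     = tensor_form K (tensor K C C) C (tensor_form K C C f g) h"
    by (rule tensor_dual_eq[OF CC_module m dual_compose[OF CC_C linear_map_is_linear[OF A] tensor_form_linear[OF m CC_module f gh]]
         tensor_form_linear[OF CC_module m fg h]])
       (simp add: tA tens_closed[OF CC_module m])
  note eq = this
  have 3: "tensor_form K C (tensor K C C) f (tensor_form K C C g h) (tensor_assoc K C C C t)
     = tensor_form K (tensor K C C) C (tensor_form K C C f g) h t" if "t \<in> carrier (tensor K (tensor K C C) C)" for t
    using fun_cong[OF eq, of t] that by simp
  have co: "tensor_assoc K C C C
            (tensor_map K C C (tensor K C C) C (comult C) (\<lambda>x. x) (comult C c))
          = tensor_map K C C C (tensor K C C) (\<lambda>x. x) (comult C) (comult C c)" if "c \<in> carrier C" for c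
    using coalg that unfolding cocommutative_coalgebra_def by blast
  have "conv K C (conv K C f g) h c = conv K C f (conv K C g h) c" if c: "c \<in> carrier C" for c
  proof -
    have "conv K C (conv K C f g) h c = tensor_form K (tensor K C C) C (tensor_form K C C f g) h
        (tensor_map K C C (tensor K C C) C (comult C) (\<lambda>x. x) (comult C c))"
      using c comult_closed[OF c] by (simp add: conv_apply flip: 1)
    also have "\<dots> = tensor_form K C (tensor K C C) f (tensor_form K C C g h)
        (tensor_map K C C C (tensor K C C) (\<lambda>x. x) (comult C) (comult C c))"
      unfolding co[OF c, symmetric]
      by (rule 3[symmetric]) (rule linear_map_closed[OF M1 comult_closed[OF c]])
    also have "\<dots> = conv K C f (conv K C g h) c"
      using c comult_closed[OF c] by (simp add: conv_apply flip: 2)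
    finally show ?thesis .
  qed
  then show ?thesis
    using linear_map_eqI[of _ K C "ground_module K"] conv_closed[OF cfg h] conv_closed[OF f cgh] unfolding dual_def by blast
qed

lemma dual_comm_monoid: "comm_monoid (dual_monoid K C)"
  unfolding dual_monoid_def
  by (rule comm_monoidI) (auto simp: conv_closed counit_dual conv_assoc conv_counit_left intro: conv_comm)

lemma dual_monoid_simps: "carrier (dual_monoid K C) = dual K C" "mult (dual_monoid K C) = conv K C"
  "one (dual_monoid K C) = counit C"
  unfolding dual_monoid_def by simp_all

definition zero_form where "zero_form = (\<lambda>c\<in>carrier C. \<zero>\<^bsub>K\<^esub>)"

lemma zero_form_dual: "zero_form \<in> dual K C"
  unfolding zero_form_def dual_def by (rule restrict_linear_mapsI[OF module_C]) auto

lemma dual_eqI: "f \<in> dual K C \<Longrightarrow> g \<in> dual K C \<Longrightarrow> (\<And>c. c \<in> carrier C \<Longrightarrow> f c = g c) \<Longrightarrow> f = g"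
  unfolding dual_def by (rule linear_map_eqI)

lemma has_fsum_conv:
  assumes f: "\<And>x. x \<in> X \<Longrightarrow> f x \<in> dual K C" and F: "F \<in> dual K C"
    and g: "\<And>y. y \<in> Y \<Longrightarrow> g y \<in> dual K C" and G: "G \<in> dual K C"
    and "\<And>v. v \<in> carrier C \<Longrightarrow> has_fsum K X (\<lambda>x. f x v) (F v)"
    and "\<And>w. w \<in> carrier C \<Longrightarrow> has_fsum K Y (\<lambda>y. g y w) (G w)"
    and c: "c \<in> carrier C"
  shows "has_fsum K (X \<times> Y) (\<lambda>(x, y). conv K C (f x) (g y) c) (conv K C F G c)"
  unfolding conv_apply[OF c]
  by (rule has_fsum_tensor_form[OF module_C module_C f F g G assms(5,6) comult_closed[OF c]])

text \<open>A single functional is a family indexed by the one-element set \<open>{()}\<close>.\<close>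

lemma has_fsum_conv_left:
  assumes f: "\<And>x. x \<in> X \<Longrightarrow> f x \<in> dual K C" and F: "F \<in> dual K C" and g: "g \<in> dual K C"
    and fF: "\<And>v. v \<in> carrier C \<Longrightarrow> has_fsum K X (\<lambda>x. f x v) (F v)"
    and c: "c \<in> carrier C"
  shows "has_fsum K X (\<lambda>x. conv K C (f x) g c) (conv K C F g c)"
proof -
  have 1: "has_fsum K {()} (\<lambda>y. g w) (g w)" if "w \<in> carrier C" for w
    by (rule C.R.has_fsum_single) (use dual_closed[OF module_C g that] in auto)
  have "bij_betw (\<lambda>x. (x, ())) X (X \<times> {()})"
    by (rule bij_betwI[of _ _ _ fst]) auto
  from C.R.has_fsum_reindex[OF this has_fsum_conv[OF f F g g fF 1 c]] show ?thesis by simp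
qed

lemma conv_zero_left: "f \<in> dual K C \<Longrightarrow> conv K C zero_form f = zero_form"
proof (rule dual_eqI[OF conv_closed zero_form_dual])
  fix c assume f: "f \<in> dual K C" and c: "c \<in> carrier C"
  have "has_fsum K {} (\<lambda>x. conv K C zero_form f c) (conv K C zero_form f c)"
    by (rule has_fsum_conv_left[where f = "\<lambda>x. zero_form"])
     (use zero_form_dual f c C.R.has_fsum_zero[of "{}"] in \<open>auto simp: zero_form_def has_fsum_def\<close>)
  then have "conv K C zero_form f c = \<zero>\<^bsub>K\<^esub>" unfolding has_fsum_def by auto
  then show "conv K C zero_form f c = zero_form c" using c unfolding zero_form_def by simp
qed (auto simp: zero_form_dual)

end

section \<open>Coalgebras with a basis of grouplike elements\<close>

text \<open>Throughout, \<open>\<iota>\<close> is a linear isomorphism from the free module on \<open>X\<close> onto the carrier of \<open>C\<close>. The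
  carrier of \<open>C\<close> has to lie in the universe, so it cannot be the free module itself.\<close>

definition coord where
  "coord K X \<iota> c = the_inv_into (carrier (free_module K X)) \<iota> c"

definition coord_form where
  "coord_form K X C \<iota> x = (\<lambda>c\<in>carrier C. coord K X \<iota> c x)"

definition basis_ext where
  "basis_ext K X C \<iota> Z \<phi> = (\<lambda>c\<in>carrier C. lin_ext K X Z \<phi> (coord K X \<iota> c))"

text \<open>The coalgebra $\mathbb{K}[X]$: it has a basis indexed by \<open>X\<close>, and each basis vector \<open>b\<close> is
  grouplike, that is, its comultiple is $b \otimes b$ and its counit is 1.\<close>

locale grouplike_coalg =
  fixes K :: "('k, 'r) ring_scheme" and X :: "'x set" and C :: "('k, 'v) coalgebra" and \<iota> :: "('x \<Rightarrow> 'k) \<Rightarrow> 'v"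
  assumes module_C: "module K C"
    and iso_is_linear: "is_linear K (free_module K X) C \<iota>"
    and iso_bij: "bij_betw \<iota> (carrier (free_module K X)) (carrier C)"
    and comult_linear: "comult C \<in> linear_maps K C (tensor K C C)"
    and counit_linear: "counit C \<in> linear_maps K C (ground_module K)"
    and comult_basis: "x \<in> X \<Longrightarrow> comult C (\<iota> (basis_vec K x)) = tens K C C (\<iota> (basis_vec K x)) (\<iota> (basis_vec K x))"
    and counit_basis: "x \<in> X \<Longrightarrow> counit C (\<iota> (basis_vec K x)) = \<one>\<^bsub>K\<^esub>"
begin

sublocale C: module K C by (rule module_C)

abbreviation b where "b x \<equiv> \<iota> (basis_vec K x)"

lemma free_X: "module K (free_module K X)"
  by (rule free_module_module[OF C.R.is_cring])

lemmas CC_module = tensor_module[OF module_C module_C]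
lemmas ground_K = ground_module_module[OF C.R.is_cring]

lemma b_closed: "x \<in> X \<Longrightarrow> b x \<in> carrier C"
  by (rule is_linear_closed[OF iso_is_linear basis_vec_carrier[OF C.R.is_cring]])

lemma coord_closed: "c \<in> carrier C \<Longrightarrow> coord K X \<iota> c \<in> carrier (free_module K X)"
  unfolding coord_def using bij_betw_the_inv_into[OF iso_bij] by (auto dest: bij_betwE)

lemma iso_coord: "c \<in> carrier C \<Longrightarrow> \<iota> (coord K X \<iota> c) = c"
  unfolding coord_def using iso_bij by (simp add: f_the_inv_into_f_bij_betw)

lemma coord_iso: "v \<in> carrier (free_module K X) \<Longrightarrow> coord K X \<iota> (\<iota> v) = v"
  unfolding coord_def using iso_bij by (simp add: bij_betw_def the_inv_into_f_f)

lemma coord_basis: "x \<in> X \<Longrightarrow> coord K X \<iota> (b x) = basis_vec K x"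
  by (rule coord_iso[OF basis_vec_carrier[OF C.R.is_cring]])

lemma coord_is_linear: "is_linear K C (free_module K X) (coord K X \<iota>)"
proof -
  interpret F: module K "free_module K X" by (rule free_X)
  have "coord K X \<iota> (c \<oplus>\<^bsub>C\<^esub> c') = coord K X \<iota> c \<oplus>\<^bsub>free_module K X\<^esub> coord K X \<iota> c'"
    if c: "c \<in> carrier C" "c' \<in> carrier C" for c c'
  proof -
    have "c \<oplus>\<^bsub>C\<^esub> c' = \<iota> (coord K X \<iota> c \<oplus>\<^bsub>free_module K X\<^esub> coord K X \<iota> c')"
      using iso_is_linear coord_closed c iso_coord unfolding is_linear_def by metis
    then show ?thesis using coord_iso F.M.add.m_closed coord_closed c by metis
  qed
  moreover have "coord K X \<iota> (r \<odot>\<^bsub>C\<^esub> c) = r \<odot>\<^bsub>free_module K X\<^esub> coord K X \<iota> c"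
    if c: "r \<in> carrier K" "c \<in> carrier C" for r c
  proof -
    have "r \<odot>\<^bsub>C\<^esub> c = \<iota> (r \<odot>\<^bsub>free_module K X\<^esub> coord K X \<iota> c)"
      using iso_is_linear coord_closed c iso_coord unfolding is_linear_def by metis
    then show ?thesis using coord_iso F.smult_closed coord_closed c by metis
  qed
  ultimately show ?thesis unfolding is_linear_def using coord_closed by blast
qed

lemma coord_apply_closed: "c \<in> carrier C \<Longrightarrow> coord K X \<iota> c x \<in> carrier K"
  using coord_closed[of c] unfolding free_module_carrier by blast

lemma coord_outside: "c \<in> carrier C \<Longrightarrow> x \<notin> X \<Longrightarrow> coord K X \<iota> c x = \<zero>\<^bsub>K\<^esub>"
  using coord_closed[of c] unfolding free_module_carrier by blast

lemma eq_if_coord_eq: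
  assumes "c \<in> carrier C" "c' \<in> carrier C" "\<And>x. x \<in> X \<Longrightarrow> coord K X \<iota> c x = coord K X \<iota> c' x"
  shows "c = c'"
proof -
  have "coord K X \<iota> c x = coord K X \<iota> c' x" for x
    by (cases "x \<in> X") (simp_all add: assms coord_outside)
  then have "coord K X \<iota> c = coord K X \<iota> c'" by blast
  then show ?thesis using iso_coord assms by metis
qed

lemma coord_form_dual: "coord_form K X C \<iota> x \<in> dual K C"
  unfolding coord_form_def dual_def
proof (rule restrict_linear_mapsI[OF module_C])
  show "coord K X \<iota> c x \<in> carrier (ground_module K)" if "c \<in> carrier C" for c
    using coord_apply_closed[OF that] by simp
next
  show "coord K X \<iota> (c \<oplus>\<^bsub>C\<^esub> c') x = coord K X \<iota> c x \<oplus>\<^bsub>ground_module K\<^esub> coord K X \<iota> c' x"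
    if "c \<in> carrier C" "c' \<in> carrier C" for c c'
    using coord_is_linear that unfolding is_linear_def by simp
  show "coord K X \<iota> (r \<odot>\<^bsub>C\<^esub> c) x = r \<odot>\<^bsub>ground_module K\<^esub> coord K X \<iota> c x"
    if "r \<in> carrier K" "c \<in> carrier C" for r c
    using coord_is_linear that unfolding is_linear_def by simp
qed

lemma is_linear_eq:
  assumes Z: "module K Z" and f: "is_linear K C Z f" and g: "is_linear K C Z g"
    and eq: "\<And>x. x \<in> X \<Longrightarrow> f (b x) = g (b x)" and c: "c \<in> carrier C"
  shows "f c = g c"
proof -
  let ?r = "\<lambda>f. \<lambda>v\<in>carrier (free_module K X). f (\<iota> v)"
  have r: "?r h \<in> linear_maps K (free_module K X) Z" if "is_linear K C Z h" for h
    by (rule restrict_linear_mapsI[OF free_X]) (use is_linear_compose[OF iso_is_linear that] in \<open>simp_all only: is_linear_def Pi_iff\<close>)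
  have "?r f = ?r g"
    by (rule free_module_linear_eq[OF C.R.is_cring Z r[OF f] r[OF g]])
      (simp add: eq basis_vec_carrier[OF C.R.is_cring])
  from fun_cong[OF this, of "coord K X \<iota> c"] show ?thesis
    using c by (simp add: coord_closed iso_coord)
qed

lemma tensor_is_linear_eq:
  assumes Z: "module K Z" and f: "is_linear K (tensor K C C) Z f" and g: "is_linear K (tensor K C C) Z g"
    and eq: "\<And>x y. x \<in> X \<Longrightarrow> y \<in> X \<Longrightarrow> f (tens K C C (b x) (b y)) = g (tens K C C (b x) (b y))"
    and t: "t \<in> carrier (tensor K C C)"
  shows "f t = g t"
proof -
  note m = module_C
  have l: "is_linear K C (tensor K C C) (\<lambda>v. tens K C C v w)" if "w \<in> carrier C" for w
    unfolding is_linear_def using that by (auto simp: tens_closed[OF m m] tens_add_left[OF m m] tens_smult_left[OF m m])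
  have r: "is_linear K C (tensor K C C) (\<lambda>w. tens K C C v w)" if "v \<in> carrier C" for v
    unfolding is_linear_def using that by (auto simp: tens_closed[OF m m] tens_add_right[OF m m] tens_smult_right[OF m m])
  have 1: "f (tens K C C (b x) w) = g (tens K C C (b x) w)" if "x \<in> X" "w \<in> carrier C" for x w
    using is_linear_eq[OF Z is_linear_compose[OF r f] is_linear_compose[OF r g] eq that(2)] that(1) b_closed by blast
  have 2: "f (tens K C C v w) = g (tens K C C v w)" if "v \<in> carrier C" "w \<in> carrier C" for v w
    using is_linear_eq[OF Z is_linear_compose[OF l f] is_linear_compose[OF l g] 1 that(1)] that(2) by blast
  have rr: "restrict h (carrier (tensor K C C)) \<in> linear_maps K (tensor K C C) Z" if "is_linear K (tensor K C C) Z h" for h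
    by (rule restrict_linear_mapsI[OF CC_module]) (use that in \<open>auto simp: is_linear_def\<close>)
  have "restrict f (carrier (tensor K C C)) = restrict g (carrier (tensor K C C))"
    by (rule tensor_linear_eq[OF m m Z rr[OF f] rr[OF g]]) (simp add: 2 tens_closed[OF m m])
  from fun_cong[OF this, of t] show ?thesis using t by simp
qed

lemma coord_form_basis: "x \<in> X \<Longrightarrow> y \<in> X \<Longrightarrow> coord_form K X C \<iota> x (b y) = (if x = y then \<one>\<^bsub>K\<^esub> else \<zero>\<^bsub>K\<^esub>)"
  unfolding coord_form_def by (simp add: b_closed coord_basis) (simp add: basis_vec_def)

text \<open>The functionals $x^* \otimes y^*$ separate the tensors: they are the coordinates of the map \<open>\<Phi>\<close> to
  the free module on pairs, and \<open>\<Phi>\<close> is injective, since \<open>\<Psi>\<close> sends the basis vector of \<open>(x, y)\<close> back to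
  the tensor of the basis vectors of \<open>x\<close> and \<open>y\<close>.\<close>

lemma tensor_eq_if_coord_form_eq:
  assumes s: "s \<in> carrier (tensor K C C)" and t: "t \<in> carrier (tensor K C C)"
    and eq: "\<And>x y. x \<in> X \<Longrightarrow> y \<in> X \<Longrightarrow> tensor_form K C C (coord_form K X C \<iota> x) (coord_form K X C \<iota> y) s
        = tensor_form K C C (coord_form K X C \<iota> x) (coord_form K X C \<iota> y) t"
  shows "s = t"
proof -
  note m = module_C
  let ?F = "free_module K (X \<times> X)"
  have F: "module K ?F" by (rule free_module_module[OF C.R.is_cring])
  interpret F: module K ?F by (rule F)
  let ?\<phi> = "\<lambda>v w. \<lambda>(x, y). coord K X \<iota> v x \<otimes>\<^bsub>K\<^esub> coord K X \<iota> w y"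
  have bil: "bilinear_map K C C ?F ?\<phi>"
  proof (rule bilinear_mapI)
    fix v w assume v: "v \<in> carrier C" and w: "w \<in> carrier C"
    have "{p. ?\<phi> v w p \<noteq> \<zero>\<^bsub>K\<^esub>} \<subseteq> {x. coord K X \<iota> v x \<noteq> \<zero>\<^bsub>K\<^esub>} \<times> {x. coord K X \<iota> w x \<noteq> \<zero>\<^bsub>K\<^esub>}"
      using coord_apply_closed v w by (auto simp: C.R.l_null C.R.r_null)
    moreover have "finite ({x. coord K X \<iota> v x \<noteq> \<zero>\<^bsub>K\<^esub>} \<times> {x. coord K X \<iota> w x \<noteq> \<zero>\<^bsub>K\<^esub>})"
      "{x. coord K X \<iota> v x \<noteq> \<zero>\<^bsub>K\<^esub>} \<times> {x. coord K X \<iota> w x \<noteq> \<zero>\<^bsub>K\<^esub>} \<subseteq> X \<times> X"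
      using coord_closed v w unfolding free_module_carrier by blast+
    ultimately have "finite {p. ?\<phi> v w p \<noteq> \<zero>\<^bsub>K\<^esub>}" "{p. ?\<phi> v w p \<noteq> \<zero>\<^bsub>K\<^esub>} \<subseteq> X \<times> X"
      by (blast intro: finite_subset, blast)
    then show "?\<phi> v w \<in> carrier ?F"
      unfolding free_module_carrier using v w by (auto simp: coord_apply_closed)
  qed (use coord_is_linear coord_apply_closed in \<open>auto simp: is_linear_def C.R.l_distr C.R.r_distr C.R.m_assoc C.R.m_lcomm\<close>)
  define \<Phi> where "\<Phi> = tensor_lift K C C ?F ?\<phi>"
  have \<Phi>: "\<Phi> \<in> linear_maps K (tensor K C C) ?F"
    unfolding \<Phi>_def by (rule tensor_lift_linear[OF m m F bil])
  have \<Phi>t: "\<Phi> (tens K C C v w) = ?\<phi> v w" if "v \<in> carrier C" "w \<in> carrier C" for v w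
    unfolding \<Phi>_def by (rule tensor_lift_tens[OF m m F bil that])
  let ?\<psi> = "\<lambda>(x, y). tens K C C (b x) (b y)"
  have \<psi>: "?\<psi> \<in> X \<times> X \<rightarrow> carrier (tensor K C C)"
    by (auto intro!: tens_closed[OF m m] b_closed)
  define \<Psi> where "\<Psi> = lin_ext K (X \<times> X) (tensor K C C) ?\<psi>"
  have \<Psi>: "\<Psi> \<in> linear_maps K ?F (tensor K C C)"
    unfolding \<Psi>_def by (rule lin_ext_linear[OF CC_module \<psi>])
  have id: "\<Psi> (\<Phi> u) = u" if "u \<in> carrier (tensor K C C)" for u
  proof (rule tensor_is_linear_eq[OF CC_module is_linear_compose[OF linear_map_is_linear[OF \<Phi>] linear_map_is_linear[OF \<Psi>]] is_linear_id _ that])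
    fix x y assume xy: "x \<in> X" "y \<in> X"
    have "\<Phi> (tens K C C (b x) (b y)) = basis_vec K (x, y)"
      unfolding \<Phi>t[OF b_closed[OF xy(1)] b_closed[OF xy(2)]] coord_basis[OF xy(1)] coord_basis[OF xy(2)]
      by (auto simp: basis_vec_def)
    then show "\<Psi> (\<Phi> (tens K C C (b x) (b y))) = tens K C C (b x) (b y)"
      unfolding \<Psi>_def using lin_ext_basis[OF CC_module \<psi>, of "(x, y)"] xy by simp
  qed
  have co: "\<Phi> u (x, y) = tensor_form K C C (coord_form K X C \<iota> x) (coord_form K X C \<iota> y) u"
    if u: "u \<in> carrier (tensor K C C)" for u x y
  proof (rule tensor_is_linear_eq[OF ground_K _ linear_map_is_linear[OF tensor_form_linear[OF m m coord_form_dual coord_form_dual, unfolded dual_def]] _ u])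
    have "v p \<in> carrier K" if "v \<in> carrier ?F" for v p using that unfolding free_module_carrier by blast
    then have "is_linear K ?F (ground_module K) (\<lambda>v. v (x, y))"
      unfolding is_linear_def by auto
    then show "is_linear K (tensor K C C) (ground_module K) (\<lambda>u. \<Phi> u (x, y))"
      by (rule is_linear_compose[OF linear_map_is_linear[OF \<Phi>]])
    show "\<Phi> (tens K C C (b x') (b y')) (x, y) = tensor_form K C C (coord_form K X C \<iota> x) (coord_form K X C \<iota> y) (tens K C C (b x') (b y'))"
      if "x' \<in> X" "y' \<in> X" for x' y'
      using that by (simp add: \<Phi>t b_closed tensor_form_tens[OF m m coord_form_dual coord_form_dual]) (simp add: b_closed coord_form_def)
  qed
  have "\<Phi> s p = \<Phi> t p" for p
  proof (cases "p \<in> X \<times> X")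
    case True
    then show ?thesis using eq co[OF s] co[OF t] by auto
  next
    case False
    then have "\<Phi> s p = \<zero>\<^bsub>K\<^esub>" "\<Phi> t p = \<zero>\<^bsub>K\<^esub>"
      using linear_map_closed[OF \<Phi> s] linear_map_closed[OF \<Phi> t] unfolding free_module_carrier by blast+
    then show ?thesis by simp
  qed
  then have "\<Phi> s = \<Phi> t" by blast
  then show ?thesis using id[OF s] id[OF t] by metis
qed

lemma basis_ext_linear:
  assumes Z: "module K Z" and \<phi>: "\<phi> \<in> X \<rightarrow> carrier Z"
  shows "basis_ext K X C \<iota> Z \<phi> \<in> linear_maps K C Z"
  unfolding basis_ext_def
  by (rule restrict_linear_mapsI[OF module_C])
    (use is_linear_compose[OF coord_is_linear linear_map_is_linear[OF lin_ext_linear[OF Z \<phi>]]] in \<open>simp_all only: is_linear_def Pi_iff\<close>)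

lemma basis_ext_basis:
  assumes Z: "module K Z" and \<phi>: "\<phi> \<in> X \<rightarrow> carrier Z" and x: "x \<in> X"
  shows "basis_ext K X C \<iota> Z \<phi> (b x) = \<phi> x"
  unfolding basis_ext_def using x by (simp add: b_closed coord_basis lin_ext_basis[OF Z \<phi>])

lemma has_fsum_basis_ext:
  assumes f: "f \<in> dual K Z" and Z: "module K Z" and \<phi>: "\<phi> \<in> X \<rightarrow> carrier Z" and c: "c \<in> carrier C"
  shows "has_fsum K X (\<lambda>x. coord K X \<iota> c x \<otimes>\<^bsub>K\<^esub> f (\<phi> x)) (f (basis_ext K X C \<iota> Z \<phi> c))"
proof -
  interpret Z: module K Z by fact
  note fl = f[unfolded dual_def]
  let ?A = "{x. coord K X \<iota> c x \<noteq> \<zero>\<^bsub>K\<^esub>}"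
  have A: "finite ?A" "?A \<subseteq> X" using coord_closed[OF c] unfolding free_module_carrier by auto
  have \<phi>A: "\<phi> x \<in> carrier Z" if "x \<in> X" for x using \<phi> that by auto
  have "f (basis_ext K X C \<iota> Z \<phi> c) = f (finsum Z (\<lambda>x. coord K X \<iota> c x \<odot>\<^bsub>Z\<^esub> \<phi> x) ?A)"
    unfolding basis_ext_def using c by (simp add: lin_ext_finsum[OF Z \<phi> coord_closed A(1) _ A(2)])
  also have "\<dots> = finsum (ground_module K) (\<lambda>x. f (coord K X \<iota> c x \<odot>\<^bsub>Z\<^esub> \<phi> x)) ?A"
    by (rule linear_map_finsum[OF Z ground_K fl A(1)]) (use A \<phi>A coord_apply_closed[OF c] in auto)
  also have "\<dots> = finsum (ground_module K) (\<lambda>x. coord K X \<iota> c x \<otimes>\<^bsub>K\<^esub> f (\<phi> x)) ?A"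
  proof -
    interpret G: module K "ground_module K" by (rule ground_K)
    show ?thesis
      by (rule G.finsum_cong'[OF refl]) (use A \<phi>A coord_apply_closed[OF c] linear_map_smult[OF fl] linear_map_closed[OF fl] in auto)
  qed
  also have "\<dots> = finsum K (\<lambda>x. coord K X \<iota> c x \<otimes>\<^bsub>K\<^esub> f (\<phi> x)) ?A"
    unfolding finsum_def finprod_def by (simp add: ground_module_def)
  finally show ?thesis
    by (intro C.R.has_fsumI[OF _ A])
       (auto simp: coord_apply_closed[OF c] dual_closed[OF Z f] \<phi>A C.R.l_null)
qed

lemma counit_sum: 
  assumes c: "c \<in> carrier C" shows "has_fsum K X (\<lambda>x. coord K X \<iota> c x) (counit C c)"
proof -
  have bX: "b \<in> X \<rightarrow> carrier C" using b_closed by auto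
  have "basis_ext K X C \<iota> C b c = c"
    by (rule is_linear_eq[OF module_C linear_map_is_linear[OF basis_ext_linear[OF module_C bX]] is_linear_id basis_ext_basis[OF module_C bX] c])
  then have "has_fsum K X (\<lambda>x. coord K X \<iota> c x \<otimes>\<^bsub>K\<^esub> counit C (b x)) (counit C c)"
    using has_fsum_basis_ext[OF _ module_C bX c, of "counit C"] counit_linear unfolding dual_def by simp
  then show ?thesis
    by (rule C.R.has_fsum_cong) (simp add: counit_basis coord_apply_closed[OF c])
qed

text \<open>All axioms compare linear maps, and on grouplike basis vectors both sides are evidently equal.\<close>

lemma cocommutative: "cocommutative_coalgebra K C"
proof -
  note m = module_C
  note D = linear_map_is_linear[OF comult_linear] and e = linear_map_is_linear[OF counit_linear]
  note s1 = is_linear_compose[OF D is_linear_compose[OF linear_map_is_linear[OF tensor_map_linear[OF m m CC_module m D is_linear_id]]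
     linear_map_is_linear[OF tensor_assoc_linear[OF m m m]]]]
  note s2 = is_linear_compose[OF D linear_map_is_linear[OF tensor_map_linear[OF m m m CC_module is_linear_id D]]]
  note s3 = is_linear_compose[OF D is_linear_compose[OF linear_map_is_linear[OF tensor_map_linear[OF m m ground_K m e is_linear_id]]
     linear_map_is_linear[OF tensor_lunit_linear[OF m]]]]
  note s4 = is_linear_compose[OF D is_linear_compose[OF linear_map_is_linear[OF tensor_map_linear[OF m m m ground_K is_linear_id e]]
     linear_map_is_linear[OF tensor_runit_linear[OF m]]]]
  note s5 = is_linear_compose[OF D linear_map_is_linear[OF tensor_swap_linear[OF m m]]]
  note t = b_closed comult_basis counit_basis tens_closed[OF m m]
    tensor_map_tens[OF m m CC_module m D is_linear_id] tensor_map_tens[OF m m m CC_module is_linear_id D] tensor_assoc_tens[OF m m m]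
    tensor_map_tens[OF m m ground_K m e is_linear_id] tensor_map_tens[OF m m m ground_K is_linear_id e]
    tensor_lunit_tens[OF m] tensor_runit_tens[OF m] tensor_swap_tens[OF m m]
  show ?thesis
    unfolding cocommutative_coalgebra_def
  proof (intro conjI ballI m comult_linear counit_linear)
    fix c assume c: "c \<in> carrier C"
    show "tensor_assoc K C C C (tensor_map K C C (tensor K C C) C (comult C) (\<lambda>x. x) (comult C c)) =
         tensor_map K C C C (tensor K C C) (\<lambda>x. x) (comult C) (comult C c)"
      by (rule is_linear_eq[OF tensor_module[OF m CC_module] s1 s2 _ c]) (simp add: t)
    show "tensor_lunit K C (tensor_map K C C (ground_module K) C (counit C) (\<lambda>x. x) (comult C c)) = c"
      by (rule is_linear_eq[OF m s3 is_linear_id _ c]) (simp add: t)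
    show "tensor_runit K C (tensor_map K C C C (ground_module K) (\<lambda>x. x) (counit C) (comult C c)) = c"
      by (rule is_linear_eq[OF m s4 is_linear_id _ c]) (simp add: t)
    show "tensor_swap K C C (comult C c) = comult C c"
      by (rule is_linear_eq[OF CC_module s5 D _ c]) (simp add: t)
  qed
qed

sublocale coalg K C by (unfold_locales) (rule cocommutative)

end

text \<open>A linear map to $\mathbb{K}[X]$ is the family of its coordinate functionals. As the functionals
  $x^* \otimes y^*$ separate the tensors and vanish on the comultiple of \<open>c\<close> unless $x = y$, the map is
  comultiplicative exactly if the coordinates are orthogonal idempotents for convolution. It
  preserves the counit exactly if the coordinates sum to the counit.\<close>

lemma (in grouplike_coalg) hom_iff:
  assumes D: "coalg K D" and h: "h \<in> linear_maps K D C"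
  defines "H \<equiv> \<lambda>x. \<lambda>d\<in>carrier D. coord_form K X C \<iota> x (h d)"
  shows "coalgebra_hom K D C h \<longleftrightarrow>
     (\<forall>x\<in>X. \<forall>y\<in>X. conv K D (H x) (H y) = (if x = y then H x else coalg.zero_form K D)) \<and>
     (\<forall>d\<in>carrier D. has_fsum K X (\<lambda>x. H x d) (counit D d))"
proof -
  interpret D: coalg K D by fact
  note m = module_C and mD = D.module_C
  note hs = linear_map_is_linear[OF h]
  note hc = linear_map_closed[OF h]
  have Hd: "H x \<in> dual K D" for x
    unfolding H_def by (rule dual_compose[OF mD hs coord_form_dual])
  have HH: "H x d = coord K X \<iota> (h d) x" if "d \<in> carrier D" for x d
    using that hc by (simp add: H_def coord_form_def)
  have Ha: "H x d = coord_form K X C \<iota> x (h d)" if "d \<in> carrier D" for x d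
    using that by (simp add: H_def)
  note th = tensor_map_linear[OF mD mD m m hs hs]
  have pull: "tensor_form K C C (coord_form K X C \<iota> x) (coord_form K X C \<iota> y) (tensor_map K D D C C h h t) = tensor_form K D D (H x) (H y) t"
    if t: "t \<in> carrier (tensor K D D)" for x y t
  proof -
    have "(\<lambda>t\<in>carrier (tensor K D D). tensor_form K C C (coord_form K X C \<iota> x) (coord_form K X C \<iota> y) (tensor_map K D D C C h h t))
      = tensor_form K D D (H x) (H y)"
      by (rule tensor_dual_eq[OF mD mD dual_compose[OF D.CC_module linear_map_is_linear[OF th] tensor_form_linear[OF m m coord_form_dual coord_form_dual]]
          tensor_form_linear[OF mD mD Hd Hd]])
         (simp add: tens_closed[OF mD mD] tensor_map_tens[OF mD mD m m hs hs] tensor_form_tens[OF m m coord_form_dual coord_form_dual]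
            tensor_form_tens[OF mD mD Hd Hd] hc Ha)
    from fun_cong[OF this, of t] show ?thesis using t by simp
  qed
  have diag: "tensor_form K C C (coord_form K X C \<iota> x) (coord_form K X C \<iota> y) (comult C c) = (if x = y then coord K X \<iota> c x else \<zero>\<^bsub>K\<^esub>)"
    if xy: "x \<in> X" "y \<in> X" and c: "c \<in> carrier C" for x y c
  proof (rule is_linear_eq[OF ground_K _ _ _ c])
    show "is_linear K C (ground_module K) (\<lambda>c. tensor_form K C C (coord_form K X C \<iota> x) (coord_form K X C \<iota> y) (comult C c))"
      by (rule is_linear_compose[OF linear_map_is_linear[OF comult_linear]
        linear_map_is_linear[OF tensor_form_linear[OF m m coord_form_dual coord_form_dual, unfolded dual_def]]])
    show "is_linear K C (ground_module K) (\<lambda>c. if x = y then coord K X \<iota> c x else \<zero>\<^bsub>K\<^esub>)"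
      using coord_is_linear coord_apply_closed unfolding is_linear_def by auto
    show "tensor_form K C C (coord_form K X C \<iota> x) (coord_form K X C \<iota> y) (comult C (b z)) = (if x = y then coord K X \<iota> (b z) x else \<zero>\<^bsub>K\<^esub>)"
      if "z \<in> X" for z
      using that xy by (simp add: comult_basis tensor_form_tens[OF m m coord_form_dual coord_form_dual] b_closed coord_form_basis coord_basis)
        (auto simp: basis_vec_def)
  qed
  have conv_eq: "conv K D (H x) (H y) = (if x = y then H x else D.zero_form) \<longleftrightarrow>
      (\<forall>d\<in>carrier D. tensor_form K C C (coord_form K X C \<iota> x) (coord_form K X C \<iota> y) (tensor_map K D D C C h h (comult D d))
         = tensor_form K C C (coord_form K X C \<iota> x) (coord_form K X C \<iota> y) (comult C (h d)))" if xy: "x \<in> X" "y \<in> X" for x y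
  proof -
    have "conv K D (H x) (H y) = (if x = y then H x else D.zero_form) \<longleftrightarrow>
       (\<forall>d\<in>carrier D. conv K D (H x) (H y) d = (if x = y then H x else D.zero_form) d)"
      using D.dual_eqI[OF D.conv_closed[OF Hd Hd], of "if x = y then H x else D.zero_form"] Hd D.zero_form_dual by auto
    also have "\<dots> \<longleftrightarrow> (\<forall>d\<in>carrier D. tensor_form K C C (coord_form K X C \<iota> x) (coord_form K X C \<iota> y) (tensor_map K D D C C h h (comult D d))
         = tensor_form K C C (coord_form K X C \<iota> x) (coord_form K X C \<iota> y) (comult C (h d)))"
      by (intro ball_cong refl) (simp add: D.conv_apply pull D.comult_closed diag[OF xy hc] HH D.zero_form_def)
    finally show ?thesis .
  qed
  have counit_eq: "has_fsum K X (\<lambda>x. H x d) (counit D d) \<longleftrightarrow> counit C (h d) = counit D d" if d: "d \<in> carrier D" for d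
  proof -
    have "has_fsum K X (\<lambda>x. H x d) (counit C (h d))"
      using counit_sum[OF hc[OF d]] HH[OF d] by simp
    then show ?thesis using C.R.has_fsum_unique by metis
  qed
  have comult_eq: "(\<forall>x\<in>X. \<forall>y\<in>X. tensor_form K C C (coord_form K X C \<iota> x) (coord_form K X C \<iota> y) (tensor_map K D D C C h h (comult D d))
         = tensor_form K C C (coord_form K X C \<iota> x) (coord_form K X C \<iota> y) (comult C (h d)))
     \<longleftrightarrow> tensor_map K D D C C h h (comult D d) = comult C (h d)" if d: "d \<in> carrier D" for d
    using tensor_eq_if_coord_form_eq[OF linear_map_closed[OF th D.comult_closed[OF d]] comult_closed[OF hc[OF d]]] by metis
  let ?E = "\<lambda>x y d. tensor_form K C C (coord_form K X C \<iota> x) (coord_form K X C \<iota> y) (tensor_map K D D C C h h (comult D d))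
         = tensor_form K C C (coord_form K X C \<iota> x) (coord_form K X C \<iota> y) (comult C (h d))"
  have "(\<forall>x\<in>X. \<forall>y\<in>X. conv K D (H x) (H y) = (if x = y then H x else D.zero_form))
      \<longleftrightarrow> (\<forall>x\<in>X. \<forall>y\<in>X. \<forall>d\<in>carrier D. ?E x y d)"
    by (intro ball_cong refl conv_eq)
  also have "\<dots> \<longleftrightarrow> (\<forall>d\<in>carrier D. \<forall>x\<in>X. \<forall>y\<in>X. ?E x y d)" by blast
  also have "\<dots> \<longleftrightarrow> (\<forall>d\<in>carrier D. tensor_map K D D C C h h (comult D d) = comult C (h d))"
    by (intro ball_cong refl comult_eq)
  finally have 1: "(\<forall>x\<in>X. \<forall>y\<in>X. conv K D (H x) (H y) = (if x = y then H x else D.zero_form)) \<longleftrightarrow>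
    (\<forall>d\<in>carrier D. tensor_map K D D C C h h (comult D d) = comult C (h d))" .
  have 2: "(\<forall>d\<in>carrier D. has_fsum K X (\<lambda>x. H x d) (counit D d)) \<longleftrightarrow> (\<forall>d\<in>carrier D. counit C (h d) = counit D d)"
    by (intro ball_cong refl counit_eq)
  show ?thesis
    unfolding coalgebra_hom_def 1 2 using h by blast
qed

section \<open>Products of grouplike coalgebras\<close>

text \<open>The families of functionals that \<open>hom_iff\<close> identifies with the coalgebra maps $D \to \mathbb{K}[X]$.\<close>

definition idem_family where
  "idem_family K D X F \<longleftrightarrow> (\<forall>x\<in>X. F x \<in> dual K D) \<and>
     (\<forall>x\<in>X. \<forall>y\<in>X. conv K D (F x) (F y) = (if x = y then F x else coalg.zero_form K D)) \<and>
     (\<forall>d\<in>carrier D. has_fsum K X (\<lambda>x. F x d) (counit D d))"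

lemma idem_familyD:
  assumes "idem_family K D X F"
  shows "x \<in> X \<Longrightarrow> F x \<in> dual K D"
    and "x \<in> X \<Longrightarrow> y \<in> X \<Longrightarrow> conv K D (F x) (F y) = (if x = y then F x else coalg.zero_form K D)"
    and "d \<in> carrier D \<Longrightarrow> has_fsum K X (\<lambda>x. F x d) (counit D d)"
  using assms unfolding idem_family_def by blast+

context grouplike_coalg
begin

lemma hom_idem_family:
  assumes D: "coalg K D" and h: "coalgebra_hom K D C h"
  shows "idem_family K D X (\<lambda>x. \<lambda>d\<in>carrier D. coord_form K X C \<iota> x (h d))"
proof -
  have hl: "h \<in> linear_maps K D C" using h unfolding coalgebra_hom_def by blast
  show ?thesis
    unfolding idem_family_def
    using hom_iff[OF D hl] h dual_compose[OF coalg.module_C[OF D] linear_map_is_linear[OF hl] coord_form_dual] by blast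
qed

lemma idem_family_hom:
  assumes D: "coalg K D" and F: "idem_family K D X F"
  shows "\<exists>h. coalgebra_hom K D C h \<and> (\<forall>x\<in>X. \<forall>d\<in>carrier D. coord_form K X C \<iota> x (h d) = F x d)"
proof -
  interpret D: coalg K D by fact
  let ?v = "\<lambda>d x. if x \<in> X then F x d else \<zero>\<^bsub>K\<^esub>"
  have v: "?v d \<in> carrier (free_module K X)" if d: "d \<in> carrier D" for d
  proof -
    obtain A where A: "finite A" "\<And>x. x \<in> X - A \<Longrightarrow> F x d = \<zero>\<^bsub>K\<^esub>"
      using idem_familyD(3)[OF F d] unfolding has_fsum_def by blast
    have "{x. ?v d x \<noteq> \<zero>\<^bsub>K\<^esub>} \<subseteq> A" using A(2) by auto
    then have "finite {x. ?v d x \<noteq> \<zero>\<^bsub>K\<^esub>}" using A(1) by (rule finite_subset)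
    then show ?thesis
      unfolding free_module_carrier using dual_closed[OF D.module_C idem_familyD(1)[OF F] d] by auto
  qed
  have vs: "is_linear K D (free_module K X) ?v"
    unfolding is_linear_def
  proof (intro conjI ballI)
    show "?v \<in> carrier D \<rightarrow> carrier (free_module K X)" using v by blast
  next
    fix d d' assume "d \<in> carrier D" "d' \<in> carrier D"
    then show "?v (d \<oplus>\<^bsub>D\<^esub> d') = ?v d \<oplus>\<^bsub>free_module K X\<^esub> ?v d'"
      using dual_add[OF D.module_C idem_familyD(1)[OF F]] by auto
  next
    fix r d assume "r \<in> carrier K" "d \<in> carrier D"
    then show "?v (r \<odot>\<^bsub>D\<^esub> d) = r \<odot>\<^bsub>free_module K X\<^esub> ?v d"
      using linear_map_smult[OF idem_familyD(1)[OF F, unfolded dual_def]] by auto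
  qed
  define h where "h = (\<lambda>d\<in>carrier D. \<iota> (?v d))"
  have hl: "h \<in> linear_maps K D C"
    unfolding h_def
    by (rule restrict_linear_mapsI[OF D.module_C])
      (use is_linear_compose[OF vs iso_is_linear] in \<open>simp_all only: is_linear_def Pi_iff\<close>)
  have hc: "coord_form K X C \<iota> x (h d) = F x d" if "x \<in> X" "d \<in> carrier D" for x d
    unfolding coord_form_def h_def using that v is_linear_closed[OF iso_is_linear] by (simp add: coord_iso)
  have FH: "(\<lambda>d\<in>carrier D. coord_form K X C \<iota> x (h d)) = F x" if "x \<in> X" for x
    by (rule D.dual_eqI[OF dual_compose[OF D.module_C linear_map_is_linear[OF hl] coord_form_dual] idem_familyD(1)[OF F that]])
       (simp add: hc that)
  have "coalgebra_hom K D C h"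
    unfolding hom_iff[OF D hl]
    using F C.R.has_fsum_cong[of X] by (auto simp: FH hc idem_family_def)
  then show ?thesis using hc by blast
qed

end

context coalg
begin

lemma finprod_family_closed:
  assumes "\<And>i. i < (n::nat) \<Longrightarrow> idem_family K C (X i) (F i)" "\<And>i. i < n \<Longrightarrow> s i \<in> X i"
  shows "finprod (dual_monoid K C) (\<lambda>i. F i (s i)) {..<n} \<in> dual K C"
proof -
  interpret M: comm_monoid "dual_monoid K C" by (rule dual_comm_monoid)
  have "finprod (dual_monoid K C) (\<lambda>i. F i (s i)) {..<n} \<in> carrier (dual_monoid K C)"
    by (rule M.finprod_closed) (use idem_familyD(1)[OF assms] in \<open>auto simp: dual_monoid_simps\<close>)
  then show ?thesis by (simp add: dual_monoid_simps)
qed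

lemma finprod_family_Suc:
  assumes "\<And>i. i < Suc n \<Longrightarrow> idem_family K C (X i) (F i)" "\<And>i. i < Suc n \<Longrightarrow> s i \<in> X i"
  shows "finprod (dual_monoid K C) (\<lambda>i. F i (s i)) {..<Suc n}
    = conv K C (finprod (dual_monoid K C) (\<lambda>i. F i (s i)) {..<n}) (F n (s n))"
proof -
  interpret M: comm_monoid "dual_monoid K C" by (rule dual_comm_monoid)
  have c: "F i (s i) \<in> carrier (dual_monoid K C)" if "i < Suc n" for i
    using idem_familyD(1)[OF assms(1)[OF that] assms(2)[OF that]] by (simp add: dual_monoid_simps)
  have "finprod (dual_monoid K C) (\<lambda>i. F i (s i)) (insert n {..<n})
     = F n (s n) \<otimes>\<^bsub>dual_monoid K C\<^esub> finprod (dual_monoid K C) (\<lambda>i. F i (s i)) {..<n}"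
    by (rule M.finprod_insert) (use c in auto)
  also have "\<dots> = finprod (dual_monoid K C) (\<lambda>i. F i (s i)) {..<n} \<otimes>\<^bsub>dual_monoid K C\<^esub> F n (s n)"
    by (rule M.m_comm) (use c in \<open>auto intro!: M.finprod_closed\<close>)
  finally show ?thesis by (simp add: dual_monoid_simps lessThan_Suc)
qed

text \<open>The distributive law $1 = \prod_i \sum_x F_i(x) = \sum_s \prod_i F_i(s_i)$, proved by induction on the
  number of factors by splitting off the last component of \<open>s\<close>.\<close>

lemma finprod_family_sum:
  fixes n :: nat
  assumes "\<And>i. i < n \<Longrightarrow> idem_family K C (X i) (F i)" and c: "c \<in> carrier C"
  shows "has_fsum K (PiE {..<n} X) (\<lambda>s. finprod (dual_monoid K C) (\<lambda>i. F i (s i)) {..<n} c) (counit C c)"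
  using assms(1) c
proof (induction n arbitrary: c)
  case 0
  interpret M: comm_monoid "dual_monoid K C" by (rule dual_comm_monoid)
  have "counit C c \<in> carrier K" using dual_closed[OF module_C counit_dual 0(2)] .
  then show ?case
    using C.R.has_fsum_single[of "\<lambda>_. undefined" "{\<lambda>_. undefined}" "\<lambda>s. counit C c"]
    by (simp add: dual_monoid_simps)
next
  case (Suc n)
  let ?g = "\<lambda>s. finprod (dual_monoid K C) (\<lambda>i. F i (s i)) {..<n}"
  let ?\<beta> = "\<lambda>s. (restrict s {..<n}, s n)"
  have bij: "bij_betw ?\<beta> (PiE {..<Suc n} X) (PiE {..<n} X \<times> X n)"
  proof (rule bij_betw_byWitness[where f' = "\<lambda>(s, x). s(n := x)"])
    have "((restrict s {..<n})(n := s n)) i = s i" if "s \<in> PiE {..<Suc n} X" for s i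
      using PiE_arb[OF that, of i] by (cases "i < n"; cases "i = n") simp_all
    then show "\<forall>s\<in>PiE {..<Suc n} X. (\<lambda>(s, x). s(n := x)) (?\<beta> s) = s"
      by (simp only: prod.case) blast
    have "restrict (s(n := x)) {..<n} i = s i" if "s \<in> PiE {..<n} X" for s x i
      using PiE_arb[OF that, of i] by (cases "i < n") simp_all
    then show "\<forall>p\<in>PiE {..<n} X \<times> X n. ?\<beta> ((\<lambda>(s, x). s(n := x)) p) = p"
      by (simp add: fun_eq_iff)
    show "?\<beta> ` PiE {..<Suc n} X \<subseteq> PiE {..<n} X \<times> X n"
      by (rule image_subsetI) (simp add: PiE_iff)
    show "(\<lambda>(s, x). s(n := x)) ` (PiE {..<n} X \<times> X n) \<subseteq> PiE {..<Suc n} X"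
      by (rule image_subsetI) (clarsimp simp: PiE_iff extensional_def less_Suc_eq)
  qed
  have 1: "has_fsum K (PiE {..<n} X \<times> X n) (\<lambda>(s, x). conv K C (?g s) (F n x) c) (conv K C (counit C) (counit C) c)"
  proof (rule has_fsum_conv[OF _ counit_dual _ counit_dual])
    show "?g s \<in> dual K C" if "s \<in> PiE {..<n} X" for s
      by (rule finprod_family_closed[of n X]) (use Suc.prems that in auto)
    show "F n x \<in> dual K C" if "x \<in> X n" for x using idem_familyD(1)[OF Suc.prems(1) that] by simp
    show "has_fsum K (X n) (\<lambda>y. F n y w) (counit C w)" if "w \<in> carrier C" for w
      using idem_familyD(3)[OF Suc.prems(1) that] by simp
    show "has_fsum K (PiE {..<n} X) (\<lambda>x. ?g x v) (counit C v)" if "v \<in> carrier C" for v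
      using Suc.IH Suc.prems(1) that by simp
  qed (rule Suc.prems)
  have "has_fsum K (PiE {..<Suc n} X) (\<lambda>s. conv K C (?g (restrict s {..<n})) (F n (s n)) c) (counit C c)"
    using C.R.has_fsum_reindex[OF bij 1] by (simp add: conv_counit_left[OF counit_dual])
  then show ?case
  proof (rule C.R.has_fsum_cong)
    fix s assume s: "s \<in> PiE {..<Suc n} X"
    interpret M: comm_monoid "dual_monoid K C" by (rule dual_comm_monoid)
    have sX: "s i \<in> X i" if "i < Suc n" for i using s that by auto
    have "?g (restrict s {..<n}) = ?g s"
      by (rule M.finprod_cong') (use idem_familyD(1)[OF Suc.prems(1) sX] in \<open>auto simp: dual_monoid_simps\<close>)
    then show "conv K C (?g (restrict s {..<n})) (F n (s n)) c = finprod (dual_monoid K C) (\<lambda>i. F i (s i)) {..<Suc n} c"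
      using finprod_family_Suc[of n X F s] Suc.prems(1) sX by simp
  qed
qed

text \<open>If \<open>s\<close> and \<open>t\<close> differ at one index, then the factor at this index is zero.\<close>

lemma finprod_family_mult:
  fixes n :: nat
  assumes F: "\<And>i. i < n \<Longrightarrow> idem_family K C (X i) (F i)" and s: "\<And>i. i < n \<Longrightarrow> s i \<in> X i" 
    and t: "\<And>i. i < n \<Longrightarrow> t i \<in> X i"
  shows "conv K C (finprod (dual_monoid K C) (\<lambda>i. F i (s i)) {..<n}) (finprod (dual_monoid K C) (\<lambda>i. F i (t i)) {..<n})
    = (if \<forall>i<n. s i = t i then finprod (dual_monoid K C) (\<lambda>i. F i (s i)) {..<n} else zero_form)"
proof -
  interpret M: comm_monoid "dual_monoid K C" by (rule dual_comm_monoid)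
  have sc: "F i (s i) \<in> dual K C" and tc: "F i (t i) \<in> dual K C" if "i < n" for i
    using idem_familyD(1)[OF F s] idem_familyD(1)[OF F t] that by auto
  have "conv K C (finprod (dual_monoid K C) (\<lambda>i. F i (s i)) {..<n}) (finprod (dual_monoid K C) (\<lambda>i. F i (t i)) {..<n})
     = finprod (dual_monoid K C) (\<lambda>i. conv K C (F i (s i)) (F i (t i))) {..<n}"
    using M.finprod_multf[of "\<lambda>i. F i (s i)" "{..<n}" "\<lambda>i. F i (t i)"] sc tc by (simp add: dual_monoid_simps Pi_def)
  also have "\<dots> = finprod (dual_monoid K C) (\<lambda>i. if s i = t i then F i (s i) else zero_form) {..<n}"
    by (rule M.finprod_cong') (use idem_familyD(2)[OF F s t] sc tc zero_form_dual in \<open>auto simp: dual_monoid_simps\<close>)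
  also have "\<dots> = (if \<forall>i<n. s i = t i then finprod (dual_monoid K C) (\<lambda>i. F i (s i)) {..<n} else zero_form)"
  proof (cases "\<forall>i<n. s i = t i")
    case True
    have "finprod (dual_monoid K C) (\<lambda>i. if s i = t i then F i (s i) else zero_form) {..<n}
       = finprod (dual_monoid K C) (\<lambda>i. F i (s i)) {..<n}"
      by (rule M.finprod_cong') (use True sc in \<open>auto simp: dual_monoid_simps\<close>)
    then show ?thesis using True by simp
  next
    case False
    then obtain j where j: "j < n" "s j \<noteq> t j" by blast
    let ?f = "\<lambda>i. if s i = t i then F i (s i) else zero_form"
    have fc: "?f i \<in> carrier (dual_monoid K C)" if "i < n" for i
      using sc[OF that] tc[OF that] zero_form_dual by (simp add: dual_monoid_simps)
    have "{..<n} = insert j ({..<n} - {j})" using j by auto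
    then have "finprod (dual_monoid K C) ?f {..<n} = finprod (dual_monoid K C) ?f (insert j ({..<n} - {j}))" by simp
    also have "\<dots> = ?f j \<otimes>\<^bsub>dual_monoid K C\<^esub> finprod (dual_monoid K C) ?f ({..<n} - {j})"
      by (rule M.finprod_insert) (use fc zero_form_dual j in \<open>auto simp: dual_monoid_simps\<close>)
    also have "\<dots> = zero_form"
    proof -
      have "finprod (dual_monoid K C) ?f ({..<n} - {j}) \<in> carrier (dual_monoid K C)"
        by (rule M.finprod_closed) (use fc in auto)
      then show ?thesis using conv_zero_left j by (simp add: dual_monoid_simps)
    qed
    finally show ?thesis unfolding if_not_P[OF False] .
  qed
  finally show ?thesis .
qed

text \<open>Multiplication by \<open>F j x\<close> affects the factor at \<open>j\<close> only.\<close>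

lemma finprod_family_absorb:
  fixes n :: nat
  assumes F: "\<And>i. i < n \<Longrightarrow> idem_family K C (X i) (F i)" and s: "\<And>i. i < n \<Longrightarrow> s i \<in> X i"
    and j: "j < n" and x: "x \<in> X j"
  shows "conv K C (finprod (dual_monoid K C) (\<lambda>i. F i (s i)) {..<n}) (F j x)
    = (if s j = x then finprod (dual_monoid K C) (\<lambda>i. F i (s i)) {..<n} else zero_form)"
proof -
  interpret M: comm_monoid "dual_monoid K C" by (rule dual_comm_monoid)
  have sc: "F i (s i) \<in> dual K C" if "i < n" for i
    using idem_familyD(1)[OF F s] that by auto
  let ?R = "finprod (dual_monoid K C) (\<lambda>i. F i (s i)) ({..<n} - {j})"
  have R: "?R \<in> dual K C"
    using M.finprod_closed[of "\<lambda>i. F i (s i)" "{..<n} - {j}"] sc by (auto simp: dual_monoid_simps)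
  have "{..<n} = insert j ({..<n} - {j})" using j by auto
  then have "finprod (dual_monoid K C) (\<lambda>i. F i (s i)) {..<n}
      = finprod (dual_monoid K C) (\<lambda>i. F i (s i)) (insert j ({..<n} - {j}))" by simp
  also have "\<dots> = F j (s j) \<otimes>\<^bsub>dual_monoid K C\<^esub> ?R"
    by (rule M.finprod_insert) (use sc j in \<open>auto simp: dual_monoid_simps\<close>)
  finally have G: "finprod (dual_monoid K C) (\<lambda>i. F i (s i)) {..<n} = conv K C ?R (F j (s j))"
    using conv_comm[OF sc[OF j] R] by (simp add: dual_monoid_simps)
  have Fx: "F j x \<in> dual K C" using idem_familyD(1)[OF F[OF j] x] .
  have "conv K C (conv K C ?R (F j (s j))) (F j x) = conv K C ?R (if s j = x then F j (s j) else zero_form)"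
    using conv_assoc[OF R sc[OF j] Fx] idem_familyD(2)[OF F[OF j] s[OF j] x] by simp
  also have "\<dots> = (if s j = x then conv K C ?R (F j (s j)) else zero_form)"
    using conv_comm[OF R zero_form_dual] conv_zero_left[OF R] by simp
  finally show ?thesis unfolding G .
qed

text \<open>Families over the factors of a product of sets multiply to a family over the product. This gives the
  map into the product of coalgebras.\<close>

lemma finprod_idem_family:
  fixes n :: nat
  assumes F: "\<And>i. i < n \<Longrightarrow> idem_family K C (X i) (F i)"
    and bij: "bij_betw (\<lambda>q. \<lambda>i\<in>{..<n}. p i q) P (PiE {..<n} X)"
  shows "idem_family K C P (\<lambda>q. finprod (dual_monoid K C) (\<lambda>i. F i (p i q)) {..<n})"
proof -
  interpret M: comm_monoid "dual_monoid K C" by (rule dual_comm_monoid)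
  have pX: "p i q \<in> X i" if "i < n" "q \<in> P" for i q
    using bij_betwE[OF bij] that by (metis PiE_mem lessThan_iff restrict_apply')
  have inj: "q = q'" if "q \<in> P" "q' \<in> P" "\<forall>i<n. p i q = p i q'" for q q'
  proof -
    have "(\<lambda>i\<in>{..<n}. p i q) = (\<lambda>i\<in>{..<n}. p i q')" using that(3) by (auto intro: restrict_ext)
    then show ?thesis using bij that(1,2) unfolding bij_betw_def inj_on_def by blast
  qed
  show ?thesis unfolding idem_family_def
  proof (intro conjI ballI)
    fix q assume q: "q \<in> P"
    show "finprod (dual_monoid K C) (\<lambda>i. F i (p i q)) {..<n} \<in> dual K C"
      by (rule finprod_family_closed[OF F]) (use pX q in auto)
    fix q' assume q': "q' \<in> P"
    show "conv K C (finprod (dual_monoid K C) (\<lambda>i. F i (p i q)) {..<n}) (finprod (dual_monoid K C) (\<lambda>i. F i (p i q')) {..<n})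
      = (if q = q' then finprod (dual_monoid K C) (\<lambda>i. F i (p i q)) {..<n} else zero_form)"
      using finprod_family_mult[of n X F "\<lambda>i. p i q" "\<lambda>i. p i q'"] F pX q q' inj by (metis (no_types, lifting))
  next
    fix c assume c: "c \<in> carrier C"
    have "finprod (dual_monoid K C) (\<lambda>i. F i ((\<lambda>i\<in>{..<n}. p i q) i)) {..<n} = finprod (dual_monoid K C) (\<lambda>i. F i (p i q)) {..<n}"
      if q: "q \<in> P" for q
      by (rule M.finprod_cong') (use idem_familyD(1)[OF F pX] q in \<open>auto simp: dual_monoid_simps\<close>)
    then show "has_fsum K P (\<lambda>q. finprod (dual_monoid K C) (\<lambda>i. F i (p i q)) {..<n} c) (counit C c)"
      using C.R.has_fsum_cong[OF C.R.has_fsum_reindex[OF bij finprod_family_sum[OF F c]]] by simp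
  qed
qed

text \<open>The marginal at \<open>x\<close> is the sum of the \<open>H q'\<close> with \<open>p q' = x\<close>, and orthogonality leaves at most the
  term \<open>q' = q\<close> after multiplication by \<open>H q\<close>.\<close>

lemma marginals_absorb:
  assumes H: "idem_family K C P H" and Fx: "Fx \<in> dual K C"
    and marg: "\<And>c. c \<in> carrier C \<Longrightarrow> has_fsum K P (\<lambda>q. if p q = x then H q c else \<zero>\<^bsub>K\<^esub>) (Fx c)"
    and q: "q \<in> P"
  shows "conv K C Fx (H q) = (if p q = x then H q else zero_form)"
proof (rule dual_eqI)
  note Hd = idem_familyD(1)[OF H]
  show "conv K C Fx (H q) \<in> dual K C" using conv_closed Fx Hd q by blast
  show "(if p q = x then H q else zero_form) \<in> dual K C" using Hd q zero_form_dual by simp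
  fix c assume c: "c \<in> carrier C"
  let ?f = "\<lambda>q'. if p q' = x then H q' else zero_form"
  have sum: "has_fsum K P (\<lambda>q'. conv K C (?f q') (H q) c) (conv K C Fx (H q) c)"
  proof (rule has_fsum_conv_left[OF _ Fx Hd[OF q] _ c])
    show "?f q' \<in> dual K C" if "q' \<in> P" for q' using Hd that zero_form_dual by simp
    show "has_fsum K P (\<lambda>x. ?f x v) (Fx v)" if "v \<in> carrier C" for v
      by (rule C.R.has_fsum_cong[OF marg[OF that]]) (simp add: zero_form_def that)
  qed
  have eq: "conv K C (?f q') (H q) c = (if q' = q then ?f q c else \<zero>\<^bsub>K\<^esub>)" if "q' \<in> P" for q'
    using idem_familyD(2)[OF H that q] idem_familyD(2)[OF H q q] conv_zero_left[OF Hd[OF q]] c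
    by (cases "q' = q") (simp_all add: zero_form_def)
  have 1: "has_fsum K P (\<lambda>q'. if q' = q then ?f q c else \<zero>\<^bsub>K\<^esub>) (conv K C Fx (H q) c)"
    by (rule C.R.has_fsum_cong[OF sum eq])
  have fq: "?f q c \<in> carrier K"
    using dual_closed[OF module_C Hd[OF q] c] dual_closed[OF module_C zero_form_dual c] by simp
  have "has_fsum K P (\<lambda>q'. if q' = q then ?f q c else \<zero>\<^bsub>K\<^esub>) (?f q c)"
    using C.R.has_fsum_single[of q P "\<lambda>q'. if q' = q then ?f q c else \<zero>\<^bsub>K\<^esub>"] q fq by simp
  from C.R.has_fsum_unique[OF 1 this] show "conv K C Fx (H q) c = ?f q c" .
qed

text \<open>The product \<open>G\<close> of the marginals at \<open>q\<close> satisfies \<open>G * H q = H q\<close> and \<open>G * H q' = 0\<close> for all other \<open>q'\<close>.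
  Summing over \<open>q'\<close>, where the \<open>H q'\<close> sum to the unit, gives \<open>G = H q\<close>. This is the uniqueness of
  the map into the product of coalgebras.\<close>

lemma family_eq_finprod_marginals:
  fixes n :: nat
  assumes H: "idem_family K C P H" and F: "\<And>i. i < n \<Longrightarrow> idem_family K C (X i) (F i)"
    and bij: "bij_betw (\<lambda>q. \<lambda>i\<in>{..<n}. p i q) P (PiE {..<n} X)"
    and marg: "\<And>i x c. i < n \<Longrightarrow> x \<in> X i \<Longrightarrow> c \<in> carrier C \<Longrightarrow>
        has_fsum K P (\<lambda>q. if p i q = x then H q c else \<zero>\<^bsub>K\<^esub>) (F i x c)"
    and q: "q \<in> P"
  shows "H q = finprod (dual_monoid K C) (\<lambda>i. F i (p i q)) {..<n}"
proof (rule dual_eqI)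
  interpret M: comm_monoid "dual_monoid K C" by (rule dual_comm_monoid)
  note Hd = idem_familyD(1)[OF H]
  have pX: "p i q \<in> X i" if "i < n" "q \<in> P" for i q
    using bij_betwE[OF bij] that by (metis PiE_mem lessThan_iff restrict_apply')
  have inj: "q = q'" if "q \<in> P" "q' \<in> P" "\<forall>i<n. p i q = p i q'" for q q'
  proof -
    have "(\<lambda>i\<in>{..<n}. p i q) = (\<lambda>i\<in>{..<n}. p i q')" using that(3) by (auto intro: restrict_ext)
    then show ?thesis using bij that(1,2) unfolding bij_betw_def inj_on_def by blast
  qed
  let ?G = "\<lambda>m. finprod (dual_monoid K C) (\<lambda>i. F i (p i q)) {..<m}"
  have Gd: "?G m \<in> dual K C" if "m \<le> n" for m
    by (rule finprod_family_closed[of m X]) (use F pX q that in auto)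
  show "H q \<in> dual K C" "?G n \<in> dual K C" using Hd[OF q] Gd by auto
  have ab: "conv K C (?G m) (H q') = (if \<forall>i<m. p i q' = p i q then H q' else zero_form)"
    if "m \<le> n" and q': "q' \<in> P" for m q'
    using that(1)
  proof (induction m)
    case 0
    then show ?case using conv_counit_left[OF Hd[OF q']] by (simp add: dual_monoid_simps)
  next
    case (Suc m)
    then have m: "m < n" by simp
    have Fm: "F m (p m q) \<in> dual K C" using idem_familyD(1)[OF F[OF m] pX[OF m q]] .
    have "?G (Suc m) = conv K C (?G m) (F m (p m q))"
      by (rule finprod_family_Suc[of m X]) (use F pX q Suc.prems in auto)
    then have "conv K C (?G (Suc m)) (H q') = conv K C (?G m) (conv K C (F m (p m q)) (H q'))"
      using conv_assoc[OF Gd Fm Hd[OF q'], of m] m by simp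
    also have "conv K C (F m (p m q)) (H q') = (if p m q' = p m q then H q' else zero_form)"
      by (rule marginals_absorb[OF H Fm marg[OF m pX[OF m q]] q'])
    also have "conv K C (?G m) \<dots> = (if p m q' = p m q then (if \<forall>i<m. p i q' = p i q then H q' else zero_form) else zero_form)"
      using Suc conv_comm[OF Gd zero_form_dual, of m] conv_zero_left[OF Gd, of m] by simp
    also have "\<dots> = (if \<forall>i<Suc m. p i q' = p i q then H q' else zero_form)" by (auto simp: less_Suc_eq)
    finally show ?case .
  qed
  fix c assume c: "c \<in> carrier C"
  have sum: "has_fsum K P (\<lambda>q'. conv K C (H q') (?G n) c) (conv K C (counit C) (?G n) c)"
    by (rule has_fsum_conv_left[OF Hd counit_dual Gd idem_familyD(3)[OF H] c]) auto
  have eq: "conv K C (H q') (?G n) c = (if q' = q then H q c else \<zero>\<^bsub>K\<^esub>)" if "q' \<in> P" for q'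
    using ab[OF _ that, of n] conv_comm[OF Hd[OF that] Gd, of n] inj[OF that q] c by (auto simp: zero_form_def)
  have 1: "has_fsum K P (\<lambda>q'. if q' = q then H q c else \<zero>\<^bsub>K\<^esub>) (?G n c)"
    using C.R.has_fsum_cong[OF sum eq] conv_counit_left[OF Gd, of n] by simp
  have "has_fsum K P (\<lambda>q'. if q' = q then H q c else \<zero>\<^bsub>K\<^esub>) (H q c)"
    using C.R.has_fsum_single[of q P "\<lambda>q'. if q' = q then H q c else \<zero>\<^bsub>K\<^esub>"] q dual_closed[OF module_C Hd[OF q] c] by simp
  from C.R.has_fsum_unique[OF this 1] show "H q c = ?G n c" .
qed

end

section \<open>The category of cocommutative coalgebras\<close>

lemma coalgebra_hom_linear: "coalgebra_hom K C D f \<Longrightarrow> f \<in> linear_maps K C D"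
  unfolding coalgebra_hom_def by blast

lemma coalgebra_hom_id:
  assumes C: "coalg K C" shows "coalgebra_hom K C C (\<lambda>x\<in>carrier C. x)"
proof -
  interpret coalg K C by fact
  note m = module_C
  have "tensor_map K C C C C (\<lambda>x\<in>carrier C. x) (\<lambda>x\<in>carrier C. x) = tensor_map K C C C C (\<lambda>x. x) (\<lambda>x. x)"
    by (rule tensor_map_cong[OF m m m m linear_map_is_linear[OF linear_map_id[OF m]] linear_map_is_linear[OF linear_map_id[OF m]]]) auto
  then show ?thesis
    unfolding coalgebra_hom_def
    by (simp add: linear_map_id[OF m] tensor_map_id[OF m m comult_closed])
qed

lemma coalgebra_hom_comp:
  assumes C: "coalg K C" and D: "coalg K D" and E: "coalg K E"
    and f: "coalgebra_hom K C D f" and g: "coalgebra_hom K D E g"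
  shows "coalgebra_hom K C E (compose (carrier C) g f)"
proof -
  interpret C: coalg K C by fact
  note mC = coalg.module_C[OF C] and mD = coalg.module_C[OF D] and mE = coalg.module_C[OF E]
  note fl = coalgebra_hom_linear[OF f] and gl = coalgebra_hom_linear[OF g]
  note fs = linear_map_is_linear[OF fl] and gs = linear_map_is_linear[OF gl]
  note cl = linear_map_comp[OF mC fl gl]
  have "tensor_map K C C E E (compose (carrier C) g f) (compose (carrier C) g f)
      = tensor_map K C C E E (\<lambda>x. g (f x)) (\<lambda>x. g (f x))"
    by (rule tensor_map_cong[OF mC mC mE mE linear_map_is_linear[OF cl] linear_map_is_linear[OF cl]])
       (auto simp: compose_def)
  then have "tensor_map K C C E E (compose (carrier C) g f) (compose (carrier C) g f) t
      = tensor_map K D D E E g g (tensor_map K C C D D f f t)" if "t \<in> carrier (tensor K C C)" for t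
    using tensor_map_comp[OF mC mC mD mD mE mE fs fs gs gs that] by simp
  then show ?thesis
    using f g cl unfolding coalgebra_hom_def
    by (auto simp: compose_def C.comult_closed linear_map_closed)
qed

lemma Hom_Coalg: "a \<in> Hom (Coalg_coc K U) C D \<longleftrightarrow>
   (\<exists>f. a = (C, f, D) \<and> C \<in> Obj (Coalg_coc K U) \<and> D \<in> Obj (Coalg_coc K U) \<and> coalgebra_hom K C D f)"
  unfolding Hom_def Coalg_coc_def Let_def by auto

lemma Obj_Coalg: "C \<in> Obj (Coalg_coc K U) \<longleftrightarrow> coalg K C \<and> carrier C \<subseteq> U"
  unfolding Coalg_coc_def Let_def coalg_def by auto

lemma Comp_Coalg: "Comp (Coalg_coc K U) (D', g, E) (C, f, D) = (C, compose (carrier C) g f, E)"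
  unfolding Coalg_coc_def Let_def by simp

lemma Ident_Coalg: "Ident (Coalg_coc K U) C = (C, (\<lambda>x\<in>carrier C. x), C)"
  unfolding Coalg_coc_def Let_def by simp

lemma category_Coalg: "category (Coalg_coc K U)"
proof
  fix f assume "f \<in> Arr (Coalg_coc K U)"
  then show "Dom (Coalg_coc K U) f \<in> Obj (Coalg_coc K U)" "Cod (Coalg_coc K U) f \<in> Obj (Coalg_coc K U)"
    unfolding Coalg_coc_def Let_def by auto
next
  fix A assume "A \<in> Obj (Coalg_coc K U)"
  then show "Ident (Coalg_coc K U) A \<in> Hom (Coalg_coc K U) A A"
    unfolding Hom_Coalg Ident_Coalg using coalgebra_hom_id Obj_Coalg by blast
next
  fix f g A B D assume "f \<in> Hom (Coalg_coc K U) A B" "g \<in> Hom (Coalg_coc K U) B D"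
  then show "g \<cdot>\<^bsub>Coalg_coc K U\<^esub> f \<in> Hom (Coalg_coc K U) A D"
    unfolding Hom_Coalg by (auto simp: Comp_Coalg Obj_Coalg intro: coalgebra_hom_comp)
next
  fix f A B assume "f \<in> Hom (Coalg_coc K U) A B"
  then obtain f' where f: "f = (A, f', B)" "f' \<in> linear_maps K A B"
    unfolding Hom_Coalg using coalgebra_hom_linear by blast
  have "compose (carrier A) (\<lambda>x\<in>carrier B. x) f' = f'" "compose (carrier A) f' (\<lambda>x\<in>carrier A. x) = f'"
    using linear_map_closed[OF f(2)] linear_map_ext[OF f(2)] by (auto simp: compose_def fun_eq_iff extensional_def)
  then show "Ident (Coalg_coc K U) B \<cdot>\<^bsub>Coalg_coc K U\<^esub> f = f" "f \<cdot>\<^bsub>Coalg_coc K U\<^esub> Ident (Coalg_coc K U) A = f"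
    unfolding f Ident_Coalg Comp_Coalg by simp_all
next
  fix f g h A B D E
  assume "f \<in> Hom (Coalg_coc K U) A B" "g \<in> Hom (Coalg_coc K U) B D" "h \<in> Hom (Coalg_coc K U) D E"
  then obtain f' g' h' where f: "f = (A, f', B)" "f' \<in> linear_maps K A B" and "g = (B, g', D)" "h = (D, h', E)"
    unfolding Hom_Coalg using coalgebra_hom_linear by blast
  moreover have "compose (carrier A) (compose (carrier B) h' g') f' = compose (carrier A) h' (compose (carrier A) g' f')"
    using linear_map_closed[OF f(2)] by (auto simp: compose_def)
  ultimately show "(h \<cdot>\<^bsub>Coalg_coc K U\<^esub> g) \<cdot>\<^bsub>Coalg_coc K U\<^esub> f = h \<cdot>\<^bsub>Coalg_coc K U\<^esub> (g \<cdot>\<^bsub>Coalg_coc K U\<^esub> f)"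
    by (simp add: Comp_Coalg)
qed

text \<open>The linearisation $\mathbb{K}[P] \to \mathbb{K}[X]$ of a function \<open>\<phi>\<close> from \<open>P\<close> to \<open>X\<close>.\<close>

definition induced_map where
  "induced_map K P E \<kappa> C \<iota> \<phi> = basis_ext K P E \<kappa> C (\<lambda>q. \<iota> (basis_vec K (\<phi> q)))"

context
  fixes K :: "('k, 'r) ring_scheme" and P :: "'p set" and E :: "('k, 'v) coalgebra" and \<kappa> :: "('p \<Rightarrow> 'k) \<Rightarrow> 'v"
    and X :: "'x set" and C :: "('k, 'w) coalgebra" and \<iota> :: "('x \<Rightarrow> 'k) \<Rightarrow> 'w" and \<phi> :: "'p \<Rightarrow> 'x"
  assumes E: "grouplike_coalg K P E \<kappa>" and C: "grouplike_coalg K X C \<iota>" and \<phi>: "\<phi> \<in> P \<rightarrow> X"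
begin

interpretation E: grouplike_coalg K P E \<kappa> by (rule E)
interpretation C: grouplike_coalg K X C \<iota> by (rule C)

lemma induced_map_values: "(\<lambda>q. \<iota> (basis_vec K (\<phi> q))) \<in> P \<rightarrow> carrier C"
  using C.b_closed \<phi> by auto

lemma induced_map_linear: "induced_map K P E \<kappa> C \<iota> \<phi> \<in> linear_maps K E C"
  unfolding induced_map_def by (rule E.basis_ext_linear[OF C.module_C induced_map_values])

lemma induced_map_basis: "q \<in> P \<Longrightarrow> induced_map K P E \<kappa> C \<iota> \<phi> (\<kappa> (basis_vec K q)) = \<iota> (basis_vec K (\<phi> q))"
  unfolding induced_map_def by (rule E.basis_ext_basis[OF C.module_C induced_map_values])

lemma induced_map_hom: "coalgebra_hom K E C (induced_map K P E \<kappa> C \<iota> \<phi>)"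
proof -
  let ?h = "induced_map K P E \<kappa> C \<iota> \<phi>"
  note hs = linear_map_is_linear[OF induced_map_linear]
  note mE = E.module_C and mC = C.module_C
  note D = linear_map_is_linear[OF E.comult_linear] and DC = linear_map_is_linear[OF C.comult_linear]
  note tl = tensor_map_linear[OF mE mE mC mC hs hs]
  have \<phi>X: "\<phi> q \<in> X" if "q \<in> P" for q using \<phi> that by auto
  have "tensor_map K E E C C ?h ?h (comult E c) = comult C (?h c)" if c: "c \<in> carrier E" for c
    by (rule E.is_linear_eq[OF C.CC_module is_linear_compose[OF D linear_map_is_linear[OF tl]] is_linear_compose[OF hs DC] _ c])
      (simp add: E.comult_basis C.comult_basis induced_map_basis \<phi>X E.b_closed tensor_map_tens[OF mE mE mC mC hs hs])
  moreover have "counit C (?h c) = counit E c" if c: "c \<in> carrier E" for c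
    by (rule E.is_linear_eq[OF E.ground_K is_linear_compose[OF hs linear_map_is_linear[OF C.counit_linear]] 
        linear_map_is_linear[OF E.counit_linear] _ c])
      (simp add: E.counit_basis C.counit_basis induced_map_basis \<phi>X)
  ultimately show ?thesis unfolding coalgebra_hom_def using induced_map_linear by blast
qed

text \<open>The coordinates of the image are the marginals, that is, the sums over the fibres of \<open>\<phi>\<close>.\<close>

lemma induced_map_coord:
  assumes c: "c \<in> carrier E" and x: "x \<in> X"
  shows "has_fsum K P (\<lambda>q. if \<phi> q = x then coord_form K P E \<kappa> q c else \<zero>\<^bsub>K\<^esub>) (coord_form K X C \<iota> x (induced_map K P E \<kappa> C \<iota> \<phi> c))"
proof -
  have "has_fsum K P (\<lambda>q. coord K P \<kappa> c q \<otimes>\<^bsub>K\<^esub> coord_form K X C \<iota> x (\<iota> (basis_vec K (\<phi> q)))) (coord_form K X C \<iota> x (induced_map K P E \<kappa> C \<iota> \<phi> c))"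
    unfolding induced_map_def by (rule E.has_fsum_basis_ext[OF C.coord_form_dual C.module_C induced_map_values c])
  then show ?thesis
  proof (rule E.C.R.has_fsum_cong)
    fix q assume q: "q \<in> P"
    then have "\<phi> q \<in> X" using \<phi> by auto
    then show "coord K P \<kappa> c q \<otimes>\<^bsub>K\<^esub> coord_form K X C \<iota> x (\<iota> (basis_vec K (\<phi> q)))
       = (if \<phi> q = x then coord_form K P E \<kappa> q c else \<zero>\<^bsub>K\<^esub>)"
      using C.coord_form_basis[OF x, of "\<phi> q"] c E.coord_apply_closed[OF c] by (auto simp: coord_form_def[of K P])
  qed
qed

end

text \<open>Linearisation preserves finite products. In terms of families, a map into $\mathbb{K}[P]$ with given
  composites to the $\mathbb{K}[X_i]$ is a family over \<open>P\<close> with given marginals: the products of the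
  marginals form such a family, and the only one.\<close>

lemma is_product_grouplike:
  fixes K :: "('k, 'r) ring_scheme" and C :: "nat \<Rightarrow> ('k, 'v) coalgebra" and P :: "'p set" and X :: "nat \<Rightarrow> 'x set"
  assumes C: "\<And>i. i < n \<Longrightarrow> grouplike_coalg K (X i) (C i) (\<iota> i)" and E: "grouplike_coalg K P E \<kappa>"
    and bij: "bij_betw (\<lambda>q. \<lambda>i\<in>{..<n}. p i q) P (PiE {..<n} X)"
    and CU: "\<And>i. i < n \<Longrightarrow> carrier (C i) \<subseteq> U" and EU: "carrier E \<subseteq> U"
  shows "is_product (Coalg_coc K U) n C E (\<lambda>i. (E, induced_map K P E \<kappa> (C i) (\<iota> i) (p i), C i))"
proof -
  interpret E: grouplike_coalg K P E \<kappa> by (rule E)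
  have Eo: "E \<in> Obj (Coalg_coc K U)" using E.coalg_axioms EU by (simp add: Obj_Coalg)
  have Co: "C i \<in> Obj (Coalg_coc K U)" if "i < n" for i
    using grouplike_coalg.cocommutative[OF C[OF that]] CU[OF that] by (simp add: Obj_Coalg coalg_def)
  have pX: "p i \<in> P \<rightarrow> X i" if "i < n" for i
  proof
    fix q assume "q \<in> P"
    then have "(\<lambda>i\<in>{..<n}. p i q) \<in> PiE {..<n} X" using bij_betwE[OF bij] by blast
    from PiE_mem[OF this, of i] show "p i q \<in> X i" using that by simp
  qed
  let ?g = "\<lambda>i. induced_map K P E \<kappa> (C i) (\<iota> i) (p i)"
  have gh: "coalgebra_hom K E (C i) (?g i)" if "i < n" for i by (rule induced_map_hom[OF E C[OF that] pX[OF that]])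
  show ?thesis unfolding is_product_def
  proof (intro conjI allI impI ballI)
    show "E \<in> Obj (Coalg_coc K U)" by (rule Eo)
    show "(E, ?g i, C i) \<in> Hom (Coalg_coc K U) E (C i)" if "i < n" for i
      unfolding Hom_Coalg using Eo Co[OF that] gh[OF that] by blast
  next
    fix D f assume Do: "D \<in> Obj (Coalg_coc K U)" and f: "\<forall>i<n. f i \<in> Hom (Coalg_coc K U) D (C i)"
    interpret D: coalg K D using Do by (simp add: Obj_Coalg)
    define f' where "f' i = fst (snd (f i))" for i
    have fi: "f i = (D, f' i, C i)" "coalgebra_hom K D (C i) (f' i)" if "i < n" for i
      using f that unfolding f'_def Hom_Coalg by auto
    define F where "F i x = (\<lambda>d\<in>carrier D. coord_form K (X i) (C i) (\<iota> i) x (f' i d))" for i x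
    have F: "idem_family K D (X i) (F i)" if "i < n" for i
      unfolding F_def by (rule grouplike_coalg.hom_idem_family[OF C[OF that] D.coalg_axioms fi(2)[OF that]])
    let ?G = "\<lambda>q. finprod (dual_monoid K D) (\<lambda>i. F i (p i q)) {..<n}"
    have G: "idem_family K D P ?G" by (rule D.finprod_idem_family[OF F bij])
    obtain h where h: "coalgebra_hom K D E h" and hG: "\<And>q d. q \<in> P \<Longrightarrow> d \<in> carrier D \<Longrightarrow> coord_form K P E \<kappa> q (h d) = ?G q d"
      using E.idem_family_hom[OF D.coalg_axioms G] by blast
    have hE: "h d \<in> carrier E" if "d \<in> carrier D" for d
      by (rule linear_map_closed[OF coalgebra_hom_linear[OF h] that])
    have gc: "?g i (h d) = f' i d" if i: "i < n" and d: "d \<in> carrier D" for i d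
    proof (rule grouplike_coalg.eq_if_coord_eq[OF C[OF i]])
      interpret Ci: grouplike_coalg K "X i" "C i" "\<iota> i" by (rule C[OF i])
      show gC: "?g i (h d) \<in> carrier (C i)" by (rule linear_map_closed[OF coalgebra_hom_linear[OF gh[OF i]] hE[OF d]])
      show fC: "f' i d \<in> carrier (C i)" by (rule linear_map_closed[OF coalgebra_hom_linear[OF fi(2)[OF i]] d])
      fix x assume x: "x \<in> X i"
      \<comment> \<open>The marginal of the family \<open>?G\<close> at \<open>x\<close> is the sum of the \<open>?G q * F i x\<close>, hence the product of \<open>F i x\<close> with the unit.\<close>
      have Fx: "F i x \<in> dual K D" using idem_familyD(1)[OF F[OF i] x] .
      have 1: "has_fsum K P (\<lambda>q. if p i q = x then ?G q d else \<zero>\<^bsub>K\<^esub>) (coord_form K (X i) (C i) (\<iota> i) x (?g i (h d)))"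
        by (rule E.C.R.has_fsum_cong[OF induced_map_coord[OF E C[OF i] pX[OF i] hE[OF d] x]]) (simp add: hG d)
      have "has_fsum K P (\<lambda>q. conv K D (?G q) (F i x) d) (conv K D (counit D) (F i x) d)"
        by (rule D.has_fsum_conv_left[OF idem_familyD(1)[OF G] D.counit_dual Fx idem_familyD(3)[OF G] d])
      moreover have "conv K D (?G q) (F i x) d = (if p i q = x then ?G q d else \<zero>\<^bsub>K\<^esub>)" if q: "q \<in> P" for q
      proof -
        have pq: "p j q \<in> X j" if "j < n" for j using pX[OF that] q by auto
        have "conv K D (?G q) (F i x) = (if p i q = x then ?G q else D.zero_form)"
          using D.finprod_family_absorb[of n X F "\<lambda>j. p j q" i x] F pq i x by simp
        then show ?thesis using d by (simp add: D.zero_form_def)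
      qed
      ultimately have 2: "has_fsum K P (\<lambda>q. if p i q = x then ?G q d else \<zero>\<^bsub>K\<^esub>) (conv K D (counit D) (F i x) d)"
        by (rule E.C.R.has_fsum_cong)
      have "coord_form K (X i) (C i) (\<iota> i) x (?g i (h d)) = F i x d"
        using E.C.R.has_fsum_unique[OF 1 2] D.conv_counit_left[OF Fx] by simp
      then show "coord K (X i) (\<iota> i) (?g i (h d)) x = coord K (X i) (\<iota> i) (f' i d) x"
        unfolding F_def coord_form_def using d gC fC by simp
    qed
    show "\<exists>!h. h \<in> Hom (Coalg_coc K U) D E \<and> (\<forall>i<n. (E, ?g i, C i) \<cdot>\<^bsub>Coalg_coc K U\<^esub> h = f i)"
    proof (rule ex1I[of _ "(D, h, E)"])
      have "compose (carrier D) (?g i) h = f' i" if i: "i < n" for i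
        by (rule linear_map_eqI[OF linear_map_comp[OF D.module_C coalgebra_hom_linear[OF h] coalgebra_hom_linear[OF gh[OF i]]]
             coalgebra_hom_linear[OF fi(2)[OF i]]])
           (simp add: compose_def gc i)
      then show "(D, h, E) \<in> Hom (Coalg_coc K U) D E \<and> (\<forall>i<n. (E, ?g i, C i) \<cdot>\<^bsub>Coalg_coc K U\<^esub> (D, h, E) = f i)"
        using Do Eo h fi(1) by (auto simp: Hom_Coalg Comp_Coalg)
    next
      fix k assume k: "k \<in> Hom (Coalg_coc K U) D E \<and> (\<forall>i<n. (E, ?g i, C i) \<cdot>\<^bsub>Coalg_coc K U\<^esub> k = f i)"
      then obtain k' where k': "k = (D, k', E)" "coalgebra_hom K D E k'" unfolding Hom_Coalg by blast
      have kE: "k' d \<in> carrier E" if "d \<in> carrier D" for d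
        by (rule linear_map_closed[OF coalgebra_hom_linear[OF k'(2)] that])
      have kf: "?g i (k' d) = f' i d" if i: "i < n" and d: "d \<in> carrier D" for i d
      proof -
        have "compose (carrier D) (?g i) k' = f' i" using k i fi(1)[OF i] unfolding k' Comp_Coalg by auto
        from fun_cong[OF this, of d] show ?thesis using d by (simp add: compose_def)
      qed
      let ?H = "\<lambda>q. \<lambda>d\<in>carrier D. coord_form K P E \<kappa> q (k' d)"
      have H: "idem_family K D P ?H" by (rule E.hom_idem_family[OF D.coalg_axioms k'(2)])
      have HG: "?H q = ?G q" if q: "q \<in> P" for q
      proof (rule D.family_eq_finprod_marginals[OF H F bij _ q])
        fix i x d assume i: "i < n" and x: "x \<in> X i" and d: "d \<in> carrier D"
        have "F i x d = coord_form K (X i) (C i) (\<iota> i) x (?g i (k' d))" using d by (simp add: F_def kf[OF i d])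
        then show "has_fsum K P (\<lambda>q. if p i q = x then ?H q d else \<zero>\<^bsub>K\<^esub>) (F i x d)"
          using induced_map_coord[OF E C[OF i] pX[OF i] kE[OF d] x] d by (simp cong: if_cong)
      qed auto
      have "k' = h"
      proof (rule linear_map_eqI[OF coalgebra_hom_linear[OF k'(2)] coalgebra_hom_linear[OF h]])
        fix d assume d: "d \<in> carrier D"
        show "k' d = h d"
        proof (rule E.eq_if_coord_eq[OF kE[OF d] hE[OF d]])
          fix q assume q: "q \<in> P"
          have "coord_form K P E \<kappa> q (k' d) = coord_form K P E \<kappa> q (h d)"
            using fun_cong[OF HG[OF q], of d] hG[OF q d] d by simp
          then show "coord K P \<kappa> (k' d) q = coord K P \<kappa> (h d) q"
            using kE[OF d] hE[OF d] by (simp add: coord_form_def)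
        qed
      qed
      then show "k = (D, h, E)" unfolding k' by simp
    qed
  qed
qed

section \<open>The grouplike coalgebra on a set\<close>

definition transport_module ::
  "('k, 'r) ring_scheme \<Rightarrow> 'x set \<Rightarrow> (('x \<Rightarrow> 'k) \<Rightarrow> 'v) \<Rightarrow> ('k, 'v) module" where
  "transport_module K X \<iota> = (let F = free_module K X; c = coord K X \<iota> in
     \<lparr>carrier = \<iota> ` carrier F, mult = undefined, one = undefined, zero = \<iota> \<zero>\<^bsub>F\<^esub>,
      add = (\<lambda>a b. \<iota> (c a \<oplus>\<^bsub>F\<^esub> c b)), smult = (\<lambda>r a. \<iota> (r \<odot>\<^bsub>F\<^esub> c a))\<rparr>)"

definition grouplike ::
  "('k, 'r) ring_scheme \<Rightarrow> 'x set \<Rightarrow> (('x \<Rightarrow> 'k) \<Rightarrow> 'v) \<Rightarrow> ('k, 'v) coalgebra" where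
  "grouplike K X \<iota> = (let M = transport_module K X \<iota> in
     \<lparr>carrier = carrier M, mult = undefined, one = undefined, zero = zero M, add = add M, smult = smult M,
      comult = (\<lambda>a\<in>carrier M. lin_ext K X (tensor K M M)
         (\<lambda>x. tens K M M (\<iota> (basis_vec K x)) (\<iota> (basis_vec K x))) (coord K X \<iota> a)),
      counit = (\<lambda>a\<in>carrier M. lin_ext K X (ground_module K) (\<lambda>x. \<one>\<^bsub>K\<^esub>) (coord K X \<iota> a))\<rparr>)"

lemma grouplike_carrier: "carrier (grouplike K X \<iota>) = \<iota> ` carrier (free_module K X)"
  unfolding grouplike_def transport_module_def Let_def by simp

lemma grouplike_coalg_grouplike:
  assumes K: "cring K" and inj: "inj_on \<iota> (carrier (free_module K X))"
  shows "grouplike_coalg K X (grouplike K X \<iota>) \<iota>"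
proof -
  interpret K: cring K by fact
  let ?F = "free_module K X" and ?M = "transport_module K X \<iota>" and ?C = "grouplike K X \<iota>"
  have F: "module K ?F" by (rule free_module_module[OF K])
  interpret F: module K ?F by (rule F)
  have ci: "coord K X \<iota> (\<iota> v) = v" if "v \<in> carrier ?F" for v
    unfolding coord_def using inj that by (rule the_inv_into_f_f)
  have ops: "carrier ?M = \<iota> ` carrier ?F" "\<zero>\<^bsub>?M\<^esub> = \<iota> \<zero>\<^bsub>?F\<^esub>"
    "\<And>v w. v \<in> carrier ?F \<Longrightarrow> w \<in> carrier ?F \<Longrightarrow> \<iota> v \<oplus>\<^bsub>?M\<^esub> \<iota> w = \<iota> (v \<oplus>\<^bsub>?F\<^esub> w)"
    "\<And>r v. v \<in> carrier ?F \<Longrightarrow> r \<odot>\<^bsub>?M\<^esub> \<iota> v = \<iota> (r \<odot>\<^bsub>?F\<^esub> v)"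
    unfolding transport_module_def Let_def by (simp_all only: ci cat.simps module.simps ring.simps partial_object.simps)
  have cops: "carrier ?C = carrier ?M" "zero ?C = zero ?M" "add ?C = add ?M" "smult ?C = smult ?M"
    unfolding grouplike_def Let_def by simp_all
  have neg: "\<exists>w\<in>carrier ?F. \<iota> (w \<oplus>\<^bsub>?F\<^esub> v) = \<iota> \<zero>\<^bsub>?F\<^esub>" if "v \<in> carrier ?F" for v
    using F.l_neg[OF that] that by (metis F.a_inv_closed)
  have "module K ?C"
  proof (intro moduleI abelian_groupI K)
    show "\<exists>y\<in>carrier ?C. y \<oplus>\<^bsub>?C\<^esub> x = \<zero>\<^bsub>?C\<^esub>" if "x \<in> carrier ?C" for x
      using that neg by (auto simp only: cops ops imageE bex_simps image_iff) (metis ops(3))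
  qed (auto simp: cops ops F.smult_l_distr F.smult_r_distr F.smult_assoc1 F.M.a_ac simp del: free_module_simps)
  have t: "tensor K ?C ?C = tensor K ?M ?M" "tens K ?C ?C = tens K ?M ?M"
    unfolding tensor_def tens_def tensor_kernel_def tensor_relations_def cops by (rule refl ext)+
  note M = \<open>module K ?C\<close>
  have bC: "\<iota> (basis_vec K x) \<in> carrier ?C" if "x \<in> X" for x
    unfolding cops ops using basis_vec_carrier[OF K that] by blast
  let ?\<tau> = "\<lambda>x. tens K ?C ?C (\<iota> (basis_vec K x)) (\<iota> (basis_vec K x))"
  have \<tau>: "?\<tau> \<in> X \<rightarrow> carrier (tensor K ?C ?C)" using tens_closed[OF M M] bC by blast
  have u: "(\<lambda>x. \<one>\<^bsub>K\<^esub>) \<in> X \<rightarrow> carrier (ground_module K)" by simp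
  have com: "comult ?C = (\<lambda>a\<in>carrier ?C. lin_ext K X (tensor K ?C ?C) ?\<tau> (coord K X \<iota> a))"
    unfolding t cops by (simp add: grouplike_def Let_def)
  have cou: "counit ?C = (\<lambda>a\<in>carrier ?C. lin_ext K X (ground_module K) (\<lambda>x. \<one>\<^bsub>K\<^esub>) (coord K X \<iota> a))"
    unfolding cops by (simp add: grouplike_def Let_def)
  show ?thesis
  proof (rule grouplike_coalg.intro)
    show "module K ?C" by (rule M)
    show "is_linear K ?F ?C \<iota>" unfolding is_linear_def by (auto simp: cops ops simp del: free_module_simps)
    show "bij_betw \<iota> (carrier ?F) (carrier ?C)" unfolding cops ops using inj by (simp add: bij_betw_def)
    show "comult ?C \<in> linear_maps K ?C (tensor K ?C ?C)"
    proof -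
      note L = lin_ext_linear[OF tensor_module[OF M M] \<tau>]
      show ?thesis unfolding com
        by (rule restrict_linear_mapsI[OF M])
        (auto simp: cops ops ci linear_map_closed[OF L] linear_map_closed[OF L, simplified] linear_map_add[OF L] linear_map_smult[OF L] simp del: free_module_simps)
    qed
    show "counit ?C \<in> linear_maps K ?C (ground_module K)"
    proof -
      note L = lin_ext_linear[OF ground_module_module[OF K] u]
      show ?thesis unfolding cou
        by (rule restrict_linear_mapsI[OF M])
        (auto simp: cops ops ci linear_map_closed[OF L] linear_map_closed[OF L, simplified] linear_map_add[OF L] linear_map_smult[OF L] simp del: free_module_simps)
    qed
    fix x assume x: "x \<in> X"
    show "comult ?C (\<iota> (basis_vec K x)) = ?\<tau> x"
      unfolding com using x bC[OF x] by (simp add: ci basis_vec_carrier[OF K] lin_ext_basis[OF tensor_module[OF M M] \<tau>])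
    show "counit ?C (\<iota> (basis_vec K x)) = \<one>\<^bsub>K\<^esub>"
      unfolding cou using x bC[OF x] by (simp add: ci basis_vec_carrier[OF K] lin_ext_basis[OF ground_module_module[OF K] u])
  qed
qed

section \<open>Linearised sets fit into the universe\<close>

lemma lepoll_iff_card_of: "A \<lesssim> B \<longleftrightarrow> (card_of A, card_of B) \<in> ordLeq"
  unfolding lepoll_def by (rule card_of_ordLeq)

lemma times_lepoll_infinite:
  assumes "infinite U" "A \<lesssim> U" "B \<lesssim> U" shows "A \<times> B \<lesssim> U"
proof -
  have "U \<times> U \<lesssim> U"
    using card_of_Times_same_infinite[OF assms(1)] by (simp add: lepoll_iff_card_of ordIso_iff_ordLeq)
  with times_lepoll_mono[OF assms(2,3)] show ?thesis by (rule lepoll_trans)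
qed

text \<open>Lists of a fixed length are equipotent to a power of \<open>U\<close>, and there are countably many lengths.\<close>

lemma lists_lepoll_infinite:
  assumes U: "infinite U" shows "lists U \<lesssim> U"
proof -
  have L: "{xs \<in> lists U. length xs = n} \<lesssim> U" for n
  proof (induction n)
    case 0
    have "{xs \<in> lists U. length xs = 0} = {[]}" by auto
    then show ?case using U by (simp add: finite_lepoll_infinite)
  next
    case (Suc n)
    have "{xs \<in> lists U. length xs = Suc n} = (\<lambda>(x, xs). x # xs) ` (U \<times> {xs \<in> lists U. length xs = n})"
      by (auto simp: length_Suc_conv image_iff)
    moreover have "(\<lambda>(x, xs). x # xs) ` (U \<times> {xs \<in> lists U. length xs = n}) \<lesssim> U \<times> {xs \<in> lists U. length xs = n}"
      by (rule image_lepoll)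
    ultimately have "{xs \<in> lists U. length xs = Suc n} \<lesssim> U \<times> {xs \<in> lists U. length xs = n}" by simp
    then show ?case by (rule lepoll_trans[OF _ times_lepoll_infinite[OF U lepoll_refl Suc.IH]])
  qed
  have "(card_of (\<Union>n\<in>(UNIV::nat set). {xs \<in> lists U. length xs = n}), card_of U) \<in> ordLeq"
  proof (rule card_of_UNION_ordLeq_infinite[OF U])
    show "(card_of (UNIV :: nat set), card_of U) \<in> ordLeq"
      using U unfolding infinite_le_lepoll lepoll_iff_card_of .
    show "\<forall>n\<in>UNIV. (card_of {xs \<in> lists U. length xs = n}, card_of U) \<in> ordLeq"
      using L unfolding lepoll_iff_card_of by blast
  qed
  moreover have "(\<Union>n\<in>(UNIV::nat set). {xs \<in> lists U. length xs = n}) = lists U" by blast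
  ultimately show ?thesis by (simp only: lepoll_iff_card_of)
qed

lemma Fpow_lepoll_infinite:
  assumes U: "infinite U" and A: "A \<lesssim> U" shows "Fpow A \<lesssim> U"
proof -
  have "Fpow A \<subseteq> set ` lists A"
    unfolding Fpow_def by (auto simp: image_iff) (metis finite_list lists_eq_set mem_Collect_eq)
  then have "Fpow A \<lesssim> lists A" by (rule subset_image_lepoll)
  also have "lists A \<lesssim> lists U" by (rule lists_lepoll_mono[OF A])
  also have "lists U \<lesssim> U" by (rule lists_lepoll_infinite[OF U])
  finally show ?thesis .
qed

text \<open>A vector is determined by the finite graph of its nonzero coordinates.\<close>

lemma free_module_lepoll:
  assumes U: "infinite U" and X: "X \<lesssim> U" and K: "carrier K \<lesssim> U"
  shows "carrier (free_module K X) \<lesssim> U"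
proof -
  have "carrier (free_module K X) \<subseteq>
     {f. f ` X \<subseteq> carrier K \<and> {x. f x \<noteq> \<zero>\<^bsub>K\<^esub>} \<subseteq> X \<and> finite {x. f x \<noteq> \<zero>\<^bsub>K\<^esub>}}"
    by (auto simp: free_module_carrier)
  then have "carrier (free_module K X) \<lesssim> Fpow (X \<times> carrier K)"
    by (rule lepoll_trans[OF subset_imp_lepoll lepoll_restricted_funspace])
  then show ?thesis
    by (rule lepoll_trans[OF _ Fpow_lepoll_infinite[OF U times_lepoll_infinite[OF U X K]]])
qed

section \<open>Categories of product preserving functors\<close>

lemma Obj_functor_cat: "F \<in> Obj (product_functor_category C D) \<longleftrightarrow> is_functor C D F \<and> preserves_finite_products F"
  and Arr_functor_cat: "\<eta> \<in> Arr (product_functor_category C D) \<longleftrightarrow> is_ntrans C D \<eta> \<and>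
      NSrc \<eta> \<in> Obj (product_functor_category C D) \<and> NTrg \<eta> \<in> Obj (product_functor_category C D)"
  and Dom_functor_cat: "Dom (product_functor_category C D) = NSrc"
  and Cod_functor_cat: "Cod (product_functor_category C D) = NTrg"
  and Ident_functor_cat: "Ident (product_functor_category C D) F =
     \<lparr>NSrc = F, NTrg = F, Component = (\<lambda>A\<in>Obj C. Ident D (OMap F A))\<rparr>"
  and Comp_functor_cat: "Comp (product_functor_category C D) \<theta> \<eta> = \<lparr>NSrc = NSrc \<eta>, NTrg = NTrg \<theta>,
                Component = (\<lambda>A\<in>Obj C. Component \<theta> A \<cdot>\<^bsub>D\<^esub> Component \<eta> A)\<rparr>"
  unfolding product_functor_category_def Let_def by simp_all

lemma Hom_functor_cat: "\<eta> \<in> Hom (product_functor_category C D) F G \<longleftrightarrow> is_ntrans C D \<eta> \<and> NSrc \<eta> = F \<and> NTrg \<eta> = G \<and>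
    F \<in> Obj (product_functor_category C D) \<and> G \<in> Obj (product_functor_category C D)"
  unfolding Hom_def Arr_functor_cat Dom_functor_cat Cod_functor_cat by auto

lemma ntrans_hom: "is_ntrans C D \<eta> \<Longrightarrow> A \<in> Obj C \<Longrightarrow> Component \<eta> A \<in> Hom D (OMap (NSrc \<eta>) A) (OMap (NTrg \<eta>) A)"
  and ntrans_natural: "is_ntrans C D \<eta> \<Longrightarrow> f \<in> Hom C A B \<Longrightarrow>
     AMap (NTrg \<eta>) f \<cdot>\<^bsub>D\<^esub> Component \<eta> A = Component \<eta> B \<cdot>\<^bsub>D\<^esub> AMap (NSrc \<eta>) f"
  unfolding is_ntrans_def Hom_def by auto

lemma ntransI:
  assumes "is_functor C D F" "is_functor C D G" "c \<in> extensional (Obj C)"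
    and "\<And>A. A \<in> Obj C \<Longrightarrow> c A \<in> Hom D (OMap F A) (OMap G A)"
    and "\<And>f A B. f \<in> Hom C A B \<Longrightarrow> AMap G f \<cdot>\<^bsub>D\<^esub> c A = c B \<cdot>\<^bsub>D\<^esub> AMap F f"
  shows "is_ntrans C D \<lparr>NSrc = F, NTrg = G, Component = c\<rparr>"
  using assms Hom_Arr_self[of _ C] unfolding is_ntrans_def by simp

context
  fixes C :: "('o, 'a) cat" and D :: "('p, 'b) cat"
  assumes C: "category C" and D: "category D"
begin

interpretation C: category C by (rule C)
interpretation D: category D by (rule D)

lemma functor_cat_ident:
  assumes F: "F \<in> Obj (product_functor_category C D)"
  shows "Ident (product_functor_category C D) F \<in> Arr (product_functor_category C D)"
proof -
  have Ff: "is_functor C D F" using F unfolding Obj_functor_cat by blast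
  have "is_ntrans C D (Ident (product_functor_category C D) F)"
    unfolding Ident_functor_cat
  proof (rule ntransI[OF Ff Ff])
    show "(\<lambda>A\<in>Obj C. Ident D (OMap F A)) A \<in> Hom D (OMap F A) (OMap F A)" if "A \<in> Obj C" for A
      using that D.ident_hom[OF functor_obj[OF Ff that]] by simp
    fix f A B assume f: "f \<in> Hom C A B"
    show "AMap F f \<cdot>\<^bsub>D\<^esub> (\<lambda>A\<in>Obj C. Ident D (OMap F A)) A = (\<lambda>A\<in>Obj C. Ident D (OMap F A)) B \<cdot>\<^bsub>D\<^esub> AMap F f"
      using functor_hom[OF Ff f] C.Hom_dom_obj[OF f] C.Hom_cod_obj[OF f] by (simp add: D.ident_left D.ident_right)
  qed simp
  then show ?thesis unfolding Arr_functor_cat using F by (simp add: Ident_functor_cat)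
qed

lemma functor_cat_comp:
  assumes \<eta>: "\<eta> \<in> Hom (product_functor_category C D) F G" and \<theta>: "\<theta> \<in> Hom (product_functor_category C D) G H"
  shows "\<theta> \<cdot>\<^bsub>product_functor_category C D\<^esub> \<eta> \<in> Hom (product_functor_category C D) F H"
proof -
  have n: "is_ntrans C D \<eta>" "is_ntrans C D \<theta>" and e: "NSrc \<eta> = F" "NTrg \<eta> = G" "NSrc \<theta> = G" "NTrg \<theta> = H"
    using \<eta> \<theta> unfolding Hom_functor_cat by auto
  have F: "is_functor C D F" "is_functor C D G" "is_functor C D H" using \<eta> \<theta> unfolding Hom_functor_cat Obj_functor_cat by auto
  note h1 = ntrans_hom[OF n(1), unfolded e] and h2 = ntrans_hom[OF n(2), unfolded e]
  have "is_ntrans C D (\<theta> \<cdot>\<^bsub>product_functor_category C D\<^esub> \<eta>)"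
    unfolding Comp_functor_cat e
  proof (rule ntransI[OF F(1,3)])
    show "(\<lambda>A\<in>Obj C. Component \<theta> A \<cdot>\<^bsub>D\<^esub> Component \<eta> A) A \<in> Hom D (OMap F A) (OMap H A)" if "A \<in> Obj C" for A
      using D.comp_hom[OF h1[OF that] h2[OF that]] that by simp
    fix f A B assume f: "f \<in> Hom C A B"
    note A = C.Hom_dom_obj[OF f] and B = C.Hom_cod_obj[OF f]
    have "AMap H f \<cdot>\<^bsub>D\<^esub> (Component \<theta> A \<cdot>\<^bsub>D\<^esub> Component \<eta> A) = (Component \<theta> B \<cdot>\<^bsub>D\<^esub> AMap G f) \<cdot>\<^bsub>D\<^esub> Component \<eta> A"
      using D.comp_assoc[OF h1[OF A] h2[OF A] functor_hom[OF F(3) f]] ntrans_natural[OF n(2) f] e by simp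
    also have "\<dots> = Component \<theta> B \<cdot>\<^bsub>D\<^esub> (Component \<eta> B \<cdot>\<^bsub>D\<^esub> AMap F f)"
      using D.comp_assoc[OF h1[OF A] functor_hom[OF F(2) f] h2[OF B]] ntrans_natural[OF n(1) f] e by simp
    also have "\<dots> = (Component \<theta> B \<cdot>\<^bsub>D\<^esub> Component \<eta> B) \<cdot>\<^bsub>D\<^esub> AMap F f"
      using D.comp_assoc[OF functor_hom[OF F(1) f] h1[OF B] h2[OF B]] by simp
    finally show "AMap H f \<cdot>\<^bsub>D\<^esub> (\<lambda>A\<in>Obj C. Component \<theta> A \<cdot>\<^bsub>D\<^esub> Component \<eta> A) A =
        (\<lambda>A\<in>Obj C. Component \<theta> A \<cdot>\<^bsub>D\<^esub> Component \<eta> A) B \<cdot>\<^bsub>D\<^esub> AMap F f"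
      using A B by simp
  qed simp
  then show ?thesis using \<eta> \<theta> unfolding Hom_functor_cat by (simp add: Comp_functor_cat)
qed

end

definition const_functor :: "('o, 'a) cat \<Rightarrow> ('p, 'b) cat \<Rightarrow> 'p \<Rightarrow> ('o, 'a, 'p, 'b) fctr" where
  "const_functor C D Q = \<lparr>Src = C, Trg = D, OMap = (\<lambda>A\<in>Obj C. Q), AMap = (\<lambda>f\<in>Arr C. Ident D Q)\<rparr>"

definition terminal where
  "terminal C Q \<longleftrightarrow> Q \<in> Obj C \<and> (\<forall>X\<in>Obj C. \<exists>!h. h \<in> Hom C X Q)"

lemma terminal_iff_product: "terminal C Q \<longleftrightarrow> is_product C 0 A Q p"
  unfolding terminal_def is_product_def by simp

lemma terminal_eq: "terminal C Q \<Longrightarrow> X \<in> Obj C \<Longrightarrow> f \<in> Hom C X Q \<Longrightarrow> g \<in> Hom C X Q \<Longrightarrow> f = g"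
  unfolding terminal_def by blast

lemma preserves_productsD:
  assumes "is_functor C D F" "preserves_finite_products F" "is_product C n A P p"
  shows "is_product D n (\<lambda>i. OMap F (A i)) (OMap F P) (\<lambda>i. AMap F (p i))"
  using assms unfolding preserves_finite_products_def is_functor_def by blast

lemma functor_cat_terminal:
  assumes "M \<in> Obj (product_functor_category C D)" "terminal C Q"
  shows "terminal D (OMap M Q)"
proof -
  have M: "is_functor C D M" "preserves_finite_products M" using assms(1) unfolding Obj_functor_cat by blast+
  have P: "is_product C 0 (\<lambda>_. Q) Q (\<lambda>_. undefined)"
    using assms(2) by (rule terminal_iff_product[THEN iffD1])
  from preserves_productsD[OF M P] show ?thesis by (rule terminal_iff_product[THEN iffD2])
qed

context
  fixes C :: "('o, 'a) cat" and D :: "('p, 'b) cat" and Q :: 'p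
  assumes C: "category C" and D: "category D" and Q: "terminal D Q"
begin

interpretation C: category C by (rule C)
interpretation D: category D by (rule D)

lemma terminal_obj: "Q \<in> Obj D"
  using Q unfolding terminal_def by blast

lemma const_functor_model: "const_functor C D Q \<in> Obj (product_functor_category C D)"
proof -
  let ?N = "const_functor C D Q"
  note I = D.ident_hom[OF terminal_obj]
  have "is_functor C D ?N"
    unfolding is_functor_def
  proof (intro conjI ballI impI)
    fix f g assume f: "f \<in> Arr C" and g: "g \<in> Arr C" and e: "Dom C g = Cod C f"
    have "g \<cdot>\<^bsub>C\<^esub> f \<in> Arr C"
      by (rule Hom_Arr[OF C.comp_hom[OF Hom_Arr_self[OF f]]]) (use Hom_Arr_self[OF g] e in simp)
    then show "AMap ?N (g \<cdot>\<^bsub>C\<^esub> f) = AMap ?N g \<cdot>\<^bsub>D\<^esub> AMap ?N f"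
      using f g D.ident_left[OF I] by (simp add: const_functor_def)
  next
    fix A assume A: "A \<in> Obj C"
    show "AMap ?N (Ident C A) = Ident D (OMap ?N A)"
      using A Hom_Arr[OF C.ident_hom[OF A]] by (simp add: const_functor_def)
  qed (use terminal_obj Hom_Arr[OF I] Hom_Dom[OF I] Hom_Cod[OF I] C.dom_obj C.cod_obj in
      \<open>simp_all add: const_functor_def\<close>)
  moreover have "preserves_finite_products ?N"
    unfolding preserves_finite_products_def
  proof (intro allI impI)
    fix n A P p assume "is_product (Src ?N) n A P p"
    then have P: "is_product C n A P p" unfolding const_functor_def by simp
    have 1: "is_product D n (\<lambda>_. Q) Q (\<lambda>_. Ident D Q)"
      unfolding is_product_def
    proof (intro conjI allI ballI impI)
      fix X f assume X: "X \<in> Obj D" and f: "\<forall>i<n. f i \<in> Hom D X Q"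
      obtain h where h: "h \<in> Hom D X Q" using Q X unfolding terminal_def by blast
      show "\<exists>!h. h \<in> Hom D X Q \<and> (\<forall>i<n. Ident D Q \<cdot>\<^bsub>D\<^esub> h = f i)"
        using h f D.ident_left[OF h] terminal_eq[OF Q X] by metis
    qed (use terminal_obj I in auto)
    have "is_product D n (\<lambda>i. OMap ?N (A i)) Q (\<lambda>i. AMap ?N (p i))"
      by (rule is_product_cong[OF 1])
        (use C.Hom_cod_obj[OF is_product_proj[OF P]] Hom_Arr[OF is_product_proj[OF P]] in \<open>auto simp: const_functor_def\<close>)
    then show "is_product (Trg ?N) n (\<lambda>i. OMap ?N (A i)) (OMap ?N P) (\<lambda>i. AMap ?N (p i))"
      using is_product_obj[OF P] by (simp add: const_functor_def)
  qed
  ultimately show ?thesis unfolding Obj_functor_cat by blast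
qed

lemma const_functor_simps: "A \<in> Obj C \<Longrightarrow> OMap (const_functor C D Q) A = Q"
  "f \<in> Hom C A B \<Longrightarrow> AMap (const_functor C D Q) f = Ident D Q"
  unfolding const_functor_def by (auto dest: Hom_Arr)

text \<open>A map from the constant functor to a model \<open>M\<close> is determined at \<open>T0\<close>, because \<open>M\<close> sends \<open>T0\<close> to a
  terminal object, and then at \<open>A\<close> by naturality along the unique arrow \<open>z A\<close> from \<open>T0\<close> to \<open>A\<close>. These
  components are natural, since the arrows \<open>z A\<close> are compatible with all others.\<close>

lemma zero_object_const_functor:
  assumes T0: "terminal C T0" and zero: "\<And>A. A \<in> Obj C \<Longrightarrow> \<exists>!f. f \<in> Hom C T0 A"
  shows "zero_object (product_functor_category C D) (const_functor C D Q)"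
  unfolding zero_object_def
proof (intro conjI ballI)
  let ?N = "const_functor C D Q"
  show "?N \<in> Obj (product_functor_category C D)" by (rule const_functor_model)
  have N: "is_functor C D ?N" using const_functor_model unfolding Obj_functor_cat by blast
  have T0O: "T0 \<in> Obj C" using T0 unfolding terminal_def by blast
  fix M assume M: "M \<in> Obj (product_functor_category C D)"
  have MF: "is_functor C D M" using M unfolding Obj_functor_cat by blast
  have MT: "terminal D (OMap M T0)" by (rule functor_cat_terminal[OF M T0])
  obtain z where z: "\<And>A. A \<in> Obj C \<Longrightarrow> z A \<in> Hom C T0 A" using zero by metis
  have zu: "f = z A" if "f \<in> Hom C T0 A" for f A using zero[OF C.Hom_cod_obj[OF that]] z[OF C.Hom_cod_obj[OF that]] that by blast
  obtain u where u: "u \<in> Hom D Q (OMap M T0)" using MT terminal_obj unfolding terminal_def by blast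
  have Mz: "AMap M (z A) \<in> Hom D (OMap M T0) (OMap M A)" if "A \<in> Obj C" for A by (rule functor_hom[OF MF z[OF that]])
  have Mzu: "AMap M (z A) \<cdot>\<^bsub>D\<^esub> u \<in> Hom D Q (OMap M A)" if "A \<in> Obj C" for A by (rule D.comp_hom[OF u Mz[OF that]])
  let ?\<eta> = "\<lparr>NSrc = ?N, NTrg = M, Component = (\<lambda>A\<in>Obj C. AMap M (z A) \<cdot>\<^bsub>D\<^esub> u)\<rparr>"
  show "\<exists>!f. f \<in> Hom (product_functor_category C D) ?N M"
  proof (rule ex1I[of _ ?\<eta>])
    have "is_ntrans C D ?\<eta>"
    proof (rule ntransI[OF N MF])
      show "(\<lambda>A\<in>Obj C. AMap M (z A) \<cdot>\<^bsub>D\<^esub> u) A \<in> Hom D (OMap ?N A) (OMap M A)" if "A \<in> Obj C" for A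
        using Mzu[OF that] that by (simp add: const_functor_simps)
      fix f A B assume f: "f \<in> Hom C A B"
      note A = C.Hom_dom_obj[OF f] and B = C.Hom_cod_obj[OF f]
      have "AMap M f \<cdot>\<^bsub>D\<^esub> AMap M (z A) \<cdot>\<^bsub>D\<^esub> u = AMap M (f \<cdot>\<^bsub>C\<^esub> z A) \<cdot>\<^bsub>D\<^esub> u"
        using D.comp_assoc[OF u Mz[OF A] functor_hom[OF MF f]] functor_comp_arr[OF MF z[OF A] f] by simp
      also have "f \<cdot>\<^bsub>C\<^esub> z A = z B" by (rule zu[OF C.comp_hom[OF z[OF A] f]])
      finally show "AMap M f \<cdot>\<^bsub>D\<^esub> (\<lambda>A\<in>Obj C. AMap M (z A) \<cdot>\<^bsub>D\<^esub> u) A = (\<lambda>A\<in>Obj C. AMap M (z A) \<cdot>\<^bsub>D\<^esub> u) B \<cdot>\<^bsub>D\<^esub> AMap ?N f"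
        using A B f D.ident_right[OF Mzu[OF B]] by (simp add: const_functor_simps)
    qed simp
    then show "?\<eta> \<in> Hom (product_functor_category C D) ?N M"
      unfolding Hom_functor_cat using M const_functor_model by simp
    fix \<theta> assume \<theta>: "\<theta> \<in> Hom (product_functor_category C D) ?N M"
    then have nt: "is_ntrans C D \<theta>" and e: "NSrc \<theta> = ?N" "NTrg \<theta> = M" unfolding Hom_functor_cat by auto
    have h: "Component \<theta> A \<in> Hom D Q (OMap M A)" if "A \<in> Obj C" for A
      using ntrans_hom[OF nt that] that by (simp add: e const_functor_simps)
    have "Component \<theta> T0 = u" by (rule terminal_eq[OF MT terminal_obj h[OF T0O] u])
    then have "Component \<theta> A = AMap M (z A) \<cdot>\<^bsub>D\<^esub> u" if "A \<in> Obj C" for A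
      using ntrans_natural[OF nt z[OF that]] D.ident_right[OF h[OF that]] const_functor_simps(2)[OF z[OF that]] by (simp add: e)
    then have "Component \<theta> = (\<lambda>A\<in>Obj C. AMap M (z A) \<cdot>\<^bsub>D\<^esub> u)"
      using nt unfolding is_ntrans_def by (intro extensionalityI[of _ "Obj C"]) auto
    then show "\<theta> = ?\<eta>" using e by simp
  qed
  have "\<exists>h. h \<in> Hom D (OMap M A) Q" if "A \<in> Obj C" for A
    using Q functor_obj[OF MF that] unfolding terminal_def by blast
  then obtain t where t: "\<And>A. A \<in> Obj C \<Longrightarrow> t A \<in> Hom D (OMap M A) Q" by metis
  let ?\<tau> = "\<lparr>NSrc = M, NTrg = ?N, Component = (\<lambda>A\<in>Obj C. t A)\<rparr>"
  show "\<exists>!f. f \<in> Hom (product_functor_category C D) M ?N"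
  proof (rule ex1I[of _ ?\<tau>])
    have "is_ntrans C D ?\<tau>"
    proof (rule ntransI[OF MF N])
      show "(\<lambda>A\<in>Obj C. t A) A \<in> Hom D (OMap M A) (OMap ?N A)" if "A \<in> Obj C" for A
        using t[OF that] that by (simp add: const_functor_simps)
      fix f A B assume f: "f \<in> Hom C A B"
      note A = C.Hom_dom_obj[OF f] and B = C.Hom_cod_obj[OF f]
      have "t A = t B \<cdot>\<^bsub>D\<^esub> AMap M f"
        by (rule terminal_eq[OF Q functor_obj[OF MF A] t[OF A] D.comp_hom[OF functor_hom[OF MF f] t[OF B]]])
      then show "AMap ?N f \<cdot>\<^bsub>D\<^esub> (\<lambda>A\<in>Obj C. t A) A = (\<lambda>A\<in>Obj C. t A) B \<cdot>\<^bsub>D\<^esub> AMap M f"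
        using A B D.ident_left[OF t[OF A]] by (simp add: const_functor_simps(2)[OF f])
    qed simp
    then show "?\<tau> \<in> Hom (product_functor_category C D) M ?N"
      unfolding Hom_functor_cat using M const_functor_model by simp
    fix \<theta> assume \<theta>: "\<theta> \<in> Hom (product_functor_category C D) M ?N"
    then have nt: "is_ntrans C D \<theta>" and e: "NSrc \<theta> = M" "NTrg \<theta> = ?N" unfolding Hom_functor_cat by auto
    have "Component \<theta> A = t A" if "A \<in> Obj C" for A
      using terminal_eq[OF Q functor_obj[OF MF that] _ t[OF that]] ntrans_hom[OF nt that] that by (simp add: e const_functor_simps)
    then have "Component \<theta> = (\<lambda>A\<in>Obj C. t A)"
      using nt unfolding is_ntrans_def by (intro extensionalityI[of _ "Obj C"]) auto
    then show "\<theta> = ?\<tau>" using e by simp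
  qed
qed

text \<open>Through the zero object there is a map \<open>\<theta>\<close> from the constant functor to \<open>M\<close>. Naturality at the
  constants \<open>u\<close> and \<open>v\<close> equates the composites of \<open>M u\<close> and of \<open>M v\<close> with the component of \<open>\<theta>\<close> at \<open>T0\<close>.
  This component is an arrow between terminal objects and can be cancelled.\<close>

lemma pointed_identifies_constants:
  assumes p: "pointed (product_functor_category C D)" and T0: "terminal C T0"
    and u: "u \<in> Hom C T0 A" and v: "v \<in> Hom C T0 A" and M: "M \<in> Obj (product_functor_category C D)"
  shows "AMap M u = AMap M v"
proof -
  let ?N = "const_functor C D Q"
  obtain Z where Z: "zero_object (product_functor_category C D) Z" using p unfolding pointed_def by blast
  obtain \<xi> where \<xi>: "\<xi> \<in> Hom (product_functor_category C D) ?N Z"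
    using Z const_functor_model unfolding zero_object_def by blast
  obtain \<eta> where \<eta>: "\<eta> \<in> Hom (product_functor_category C D) Z M"
    using Z M unfolding zero_object_def by blast
  from functor_cat_comp[OF C D \<xi> \<eta>]
  obtain \<theta> where nt: "is_ntrans C D \<theta>" and e: "NSrc \<theta> = ?N" "NTrg \<theta> = M" unfolding Hom_functor_cat by blast
  have MF: "is_functor C D M" using M unfolding Obj_functor_cat by blast
  have T0O: "T0 \<in> Obj C" using T0 unfolding terminal_def by blast
  let ?w = "Component \<theta> T0"
  have w: "?w \<in> Hom D Q (OMap M T0)" using ntrans_hom[OF nt T0O] T0O by (simp add: e const_functor_simps)
  have MTO: "OMap M T0 \<in> Obj D" by (rule functor_obj[OF MF T0O])
  obtain w' where w': "w' \<in> Hom D (OMap M T0) Q" using Q MTO unfolding terminal_def by blast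
  have ww: "?w \<cdot>\<^bsub>D\<^esub> w' = Ident D (OMap M T0)"
    by (rule terminal_eq[OF functor_cat_terminal[OF M T0] MTO D.comp_hom[OF w' w] D.ident_hom[OF MTO]])
  have "AMap M u \<cdot>\<^bsub>D\<^esub> ?w = AMap M v \<cdot>\<^bsub>D\<^esub> ?w"
    using ntrans_natural[OF nt u] ntrans_natural[OF nt v] by (simp add: e const_functor_simps(2)[OF u] const_functor_simps(2)[OF v])
  moreover have "AMap M x = (AMap M x \<cdot>\<^bsub>D\<^esub> ?w) \<cdot>\<^bsub>D\<^esub> w'" if "x \<in> Hom C T0 A" for x
    using D.comp_assoc[OF w' w functor_hom[OF MF that]] ww D.ident_right[OF functor_hom[OF MF that]] by simp
  ultimately show ?thesis using u v by metis
qed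

end

lemma precomposition_functor:
  assumes S: "lawvere_theory S" and T: "lawvere_theory T" and F: "theory_morphism S T F"
  shows "is_functor (coalg_models K U T) (coalg_models K U S) (precomposition K U T S F)"
proof -
  let ?D = "Coalg_coc K U" and ?B = "base S" and ?C = "base T"
  interpret B: category ?B using S unfolding lawvere_theory_def by blast
  interpret C: category ?C using T unfolding lawvere_theory_def by blast
  interpret D: category ?D by (rule category_Coalg)
  note cB = B.category_axioms and cC = C.category_axioms and cD = D.category_axioms
  let ?\<Phi> = "precomposition K U T S F"
  have FF: "is_functor ?B ?C F" "preserves_finite_products F" using F unfolding theory_morphism_def by auto
  have obj: "functor_comp M F \<in> Obj (coalg_models K U S)" if "M \<in> Obj (coalg_models K U T)" for M
  proof -
    have M: "is_functor ?C ?D M" "preserves_finite_products M" using that unfolding coalg_models_def Obj_functor_cat by auto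
    have "is_functor ?B ?D (functor_comp M F)"
      by (rule functor_comp_functor[OF _ _ _ FF(1) M(1)])
        (auto intro: Hom_Arr[OF B.ident_hom] Hom_Arr[OF B.comp_hom[OF Hom_Arr_self]] B.dom_obj B.cod_obj Hom_Arr_self
          simp: Hom_def)
    then show ?thesis
      unfolding coalg_models_def Obj_functor_cat using functor_comp_preserves[OF cB FF M] by blast
  qed
  have O: "OMap (functor_comp M F) A = OMap M (OMap F A)" if "A \<in> Obj ?B" "M \<in> Obj (coalg_models K U T)" for M A
    using that FF(1) unfolding functor_comp_def is_functor_def by (simp add: compose_def)
  have A: "AMap (functor_comp M F) f = AMap M (AMap F f)" if "f \<in> Hom ?B X Y" "M \<in> Obj (coalg_models K U T)" for M f X Y
    using Hom_Arr[OF that(1)] FF(1) unfolding functor_comp_def is_functor_def by (simp add: compose_def)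
  note FO = functor_obj[OF FF(1)]
  let ?p = "\<lambda>\<eta>. \<lparr>NSrc = functor_comp (NSrc \<eta>) F, NTrg = functor_comp (NTrg \<eta>) F,
         Component = (\<lambda>A\<in>Obj ?B. Component \<eta> (OMap F A))\<rparr>"
  have arr: "?p \<eta> \<in> Arr (coalg_models K U S)" if \<eta>: "\<eta> \<in> Arr (coalg_models K U T)" for \<eta>
  proof -
    have nt: "is_ntrans ?C ?D \<eta>" and M: "NSrc \<eta> \<in> Obj (coalg_models K U T)" "NTrg \<eta> \<in> Obj (coalg_models K U T)"
      using \<eta> unfolding coalg_models_def Arr_functor_cat by auto
    have "is_ntrans ?B ?D (?p \<eta>)"
    proof (rule ntransI)
      show "is_functor ?B ?D (functor_comp (NSrc \<eta>) F)" "is_functor ?B ?D (functor_comp (NTrg \<eta>) F)"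
        using obj[OF M(1)] obj[OF M(2)] unfolding coalg_models_def Obj_functor_cat by auto
      show "(\<lambda>A\<in>Obj ?B. Component \<eta> (OMap F A)) X \<in> Hom ?D (OMap (functor_comp (NSrc \<eta>) F) X) (OMap (functor_comp (NTrg \<eta>) F) X)"
        if "X \<in> Obj ?B" for X
        unfolding O[OF that M(1)] O[OF that M(2)] using ntrans_hom[OF nt FO[OF that]] that by simp
      show "AMap (functor_comp (NTrg \<eta>) F) f \<cdot>\<^bsub>?D\<^esub> (\<lambda>A\<in>Obj ?B. Component \<eta> (OMap F A)) X
          = (\<lambda>A\<in>Obj ?B. Component \<eta> (OMap F A)) Y \<cdot>\<^bsub>?D\<^esub> AMap (functor_comp (NSrc \<eta>) F) f" if f: "f \<in> Hom ?B X Y" for f X Y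
        unfolding A[OF f M(1)] A[OF f M(2)]
        using ntrans_natural[OF nt functor_hom[OF FF(1) f]] B.Hom_dom_obj[OF f] B.Hom_cod_obj[OF f] by simp
    qed simp
    then show ?thesis unfolding coalg_models_def Arr_functor_cat using obj[OF M(1)] obj[OF M(2)] unfolding coalg_models_def by simp
  qed
  have AP: "AMap ?\<Phi> \<eta> = ?p \<eta>" if "\<eta> \<in> Arr (coalg_models K U T)" for \<eta>
    unfolding precomposition_def using that by simp
  have OP: "OMap ?\<Phi> M = functor_comp M F" if "M \<in> Obj (coalg_models K U T)" for M
    unfolding precomposition_def using that by simp
  show ?thesis
    unfolding is_functor_def
  proof (intro conjI ballI impI)
    show "Src ?\<Phi> = coalg_models K U T" "Trg ?\<Phi> = coalg_models K U S" unfolding precomposition_def by simp_all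
    show "OMap ?\<Phi> \<in> Obj (coalg_models K U T) \<rightarrow>\<^sub>E Obj (coalg_models K U S)"
      unfolding precomposition_def using obj by auto
    show "AMap ?\<Phi> \<in> Arr (coalg_models K U T) \<rightarrow>\<^sub>E Arr (coalg_models K U S)"
      by (rule PiE_I) (use AP arr in \<open>simp_all add: precomposition_def\<close>)
  next
    fix M assume M: "M \<in> Obj (coalg_models K U T)"
    have IM: "Ident (coalg_models K U T) M \<in> Arr (coalg_models K U T)"
      using functor_cat_ident[OF cC cD] M unfolding coalg_models_def by blast
    have "(\<lambda>A\<in>Obj ?B. (\<lambda>A\<in>Obj ?C. Ident ?D (OMap M A)) (OMap F A)) = (\<lambda>A\<in>Obj ?B. Ident ?D (OMap (functor_comp M F) A))"
      by (rule restrict_ext) (simp add: FO O M)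
    then show "AMap ?\<Phi> (Ident (coalg_models K U T) M) = Ident (coalg_models K U S) (OMap ?\<Phi> M)"
      unfolding AP[OF IM] OP[OF M] unfolding coalg_models_def Ident_functor_cat by simp
  next
    fix \<eta> assume \<eta>: "\<eta> \<in> Arr (coalg_models K U T)"
    then have M: "NSrc \<eta> \<in> Obj (coalg_models K U T)" "NTrg \<eta> \<in> Obj (coalg_models K U T)"
      unfolding coalg_models_def Arr_functor_cat by auto
    show "Dom (coalg_models K U S) (AMap ?\<Phi> \<eta>) = OMap ?\<Phi> (Dom (coalg_models K U T) \<eta>)"
      "Cod (coalg_models K U S) (AMap ?\<Phi> \<eta>) = OMap ?\<Phi> (Cod (coalg_models K U T) \<eta>)"
      unfolding AP[OF \<eta>] using OP M unfolding coalg_models_def Dom_functor_cat Cod_functor_cat by simp_all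
    fix \<theta> assume \<theta>: "\<theta> \<in> Arr (coalg_models K U T)"
      and e: "Dom (coalg_models K U T) \<theta> = Cod (coalg_models K U T) \<eta>"
    have "\<theta> \<cdot>\<^bsub>coalg_models K U T\<^esub> \<eta> \<in> Hom (coalg_models K U T) (Dom (coalg_models K U T) \<eta>) (Cod (coalg_models K U T) \<theta>)"
      using functor_cat_comp[OF cC cD] Hom_Arr_self[OF \<eta>] Hom_Arr_self[OF \<theta>] e unfolding coalg_models_def by metis
    from Hom_Arr[OF this] have c: "\<theta> \<cdot>\<^bsub>coalg_models K U T\<^esub> \<eta> \<in> Arr (coalg_models K U T)" .
    have "(\<lambda>A\<in>Obj ?B. (\<lambda>A\<in>Obj ?C. Component \<theta> A \<cdot>\<^bsub>?D\<^esub> Component \<eta> A) (OMap F A))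
       = (\<lambda>A\<in>Obj ?B. (\<lambda>A\<in>Obj ?B. Component \<theta> (OMap F A)) A \<cdot>\<^bsub>?D\<^esub> (\<lambda>A\<in>Obj ?B. Component \<eta> (OMap F A)) A)"
      by (rule restrict_ext) (simp add: FO)
    then show "AMap ?\<Phi> (\<theta> \<cdot>\<^bsub>coalg_models K U T\<^esub> \<eta>) = AMap ?\<Phi> \<theta> \<cdot>\<^bsub>coalg_models K U S\<^esub> AMap ?\<Phi> \<eta>"
      unfolding AP[OF c] AP[OF \<eta>] AP[OF \<theta>] unfolding coalg_models_def Comp_functor_cat by simp
  qed
qed

section \<open>The model of grouplike elements\<close>

lemma induced_map_ident:
  assumes E: "grouplike_coalg K P E \<kappa>" and id: "\<And>q. q \<in> P \<Longrightarrow> \<phi> q = q"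
  shows "induced_map K P E \<kappa> E \<kappa> \<phi> = (\<lambda>x\<in>carrier E. x)"
proof -
  interpret E: grouplike_coalg K P E \<kappa> by (rule E)
  have \<phi>: "\<phi> \<in> P \<rightarrow> P" using id by auto
  note l = induced_map_linear[OF E E \<phi>] linear_map_id[OF E.module_C]
  show ?thesis
    by (rule linear_map_eqI[OF l], rule E.is_linear_eq[OF E.module_C l[THEN linear_map_is_linear]])
      (simp_all add: induced_map_basis[OF E E \<phi>] id E.b_closed)
qed

lemma induced_map_compose:
  assumes E: "grouplike_coalg K P E \<kappa>" and C: "grouplike_coalg K X C \<iota>" and D: "grouplike_coalg K Y D \<zeta>"
    and \<phi>: "\<phi> \<in> P \<rightarrow> X" and \<psi>: "\<psi> \<in> X \<rightarrow> Y" and \<chi>: "\<And>q. q \<in> P \<Longrightarrow> \<chi> q = \<psi> (\<phi> q)"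
  shows "induced_map K P E \<kappa> D \<zeta> \<chi> = compose (carrier E) (induced_map K X C \<iota> D \<zeta> \<psi>) (induced_map K P E \<kappa> C \<iota> \<phi>)"
proof -
  interpret E: grouplike_coalg K P E \<kappa> by (rule E)
  have \<chi>Y: "\<chi> \<in> P \<rightarrow> Y" using \<phi> \<psi> \<chi> by auto
  have \<phi>X: "\<phi> q \<in> X" if "q \<in> P" for q using \<phi> that by auto
  note l = induced_map_linear[OF E D \<chi>Y] linear_map_comp[OF E.module_C induced_map_linear[OF E C \<phi>] induced_map_linear[OF C D \<psi>]]
  note m = grouplike_coalg.module_C[OF D]
  show ?thesis
    by (rule linear_map_eqI[OF l], rule E.is_linear_eq[OF m l[THEN linear_map_is_linear]])
      (simp_all add: induced_map_basis[OF E D \<chi>Y] induced_map_basis[OF E C \<phi>] induced_map_basis[OF C D \<psi>] \<chi> \<phi>X E.b_closed compose_def)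
qed

text \<open>The model $A \mapsto \mathbb{K}[\mathrm{Hom}(T_0, A)]$: representable functors preserve products, and so
  does linearisation. It separates the arrows out of \<open>T0\<close>, as is seen on the basis vector of the
  identity of \<open>T0\<close>.\<close>

lemma grouplike_model:
  fixes K :: "('k, 'r) ring_scheme" and B :: "('o, 'a) cat" and U :: "'v set"
  assumes K: "cring K" and nontrivial: "\<one>\<^bsub>K\<^esub> \<noteq> \<zero>\<^bsub>K\<^esub>" and U: "infinite U" "carrier K \<lesssim> U" "Arr B \<lesssim> U"
    and B: "category B" and T0: "T0 \<in> Obj B"
  shows "\<exists>M \<in> Obj (product_functor_category B (Coalg_coc K U)).
     \<forall>A u v. u \<in> Hom B T0 A \<longrightarrow> v \<in> Hom B T0 A \<longrightarrow> AMap M u = AMap M v \<longrightarrow> u = v"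
proof -
  interpret B: category B by (rule B)
  let ?D = "Coalg_coc K U"
  let ?X = "\<lambda>A. Hom B T0 A"
  have "\<exists>\<iota>. inj_on \<iota> (carrier (free_module K (?X A))) \<and> \<iota> ` carrier (free_module K (?X A)) \<subseteq> U" for A
  proof -
    have "?X A \<subseteq> Arr B" unfolding Hom_def by blast
    then have "?X A \<lesssim> U" by (rule lepoll_trans[OF subset_imp_lepoll U(3)])
    from free_module_lepoll[OF U(1) this U(2)] show ?thesis unfolding lepoll_def .
  qed
  then obtain \<iota> where \<iota>: "\<And>A. inj_on (\<iota> A) (carrier (free_module K (?X A)))" "\<And>A. \<iota> A ` carrier (free_module K (?X A)) \<subseteq> U"
    by metis
  let ?C = "\<lambda>A. grouplike K (?X A) (\<iota> A)"
  have g: "grouplike_coalg K (?X A) (?C A) (\<iota> A)" for A by (rule grouplike_coalg_grouplike[OF K \<iota>(1)])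
  have CU: "carrier (?C A) \<subseteq> U" for A unfolding grouplike_carrier by (rule \<iota>(2))
  have CO: "?C A \<in> Obj ?D" for A
    unfolding Obj_Coalg using CU grouplike_coalg.cocommutative[OF g] by (simp add: coalg_def)
  let ?h = "\<lambda>f. induced_map K (?X (Dom B f)) (?C (Dom B f)) (\<iota> (Dom B f)) (?C (Cod B f)) (\<iota> (Cod B f)) (\<lambda>x. f \<cdot>\<^bsub>B\<^esub> x)"
  let ?m = "\<lambda>f. (?C (Dom B f), ?h f, ?C (Cod B f))"
  define M where "M = \<lparr>Src = B, Trg = ?D, OMap = (\<lambda>A\<in>Obj B. ?C A), AMap = (\<lambda>f\<in>Arr B. ?m f)\<rparr>"
  have post: "(\<lambda>x. f \<cdot>\<^bsub>B\<^esub> x) \<in> ?X A \<rightarrow> ?X A'" if "f \<in> Hom B A A'" for f A A'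
    using B.comp_hom[OF _ that] by blast
  have mH: "?m f \<in> Hom ?D (?C (Dom B f)) (?C (Cod B f))" if "f \<in> Arr B" for f
    unfolding Hom_Coalg using CO induced_map_hom[OF g g post[OF Hom_Arr_self[OF that]]] by blast
  have MF: "is_functor B ?D M"
    unfolding is_functor_def
  proof (intro conjI ballI impI)
    show "Src M = B" "Trg M = ?D" unfolding M_def by simp_all
    show "OMap M \<in> Obj B \<rightarrow>\<^sub>E Obj ?D" unfolding M_def using CO by simp
    show "AMap M \<in> Arr B \<rightarrow>\<^sub>E Arr ?D" unfolding M_def using Hom_Arr[OF mH] by simp
  next
    fix f assume f: "f \<in> Arr B"
    show "Dom ?D (AMap M f) = OMap M (Dom B f)" "Cod ?D (AMap M f) = OMap M (Cod B f)"
      unfolding M_def using f B.dom_obj[OF f] B.cod_obj[OF f] Hom_Dom[OF mH[OF f]] Hom_Cod[OF mH[OF f]] by simp_all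
    fix k assume k: "k \<in> Arr B" and kf: "Dom B k = Cod B f"
    have kH: "k \<in> Hom B (Cod B f) (Cod B k)" using Hom_Arr_self[OF k] kf by simp
    note c = B.comp_hom[OF Hom_Arr_self[OF f] kH]
    have "?h (k \<cdot>\<^bsub>B\<^esub> f) = compose (carrier (?C (Dom B f))) (?h k) (?h f)"
      unfolding Hom_Dom[OF c] Hom_Cod[OF c] kf
      by (rule induced_map_compose[OF g g g post[OF Hom_Arr_self[OF f]] post[OF kH] B.comp_assoc[OF _ Hom_Arr_self[OF f] kH]])
    then show "AMap M (k \<cdot>\<^bsub>B\<^esub> f) = AMap M k \<cdot>\<^bsub>?D\<^esub> AMap M f"
      unfolding M_def using f k Hom_Arr[OF c] by (simp add: Comp_Coalg Hom_Dom[OF c] Hom_Cod[OF c] kf)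
  next
    fix A assume A: "A \<in> Obj B"
    note i = B.ident_hom[OF A]
    have "?h (Ident B A) = (\<lambda>x\<in>carrier (?C A). x)"
      unfolding Hom_Dom[OF i] Hom_Cod[OF i] by (rule induced_map_ident[OF g B.ident_left])
    then show "AMap M (Ident B A) = Ident ?D (OMap M A)"
      unfolding M_def using A Hom_Arr[OF i] by (simp add: Ident_Coalg Hom_Dom[OF i] Hom_Cod[OF i])
  qed
  have "preserves_finite_products M"
    unfolding preserves_finite_products_def
  proof (intro allI impI)
    fix n A P p assume "is_product (Src M) n A P p"
    then have P: "is_product B n A P p" unfolding M_def by simp
    have bij: "bij_betw (\<lambda>q. \<lambda>i\<in>{..<n}. p i \<cdot>\<^bsub>B\<^esub> q) (?X P) (PiE {..<n} (\<lambda>i. ?X (A i)))"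
      unfolding bij_betw_def
    proof
      show "inj_on (\<lambda>q. \<lambda>i\<in>{..<n}. p i \<cdot>\<^bsub>B\<^esub> q) (?X P)"
      proof (rule inj_onI)
        fix q q' assume q: "q \<in> ?X P" "q' \<in> ?X P" and eq: "(\<lambda>i\<in>{..<n}. p i \<cdot>\<^bsub>B\<^esub> q) = (\<lambda>i\<in>{..<n}. p i \<cdot>\<^bsub>B\<^esub> q')"
        show "q = q'"
          by (rule B.product_eqI[OF P q]) (use fun_cong[OF eq] in \<open>metis lessThan_iff restrict_apply'\<close>)
      qed
      show "(\<lambda>q. \<lambda>i\<in>{..<n}. p i \<cdot>\<^bsub>B\<^esub> q) ` ?X P = PiE {..<n} (\<lambda>i. ?X (A i))"
      proof (intro equalityI subsetI)
        fix s assume "s \<in> (\<lambda>q. \<lambda>i\<in>{..<n}. p i \<cdot>\<^bsub>B\<^esub> q) ` ?X P"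
        then obtain q where q: "q \<in> ?X P" "s = (\<lambda>i\<in>{..<n}. p i \<cdot>\<^bsub>B\<^esub> q)" by blast
        show "s \<in> PiE {..<n} (\<lambda>i. ?X (A i))"
          unfolding q(2) by (rule restrict_PiE_iff[THEN iffD2]) (use B.comp_hom[OF q(1) is_product_proj[OF P]] in simp)
      next
        fix s assume s: "s \<in> PiE {..<n} (\<lambda>i. ?X (A i))"
        then have sX: "s i \<in> ?X (A i)" if "i < n" for i using that by auto
        let ?l = "lift B n P p T0 s"
        have l: "?l \<in> ?X P" by (rule lift_hom[OF P T0]) (rule sX)
        have "p i \<cdot>\<^bsub>B\<^esub> ?l = s i" if "i < n" for i by (rule proj_lift[OF P T0 _ that]) (rule sX)
        then have "(\<lambda>i\<in>{..<n}. p i \<cdot>\<^bsub>B\<^esub> ?l) = s"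
          using s by (intro extensionalityI[of _ "{..<n}"]) (auto simp: PiE_def)
        from this[symmetric] show "s \<in> (\<lambda>q. \<lambda>i\<in>{..<n}. p i \<cdot>\<^bsub>B\<^esub> q) ` ?X P"
          by (rule image_eqI[where f = "\<lambda>q. \<lambda>i\<in>{..<n}. p i \<cdot>\<^bsub>B\<^esub> q", OF _ l])
      qed
    qed
    have "is_product ?D n (\<lambda>i. ?C (A i)) (?C P) (\<lambda>i. (?C P, induced_map K (?X P) (?C P) (\<iota> P) (?C (A i)) (\<iota> (A i)) (\<lambda>x. p i \<cdot>\<^bsub>B\<^esub> x), ?C (A i)))"
      by (rule is_product_grouplike[OF g g bij CU CU])
    then have "is_product ?D n (\<lambda>i. OMap M (A i)) (?C P) (\<lambda>i. AMap M (p i))"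
    proof (rule is_product_cong)
      fix i assume i: "i < n"
      note pi = is_product_proj[OF P i]
      show "?C (A i) = OMap M (A i)" unfolding M_def using B.Hom_cod_obj[OF pi] by simp
      show "(?C P, induced_map K (?X P) (?C P) (\<iota> P) (?C (A i)) (\<iota> (A i)) (\<lambda>x. p i \<cdot>\<^bsub>B\<^esub> x), ?C (A i)) = AMap M (p i)"
        unfolding M_def using Hom_Arr[OF pi] by (simp add: Hom_Dom[OF pi] Hom_Cod[OF pi])
    qed
    moreover have "OMap M P = ?C P" unfolding M_def using is_product_obj[OF P] by simp
    ultimately show "is_product (Trg M) n (\<lambda>i. OMap M (A i)) (OMap M P) (\<lambda>i. AMap M (p i))"
      by (simp add: M_def)
  qed
  then have "M \<in> Obj (product_functor_category B ?D)" using MF unfolding Obj_functor_cat by blast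
  moreover have "u = v" if u: "u \<in> ?X A" and v: "v \<in> ?X A" and eq: "AMap M u = AMap M v" for A u v
  proof -
    have mu: "AMap M u = ?m u" and mv: "AMap M v = ?m v"
      unfolding M_def using Hom_Arr[OF u] Hom_Arr[OF v] by simp_all
    have h: "induced_map K (?X T0) (?C T0) (\<iota> T0) (?C A) (\<iota> A) (\<lambda>x. u \<cdot>\<^bsub>B\<^esub> x) = induced_map K (?X T0) (?C T0) (\<iota> T0) (?C A) (\<iota> A) (\<lambda>x. v \<cdot>\<^bsub>B\<^esub> x)"
      using eq unfolding mu mv Hom_Dom[OF u] Hom_Dom[OF v] Hom_Cod[OF u] Hom_Cod[OF v] by (simp only: prod.inject)
    note i = B.ident_hom[OF T0]
    have "\<iota> A (basis_vec K u) = \<iota> A (basis_vec K v)"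
      using fun_cong[OF h, of "\<iota> T0 (basis_vec K (Ident B T0))"]
      unfolding induced_map_basis[OF g g post[OF u] i] induced_map_basis[OF g g post[OF v] i] B.ident_right[OF u] B.ident_right[OF v] .
    then have "basis_vec K u = basis_vec K v"
      using \<iota>(1)[of A] basis_vec_carrier[OF K u] basis_vec_carrier[OF K v] unfolding inj_on_def by blast
    from fun_cong[OF this, of u] show "u = v" using nontrivial by (auto simp: basis_vec_def split: if_splits)
  qed
  ultimately show ?thesis by blast
qed

text \<open>The case of no factors in \<open>is_product_grouplike\<close>: the base field, as the linearisation of a point.\<close>

lemma terminal_coalgebra:
  fixes K :: "('k, 'r) ring_scheme" and U :: "'v set"
  assumes K: "cring K" and U: "infinite U" "carrier K \<lesssim> U"
  shows "\<exists>Q. terminal (Coalg_coc K U) Q"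
proof -
  have "{()} \<lesssim> U" using U(1) by (simp add: finite_lepoll_infinite)
  from free_module_lepoll[OF U(1) this U(2)]
  obtain \<iota> where \<iota>: "inj_on \<iota> (carrier (free_module K {()}))" "\<iota> ` carrier (free_module K {()}) \<subseteq> U"
    unfolding lepoll_def by blast
  let ?Q = "grouplike K {()} \<iota>"
  have g: "grouplike_coalg K {()} ?Q \<iota>" by (rule grouplike_coalg_grouplike[OF K \<iota>(1)])
  have "is_product (Coalg_coc K U) 0 (\<lambda>_. ?Q) ?Q (\<lambda>i. (?Q, induced_map K {()} ?Q \<iota> ?Q \<iota> (\<lambda>q. q), ?Q))"
    by (rule is_product_grouplike[where X = "\<lambda>_. {()}", OF g g])
      (use \<iota>(2) in \<open>auto simp: grouplike_carrier bij_betw_def\<close>)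
  from terminal_iff_product[THEN iffD2, OF this] show ?thesis by blast
qed

section \<open>Pointed categories of models with an algebraic functor to Hopf algebras\<close>

theorem proposition7p1:
  fixes K :: "('k, 'r) ring_scheme"
    and T :: "('o, 'a) lawvere"
    and U :: "'v set"
  assumes "field K"
    and "lawvere_theory T"
    and "infinite U" and "carrier K \<lesssim> U" and "Arr (base T) \<lesssim> U"
  shows "Omega_Hopf_category K U (coalg_models K U T) \<longleftrightarrow>
    pointed (coalg_models K U T) \<and>
    (\<exists>\<Phi>. algebraic_functor K U T theory_of_groups \<Phi> \<and> Trg \<Phi> = Hopf_coc K U)"
proof -
  interpret K: field K by fact
  have Kc: "cring K" by (rule K.is_cring)
  note T = \<open>lawvere_theory T\<close>
  interpret B: category "base T" using T unfolding lawvere_theory_def by blast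
  note cB = B.category_axioms and cD = category_Coalg[of K U]
  obtain Q where Q: "terminal (Coalg_coc K U) Q" using terminal_coalgebra[OF Kc assms(3,4)] by blast
  have T0: "terminal (base T) (pow T 0)" if "lawvere_theory T" for T :: "('o, 'a) lawvere"
    by (rule terminal_iff_product[THEN iffD2, OF power_product[OF that]])
  show ?thesis
  proof
    assume "Omega_Hopf_category K U (coalg_models K U T)"
    then obtain T' :: "('o, 'a) lawvere" where T': "Omega_group_theory T'" and eq: "coalg_models K U T = coalg_models K U T'"
      unfolding Omega_Hopf_category_def by blast
    let ?N = "const_functor (base T) (Coalg_coc K U) Q"
    \<comment> \<open>A functor records its source. So equality of the categories of models gives equality of the base categories, once there is a model at all; the generators may still differ.\<close>
    have "?N \<in> Obj (coalg_models K U T)"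
      unfolding coalg_models_def by (rule const_functor_model[OF cB cD Q])
    then have "?N \<in> Obj (coalg_models K U T')" using eq by simp
    then have base: "base T' = base T"
      unfolding coalg_models_def Obj_functor_cat is_functor_def const_functor_def by simp
    obtain m e s where gs: "group_structure T' m e s" and e: "Hom (base T) (pow T' 0) (pow T' 1) = {e}" and LT': "lawvere_theory T'"
      using T' unfolding Omega_group_theory_def base by blast
    note P' = power_product[OF LT', unfolded base]
    have range: "Obj (base T) = range (pow T')" using LT' unfolding lawvere_theory_def base by blast
    have zero: "\<exists>!f. f \<in> Hom (base T) (pow T' 0) A" if A: "A \<in> Obj (base T)" for A
    proof -
      obtain k where k: "A = pow T' k" using A range by blast
      have O0: "pow T' 0 \<in> Obj (base T)" using range by blast
      have "\<exists>!f. f \<in> Hom (base T) (pow T' 0) (pow T' k) \<and> (\<forall>i<k. prj T' k i \<cdot>\<^bsub>base T\<^esub> f = e)"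
        by (rule is_product_ex1[OF P' O0]) (use e in auto)
      moreover have "prj T' k i \<cdot>\<^bsub>base T\<^esub> f = e" if "f \<in> Hom (base T) (pow T' 0) (pow T' k)" "i < k" for f i
        using B.comp_hom[OF that(1) is_product_proj[OF P' that(2)]] e by blast
      ultimately show ?thesis unfolding k by blast
    qed
    have "pointed (coalg_models K U T)"
      using zero_object_const_functor[OF cB cD Q T0[OF LT', unfolded base] zero] unfolding coalg_models_def pointed_def by blast
    moreover have "\<exists>\<Phi>. algebraic_functor K U T theory_of_groups \<Phi> \<and> Trg \<Phi> = Hopf_coc K U"
    proof -
      obtain mul unit neg where "natural_group (base T) (pow T' 1) mul unit neg"
        using natural_group_of_structure[OF LT' gs] unfolding base by blast
      \<comment> \<open>The group structure lives on the generator of \<open>T'\<close>, of which the generator of \<open>T\<close> is a power.\<close>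
      moreover obtain k where "pow T 1 = pow T' k" using range pow_obj[OF T] by blast
      ultimately obtain mul unit neg where "natural_group (base T) (pow T 1) mul unit neg"
        using natural_group.natural_group_power[OF _ P', of mul unit neg k] by metis
      then obtain F where F: "theory_morphism theory_of_groups T F"
        using natural_group_theory_morphism[OF T] by blast
      have "algebraic_functor K U T theory_of_groups (precomposition K U T theory_of_groups F)"
        unfolding algebraic_functor_def using precomposition_functor[OF lawvere_Grp T F] F by blast
      moreover have "Trg (precomposition K U T theory_of_groups F) = Hopf_coc K U"
        unfolding precomposition_def Hopf_coc_def by simp
      ultimately show ?thesis by blast
    qed
    ultimately show "pointed (coalg_models K U T) \<and>
      (\<exists>\<Phi>. algebraic_functor K U T theory_of_groups \<Phi> \<and> Trg \<Phi> = Hopf_coc K U)" by blast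
  next
    assume R: "pointed (coalg_models K U T) \<and>
      (\<exists>\<Phi>. algebraic_functor K U T theory_of_groups \<Phi> \<and> Trg \<Phi> = Hopf_coc K U)"
    then obtain F where F: "theory_morphism theory_of_groups T F" unfolding algebraic_functor_def by blast
    obtain mul unit neg where ng: "natural_group (base T) (pow T 1) mul unit neg"
      using theory_morphism_natural_group[OF T F] by blast
    let ?e = "unit (pow T 0)"
    note gs = structure_of_natural_group[OF T ng]
    have e: "?e \<in> Hom (base T) (pow T 0) (pow T 1)"
      by (rule natural_group.unit_hom[OF ng pow_obj[OF T]])
    obtain M where M: "M \<in> Obj (product_functor_category (base T) (Coalg_coc K U))"
      and sep: "\<And>A u v. u \<in> Hom (base T) (pow T 0) A \<Longrightarrow> v \<in> Hom (base T) (pow T 0) A \<Longrightarrow> AMap M u = AMap M v \<Longrightarrow> u = v"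
      using grouplike_model[OF Kc K.one_not_zero assms(3,4,5) cB pow_obj[OF T]] by blast
    \<comment> \<open>All models identify \<open>u\<close> with the unit, but \<open>M\<close> separates constants.\<close>
    have "u = ?e" if "u \<in> Hom (base T) (pow T 0) (pow T 1)" for u
      using sep[OF that e] pointed_identifies_constants[OF cB cD Q _ T0[OF T] that e M] R unfolding coalg_models_def by blast
    then have single: "Hom (base T) (pow T 0) (pow T 1) = {?e}" using e by blast
    have "f \<cdot>\<^bsub>base T\<^esub> tuple T n (pow T 0) (\<lambda>_. ?e) = ?e" if f: "f \<in> Hom (base T) (pow T n) (pow T 1)" for n f
    proof -
      have "tuple T n (pow T 0) (\<lambda>_. ?e) \<in> Hom (base T) (pow T 0) (pow T n)"
        unfolding tuple_eq_lift by (rule lift_hom[OF power_product[OF T] pow_obj[OF T] e])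
      from B.comp_hom[OF this f] show ?thesis using single by blast
    qed
    then have "Omega_group_theory T" unfolding Omega_group_theory_def using T gs single by blast
    then show "Omega_Hopf_category K U (coalg_models K U T)" unfolding Omega_Hopf_category_def by blast
  qed
qed

end
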